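(* Let $(M,J)$ and $(M',J')$ be almost complex manifolds and let $f\colon M\to M'$ be a pseudo-holomorphic map. Then the pullback $f^*$ of forms induces a morphism of differential $\mathbb{Z}$-graded algebras $$f^*\colon H^\bullet_{d+d^c}(M',J')\longrightarrow H^\bullet_{d+d^c}(M,J),$$ and a morphism of differential $\mathbb{Z}$-graded modules over $H^\bullet_{d+d^c}$ $$f^*\colon H^\bullet_{dd^c}(M',J')\longrightarrow H^\bullet_{dd^c}(M,J).$$ Furthermore, if $f$ is also a diffeomorphism, then both maps $f^*$ are isomorphisms.
   Context: An almost complex manifold $(M,J)$ is a smooth $2m$-manifold with a smooth $(1,1)$-tensor field $J$, $J^2=-\mathrm{Id}$. $A^k$ is the space of smooth complex $k$-forms, with bigrading $A^k=\bigoplus_{p+q=k}A^{p,q}$ induced by $J$. $J$ acts on forms by duality, as an algebra automorphism: $J\alpha=i^{p-q}\alpha$ for $\alpha\in A^{p,q}$. Set $d^c:=J^{-1}dJ$. A smooth map $f$ is pseudo-holomorphic if $df\circ J=J'\circ df$. Let $B^\bullet:=\{\alpha\in A^\bullet:(dd^c+d^cd)\alpha=0\}$ and $C^\bullet:=A^\bullet/\operatorname{Im}(dd^c+d^cd)$ (graded by degree of forms); $d$ and $d^c$ act on both. The Bott-Chern cohomology is $$H^k_{d+d^c}(M,J):=\frac{\ker(d\colon B^k\to B^{k+1})\cap\ker(d^c\colon B^k\to B^{k+1})}{\operatorname{Im}(dd^c\colon B^{k-2}\to B^k)},$$ and the Aeppli cohomology is $$H^k_{dd^c}(M,J):=\frac{\ker(dd^c\colon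 C^k\to C^{k+2})}{\operatorname{Im}(d\colon C^{k-1}\to C^k)+\operatorname{Im}(d^c\colon C^{k-1}\to C^k)}.$$ The algebra structure on $H^\bullet_{d+d^c}$ and the module structure of $H^\bullet_{dd^c}$ over it are induced by the wedge product of representatives. Module morphism means $f^*([\alpha]\cdot[\gamma])=f^*[\alpha]\cdot f^*[\gamma]$; the cohomologies carry the zero differential. *)

theory Defs
  imports
    "HOL-Analysis.Analysis"
    "HOL-Library.Set_Algebras"
    "HOL-Library.Function_Algebras"
    "HOL-Algebra.Module"
begin

section \<open>Smooth manifolds\<close>

text \<open>
  Class \<open>C\<^sup>n\<close> on an open set of a Euclidean space: all iterated directional derivatives
  up to order \<open>n\<close> exist (in the Frechet sense) and are continuous.
\<close>

primrec C_k_on :: "nat \<Rightarrow> 'v::euclidean_space set \<Rightarrow> ('v \<Rightarrow> 'w::real_normed_vector) \<Rightarrow> bool" where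
  "C_k_on 0 S g \<longleftrightarrow> continuous_on S g"
| "C_k_on (Suc n) S g \<longleftrightarrow>
     (\<forall>x\<in>S. g differentiable (at x)) \<and> (\<forall>v. C_k_on n S (\<lambda>x. frechet_derivative g (at x) v))"

definition smooth_on :: "'v::euclidean_space set \<Rightarrow> ('v \<Rightarrow> 'w::real_normed_vector) \<Rightarrow> bool" where
  "smooth_on S g \<longleftrightarrow> (\<forall>n. C_k_on n S g)"

text \<open>A chart \<open>(U, \<phi>)\<close> is a domain together with a coordinate map; \<open>\<phi>\<close> is only relevant on \<open>U\<close>.\<close>

type_synonym ('a, 'v) chart = "'a set \<times> ('a \<Rightarrow> 'v)"

abbreviation cdom :: "('a, 'v) chart \<Rightarrow> 'a set" where "cdom \<equiv> fst"
abbreviation cmap :: "('a, 'v) chart \<Rightarrow> 'a \<Rightarrow> 'v" where "cmap \<equiv> snd"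
abbreviation cimg :: "('a, 'v) chart \<Rightarrow> 'v set" where "cimg c \<equiv> cmap c ` cdom c"
abbreviation cinv :: "('a, 'v) chart \<Rightarrow> 'v \<Rightarrow> 'a" where "cinv c \<equiv> inv_into (cdom c) (cmap c)"

record ('a, 'v) manifold =
  space_of :: "'a topology"
  atlas :: "('a, 'v) chart set"

abbreviation points :: "('a, 'v) manifold \<Rightarrow> 'a set" where "points M \<equiv> topspace (space_of M)"

text \<open>The atlas is not required to be maximal.\<close>

definition smooth_manifold :: "('a, 'v::euclidean_space) manifold \<Rightarrow> bool" where
  "smooth_manifold M \<longleftrightarrow>
     Hausdorff_space (space_of M) \<and> second_countable (space_of M) \<and>
     (\<Union>c\<in>atlas M. cdom c) = points M \<and>
     (\<forall>c\<in>atlas M. openin (space_of M) (cdom c) \<and> open (cimg c) \<and>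
        homeomorphic_map (subtopology (space_of M) (cdom c)) (top_of_set (cimg c)) (cmap c)) \<and>
     (\<forall>c\<in>atlas M. \<forall>c'\<in>atlas M. smooth_on (cmap c ` (cdom c \<inter> cdom c')) (cmap c' \<circ> cinv c))"

definition smooth_map ::
  "('a, 'v::euclidean_space) manifold \<Rightarrow> ('b, 'w::euclidean_space) manifold \<Rightarrow> ('a \<Rightarrow> 'b) \<Rightarrow> bool" where
  "smooth_map M N f \<longleftrightarrow>
     continuous_map (space_of M) (space_of N) f \<and>
     (\<forall>c\<in>atlas M. \<forall>c'\<in>atlas N.
        smooth_on (cmap c ` (cdom c \<inter> f -` cdom c')) (cmap c' \<circ> f \<circ> cinv c))"

definition diffeomorphism ::
  "('a, 'v::euclidean_space) manifold \<Rightarrow> ('b, 'w::euclidean_space) manifold \<Rightarrow> ('a \<Rightarrow> 'b) \<Rightarrow> bool" where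
  "diffeomorphism M N f \<longleftrightarrow>
     smooth_map M N f \<and>
     (\<exists>g. smooth_map N M g \<and> (\<forall>p\<in>points M. g (f p) = p) \<and> (\<forall>q\<in>points N. f (g q) = q))"

section \<open>Tangent vectors and almost complex structures\<close>

text \<open>
  A tangent vector at \<open>p\<close> is the family of its coordinate vectors in all charts around \<open>p\<close>,
  related by the differentials of the transition maps (and \<open>0\<close> at all other indices, so that
  equality of tangent vectors is equality of functions).
\<close>

type_synonym ('a, 'v) tvec = "('a, 'v) chart \<Rightarrow> 'v"

definition charts_at :: "('a, 'v) manifold \<Rightarrow> 'a \<Rightarrow> ('a, 'v) chart set" where
  "charts_at M p = {c \<in> atlas M. p \<in> cdom c}"

definition tangent_space :: "('a, 'v::euclidean_space) manifold \<Rightarrow> 'a \<Rightarrow> ('a, 'v) tvec set" where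
  "tangent_space M p =
     {\<xi>. (\<forall>c\<in>charts_at M p. \<forall>c'\<in>charts_at M p.
            \<xi> c' = frechet_derivative (cmap c' \<circ> cinv c) (at (cmap c p)) (\<xi> c)) \<and>
         (\<forall>c. c \<notin> charts_at M p \<longrightarrow> \<xi> c = 0)}"

text \<open>The tangent vector at \<open>p\<close> whose coordinates in the chart \<open>c\<close> are \<open>w\<close>.\<close>

definition tvec_of ::
  "('a, 'v::euclidean_space) manifold \<Rightarrow> ('a, 'v) chart \<Rightarrow> 'a \<Rightarrow> 'v \<Rightarrow> ('a, 'v) tvec" where
  "tvec_of M c p w =
     (\<lambda>c'. if c' \<in> charts_at M p then frechet_derivative (cmap c' \<circ> cinv c) (at (cmap c p)) w else 0)"

text \<open>Sums and real multiples of tangent vectors, taken in every chart.\<close>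

definition tlin :: "real \<Rightarrow> ('a, 'v::euclidean_space) tvec \<Rightarrow> real \<Rightarrow> ('a, 'v) tvec \<Rightarrow> ('a, 'v) tvec" where
  "tlin a \<xi> b \<eta> = (\<lambda>c. a *\<^sub>R \<xi> c + b *\<^sub>R \<eta> c)"

text \<open>The choice of the chart \<open>c\<close> around \<open>p\<close> is immaterial for smooth \<open>f\<close>.\<close>

definition differential ::
  "('a, 'v::euclidean_space) manifold \<Rightarrow> ('b, 'w::euclidean_space) manifold \<Rightarrow> ('a \<Rightarrow> 'b) \<Rightarrow> 'a \<Rightarrow>
   ('a, 'v) tvec \<Rightarrow> ('b, 'w) tvec" where
  "differential M N f p \<xi> =
     (let c = (SOME c. c \<in> charts_at M p) in
      (\<lambda>c'. if c' \<in> charts_at N (f p)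
            then frechet_derivative (cmap c' \<circ> f \<circ> cinv c) (at (cmap c p)) (\<xi> c) else 0))"

definition almost_complex_structure ::
  "('a, 'v::euclidean_space) manifold \<Rightarrow> ('a \<Rightarrow> ('a, 'v) tvec \<Rightarrow> ('a, 'v) tvec) \<Rightarrow> bool" where
  "almost_complex_structure M J \<longleftrightarrow>
     (\<forall>p\<in>points M. \<forall>\<xi>\<in>tangent_space M p.
        J p \<xi> \<in> tangent_space M p \<and> J p (J p \<xi>) = - \<xi> \<and>
        (\<forall>\<eta>\<in>tangent_space M p. \<forall>a b. J p (tlin a \<xi> b \<eta>) = tlin a (J p \<xi>) b (J p \<eta>))) \<and>
     (\<forall>c\<in>atlas M. \<forall>w. smooth_on (cimg c) (\<lambda>x. J (cinv c x) (tvec_of M c (cinv c x) w) c))"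

definition almost_complex_manifold ::
  "('a, 'v::euclidean_space) manifold \<Rightarrow> ('a \<Rightarrow> ('a, 'v) tvec \<Rightarrow> ('a, 'v) tvec) \<Rightarrow> bool" where
  "almost_complex_manifold M J \<longleftrightarrow>
     smooth_manifold M \<and> even DIM('v) \<and> almost_complex_structure M J"

definition pseudo_holomorphic ::
  "('a, 'v::euclidean_space) manifold \<Rightarrow> ('a \<Rightarrow> ('a, 'v) tvec \<Rightarrow> ('a, 'v) tvec) \<Rightarrow>
   ('b, 'w::euclidean_space) manifold \<Rightarrow> ('b \<Rightarrow> ('b, 'w) tvec \<Rightarrow> ('b, 'w) tvec) \<Rightarrow>
   ('a \<Rightarrow> 'b) \<Rightarrow> bool" where
  "pseudo_holomorphic M J N J' f \<longleftrightarrow>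
     smooth_map M N f \<and>
     (\<forall>p\<in>points M. \<forall>\<xi>\<in>tangent_space M p.
        differential M N f p (J p \<xi>) = J' (f p) (differential M N f p \<xi>))"

section \<open>Complex differential forms\<close>

text \<open>
  A \<open>k\<close>-form sends a point \<open>p\<close> and a list of \<open>k\<close> tangent vectors at \<open>p\<close> to a complex number; it is
  \<open>0\<close> on all other arguments. Degrees are integers: no list has negative length, so the space
  of forms of negative degree is \<open>{0}\<close>.
\<close>

type_synonym ('a, 'v) form = "'a \<Rightarrow> ('a, 'v) tvec list \<Rightarrow> complex"

text \<open>Coefficient functions of a form in a chart: \<open>\<omega>\<close> on constant coordinate vector fields.\<close>

definition coeff_in ::
  "('a, 'v::euclidean_space) manifold \<Rightarrow> ('a, 'v) form \<Rightarrow> ('a, 'v) chart \<Rightarrow> 'v list \<Rightarrow> 'v \<Rightarrow> complex" where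
  "coeff_in M \<omega> c ws x = \<omega> (cinv c x) (map (tvec_of M c (cinv c x)) ws)"

definition tangent_list :: "('a, 'v::euclidean_space) manifold \<Rightarrow> 'a \<Rightarrow> ('a, 'v) tvec list \<Rightarrow> bool" where
  "tangent_list M p vs \<longleftrightarrow> p \<in> points M \<and> set vs \<subseteq> tangent_space M p"

definition forms :: "('a, 'v::euclidean_space) manifold \<Rightarrow> int \<Rightarrow> ('a, 'v) form set" where
  "forms M k =
     {\<omega>. (\<forall>p vs. \<not> (tangent_list M p vs \<and> int (length vs) = k) \<longrightarrow> \<omega> p vs = 0) \<and>
         (\<forall>p us \<xi> \<eta> vs a b. tangent_list M p (us @ \<xi> # \<eta> # vs) \<longrightarrow>
            \<omega> p (us @ tlin a \<xi> b \<eta> # vs)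
              = of_real a * \<omega> p (us @ \<xi> # vs) + of_real b * \<omega> p (us @ \<eta> # vs)) \<and>
         (\<forall>p us \<xi> vs ws. \<omega> p (us @ \<xi> # vs @ \<xi> # ws) = 0) \<and>
         (\<forall>c\<in>atlas M. \<forall>ws. smooth_on (cimg c) (coeff_in M \<omega> c ws))}"

definition scale_form :: "complex \<Rightarrow> ('a, 'v) form \<Rightarrow> ('a, 'v) form" where
  "scale_form z \<omega> = (\<lambda>p vs. z * \<omega> p vs)"

definition unit_form :: "('a, 'v) manifold \<Rightarrow> ('a, 'v) form" where
  "unit_form M = (\<lambda>p vs. if p \<in> points M \<and> vs = [] then 1 else 0)"

text \<open>
  The wedge product as a sum over shuffles: \<open>I\<close> is the set of positions fed to \<open>\<alpha>\<close>, and the sign is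
  that of the permutation listing \<open>I\<close> increasingly and then its complement increasingly.
\<close>

definition wedge :: "('a, 'v) form \<Rightarrow> ('a, 'v) form \<Rightarrow> ('a, 'v) form" where
  "wedge \<alpha> \<beta> = (\<lambda>p vs. \<Sum>I\<in>Pow {..<length vs}.
     (-1) ^ card {(i, j). i \<in> I \<and> j \<in> {..<length vs} - I \<and> j < i}
       * \<alpha> p (nths vs I) * \<beta> p (nths vs (- I)))"

text \<open>
  The exterior derivative at \<open>p\<close>, computed in a chart around \<open>p\<close> (whose choice is immaterial) by
  \<open>d\<omega>(v\<^sub>0, \<dots>, v\<^sub>k) = \<Sum>\<^sub>i (-1)\<^sup>i \<partial>\<omega>(v\<^sub>0, \<dots>, v\<^sub>k without v\<^sub>i)/\<partial>v\<^sub>i\<close> with all \<open>v\<^sub>j\<close> extended as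
  constant coordinate vector fields.
\<close>

definition ext_d :: "('a, 'v::euclidean_space) manifold \<Rightarrow> ('a, 'v) form \<Rightarrow> ('a, 'v) form" where
  "ext_d M \<omega> = (\<lambda>p vs.
     if tangent_list M p vs then
       (let c = (SOME c. c \<in> charts_at M p); ws = map (\<lambda>\<xi>. \<xi> c) vs in
        \<Sum>i<length ws. (-1) ^ i *
          frechet_derivative (coeff_in M \<omega> c (take i ws @ drop (Suc i) ws)) (at (cmap c p)) (ws ! i))
     else 0)"

definition pullback ::
  "('a, 'v::euclidean_space) manifold \<Rightarrow> ('b, 'w::euclidean_space) manifold \<Rightarrow> ('a \<Rightarrow> 'b) \<Rightarrow>
   ('b, 'w) form \<Rightarrow> ('a, 'v) form" where
  "pullback M N f \<omega> = (\<lambda>p vs.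
     if tangent_list M p vs then \<omega> (f p) (map (differential M N f p) vs) else 0)"

text \<open>
  The action by duality of an endomorphism field: \<open>\<omega>(E v\<^sub>1, \<dots>, E v\<^sub>k)\<close>. For \<open>E = J\<close> it is
  multiplication by \<open>i\<^sup>p\<^sup>-\<^sup>q\<close> on forms of type \<open>(p, q)\<close>. The inverse of the action of \<open>J\<close> is the
  action of \<open>-J\<close>, since \<open>J\<^sup>-\<^sup>1 = -J\<close>.
\<close>

definition act_on_forms ::
  "('a, 'v::euclidean_space) manifold \<Rightarrow> ('a \<Rightarrow> ('a, 'v) tvec \<Rightarrow> ('a, 'v) tvec) \<Rightarrow>
   ('a, 'v) form \<Rightarrow> ('a, 'v) form" where
  "act_on_forms M E \<omega> = (\<lambda>p vs. if tangent_list M p vs then \<omega> p (map (E p) vs) else 0)"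

definition dc ::
  "('a, 'v::euclidean_space) manifold \<Rightarrow> ('a \<Rightarrow> ('a, 'v) tvec \<Rightarrow> ('a, 'v) tvec) \<Rightarrow>
   ('a, 'v) form \<Rightarrow> ('a, 'v) form" where
  "dc M J \<omega> = act_on_forms M (\<lambda>p \<xi>. - J p \<xi>) (ext_d M (act_on_forms M J \<omega>))"

definition ddc_plus_dcd ::
  "('a, 'v::euclidean_space) manifold \<Rightarrow> ('a \<Rightarrow> ('a, 'v) tvec \<Rightarrow> ('a, 'v) tvec) \<Rightarrow>
   ('a, 'v) form \<Rightarrow> ('a, 'v) form" where
  "ddc_plus_dcd M J \<omega> = ext_d M (dc M J \<omega>) + dc M J (ext_d M \<omega>)"

section \<open>Differential graded algebras and modules over the complex numbers\<close>

definition complex_ring :: "complex ring" where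
  "complex_ring = \<lparr>carrier = UNIV, mult = (*), one = 1, zero = 0, add = (+)\<rparr>"

definition linear_map ::
  "(complex, 'x) module \<Rightarrow> (complex, 'y) module \<Rightarrow> ('x \<Rightarrow> 'y) \<Rightarrow> bool" where
  "linear_map V W h \<longleftrightarrow>
     h \<in> carrier V \<rightarrow> carrier W \<and>
     (\<forall>x\<in>carrier V. \<forall>y\<in>carrier V. h (x \<oplus>\<^bsub>V\<^esub> y) = h x \<oplus>\<^bsub>W\<^esub> h y) \<and>
     (\<forall>z. \<forall>x\<in>carrier V. h (z \<odot>\<^bsub>V\<^esub> x) = z \<odot>\<^bsub>W\<^esub> h x)"

definition bilinear_map ::
  "(complex, 'x) module \<Rightarrow> (complex, 'y) module \<Rightarrow> (complex, 'z) module \<Rightarrow>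
   ('x \<Rightarrow> 'y \<Rightarrow> 'z) \<Rightarrow> bool" where
  "bilinear_map U V W h \<longleftrightarrow>
     (\<forall>x\<in>carrier U. linear_map V W (h x)) \<and> (\<forall>y\<in>carrier V. linear_map U W (\<lambda>x. h x y))"

text \<open>
  Graded objects are families of vector spaces indexed by the integers; \<open>gmult A p q\<close> is the
  product of elements of degrees \<open>p\<close> and \<open>q\<close>, and \<open>gdiff A p\<close> the differential on degree \<open>p\<close>.
\<close>

record 'x dga =
  gcomp :: "int \<Rightarrow> (complex, 'x) module"
  gmult :: "int \<Rightarrow> int \<Rightarrow> 'x \<Rightarrow> 'x \<Rightarrow> 'x"
  gone :: 'x
  gdiff :: "int \<Rightarrow> 'x \<Rightarrow> 'x"

abbreviation gdeg :: "('x, 'r) dga_scheme \<Rightarrow> int \<Rightarrow> 'x set" where "gdeg A k \<equiv> carrier (gcomp A k)"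

definition is_dga :: "'x dga \<Rightarrow> bool" where
  "is_dga A \<longleftrightarrow>
     (\<forall>k. module complex_ring (gcomp A k)) \<and>
     (\<forall>p q. bilinear_map (gcomp A p) (gcomp A q) (gcomp A (p + q)) (gmult A p q)) \<and>
     (\<forall>p q r. \<forall>x\<in>gdeg A p. \<forall>y\<in>gdeg A q. \<forall>z\<in>gdeg A r.
        gmult A (p + q) r (gmult A p q x y) z = gmult A p (q + r) x (gmult A q r y z)) \<and>
     gone A \<in> gdeg A 0 \<and>
     (\<forall>p. \<forall>x\<in>gdeg A p. gmult A 0 p (gone A) x = x \<and> gmult A p 0 x (gone A) = x) \<and>
     (\<forall>p. linear_map (gcomp A p) (gcomp A (p + 1)) (gdiff A p)) \<and>
     (\<forall>p. \<forall>x\<in>gdeg A p. gdiff A (p + 1) (gdiff A p x) = \<zero>\<^bsub>gcomp A (p + 2)\<^esub>) \<and>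
     (\<forall>p q. \<forall>x\<in>gdeg A p. \<forall>y\<in>gdeg A q.
        gdiff A (p + q) (gmult A p q x y)
          = gmult A (p + 1) q (gdiff A p x) y
              \<oplus>\<^bsub>gcomp A (p + q + 1)\<^esub>
            ((-1) powi p) \<odot>\<^bsub>gcomp A (p + q + 1)\<^esub> gmult A p (q + 1) x (gdiff A q y))"

record ('x, 'y) dgmod =
  mcomp :: "int \<Rightarrow> (complex, 'y) module"
  mact :: "int \<Rightarrow> int \<Rightarrow> 'x \<Rightarrow> 'y \<Rightarrow> 'y"
  mdiff :: "int \<Rightarrow> 'y \<Rightarrow> 'y"

abbreviation mdeg :: "('x, 'y, 'r) dgmod_scheme \<Rightarrow> int \<Rightarrow> 'y set" where
  "mdeg N k \<equiv> carrier (mcomp N k)"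

definition is_dg_module :: "'x dga \<Rightarrow> ('x, 'y) dgmod \<Rightarrow> bool" where
  "is_dg_module A N \<longleftrightarrow>
     is_dga A \<and>
     (\<forall>k. module complex_ring (mcomp N k)) \<and>
     (\<forall>p q. bilinear_map (gcomp A p) (mcomp N q) (mcomp N (p + q)) (mact N p q)) \<and>
     (\<forall>p q r. \<forall>x\<in>gdeg A p. \<forall>y\<in>gdeg A q. \<forall>m\<in>mdeg N r.
        mact N (p + q) r (gmult A p q x y) m = mact N p (q + r) x (mact N q r y m)) \<and>
     (\<forall>p. \<forall>m\<in>mdeg N p. mact N 0 p (gone A) m = m) \<and>
     (\<forall>p. linear_map (mcomp N p) (mcomp N (p + 1)) (mdiff N p)) \<and>
     (\<forall>p. \<forall>m\<in>mdeg N p. mdiff N (p + 1) (mdiff N p m) = \<zero>\<^bsub>mcomp N (p + 2)\<^esub>) \<and>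
     (\<forall>p q. \<forall>x\<in>gdeg A p. \<forall>m\<in>mdeg N q.
        mdiff N (p + q) (mact N p q x m)
          = mact N (p + 1) q (gdiff A p x) m
              \<oplus>\<^bsub>mcomp N (p + q + 1)\<^esub>
            ((-1) powi p) \<odot>\<^bsub>mcomp N (p + q + 1)\<^esub> mact N p (q + 1) x (mdiff N q m))"

definition dga_hom :: "'x dga \<Rightarrow> 'y dga \<Rightarrow> (int \<Rightarrow> 'x \<Rightarrow> 'y) \<Rightarrow> bool" where
  "dga_hom A B F \<longleftrightarrow>
     is_dga A \<and> is_dga B \<and>
     (\<forall>p. linear_map (gcomp A p) (gcomp B p) (F p)) \<and>
     (\<forall>p q. \<forall>x\<in>gdeg A p. \<forall>y\<in>gdeg A q. F (p + q) (gmult A p q x y) = gmult B p q (F p x) (F q y)) \<and>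
     F 0 (gone A) = gone B \<and>
     (\<forall>p. \<forall>x\<in>gdeg A p. F (p + 1) (gdiff A p x) = gdiff B p (F p x))"

definition dga_iso :: "'x dga \<Rightarrow> 'y dga \<Rightarrow> (int \<Rightarrow> 'x \<Rightarrow> 'y) \<Rightarrow> bool" where
  "dga_iso A B F \<longleftrightarrow> dga_hom A B F \<and> (\<forall>p. bij_betw (F p) (gdeg A p) (gdeg B p))"

text \<open>Morphisms from an \<open>A\<close>-module to a \<open>B\<close>-module along the algebra morphism \<open>F\<close>.\<close>

definition dg_module_hom ::
  "'x dga \<Rightarrow> ('x, 'm) dgmod \<Rightarrow> 'y dga \<Rightarrow> ('y, 'n) dgmod \<Rightarrow>
   (int \<Rightarrow> 'x \<Rightarrow> 'y) \<Rightarrow> (int \<Rightarrow> 'm \<Rightarrow> 'n) \<Rightarrow> bool" where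
  "dg_module_hom A S B T F G \<longleftrightarrow>
     is_dg_module A S \<and> is_dg_module B T \<and> dga_hom A B F \<and>
     (\<forall>p. linear_map (mcomp S p) (mcomp T p) (G p)) \<and>
     (\<forall>p q. \<forall>x\<in>gdeg A p. \<forall>m\<in>mdeg S q. G (p + q) (mact S p q x m) = mact T p q (F p x) (G q m)) \<and>
     (\<forall>p. \<forall>m\<in>mdeg S p. G (p + 1) (mdiff S p m) = mdiff T p (G p m))"

definition dg_module_iso ::
  "'x dga \<Rightarrow> ('x, 'm) dgmod \<Rightarrow> 'y dga \<Rightarrow> ('y, 'n) dgmod \<Rightarrow>
   (int \<Rightarrow> 'x \<Rightarrow> 'y) \<Rightarrow> (int \<Rightarrow> 'm \<Rightarrow> 'n) \<Rightarrow> bool" where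
  "dg_module_iso A S B T F G \<longleftrightarrow>
     dg_module_hom A S B T F G \<and> (\<forall>p. bij_betw (F p) (gdeg A p) (gdeg B p)) \<and>
     (\<forall>p. bij_betw (G p) (mdeg S p) (mdeg T p))"

section \<open>Bott-Chern and Aeppli cohomology\<close>

text \<open>
  Quotients by a subspace \<open>W\<close> consist of the cosets \<open>x +o W\<close>; the sum of cosets is the elementwise
  sum of sets, and a map \<open>g\<close> sending \<open>W\<close> into \<open>W'\<close> induces on cosets the map below, as
  \<open>g ` (x +o W) + W' = g x +o W'\<close> for additive \<open>g\<close>. Both cohomologies carry the zero
  differential.
\<close>

definition coset_map :: "'y::plus set \<Rightarrow> ('x \<Rightarrow> 'y) \<Rightarrow> 'x set \<Rightarrow> 'y set" where
  "coset_map W' g X = g ` X + W'"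

context
  fixes M :: "('a, 'v::euclidean_space) manifold" and J :: "'a \<Rightarrow> ('a, 'v) tvec \<Rightarrow> ('a, 'v) tvec"
begin

definition B_forms :: "int \<Rightarrow> ('a, 'v) form set" where
  "B_forms k = {\<alpha> \<in> forms M k. ddc_plus_dcd M J \<alpha> = 0}"

definition BC_cycles :: "int \<Rightarrow> ('a, 'v) form set" where
  "BC_cycles k = {\<alpha> \<in> B_forms k. ext_d M \<alpha> = 0 \<and> dc M J \<alpha> = 0}"

definition BC_boundaries :: "int \<Rightarrow> ('a, 'v) form set" where
  "BC_boundaries k = (\<lambda>\<beta>. ext_d M (dc M J \<beta>)) ` B_forms (k - 2)"

definition BC_class :: "int \<Rightarrow> ('a, 'v) form \<Rightarrow> ('a, 'v) form set" where
  "BC_class k \<alpha> = \<alpha> +o BC_boundaries k"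

definition bott_chern :: "('a, 'v) form set dga" where
  "bott_chern =
     \<lparr>gcomp = (\<lambda>k. \<lparr>carrier = BC_class k ` BC_cycles k, mult = undefined, one = undefined,
                    zero = BC_boundaries k, add = (+),
                    smult = (\<lambda>z. coset_map (BC_boundaries k) (scale_form z))\<rparr>),
      gmult = (\<lambda>p q X Y. {wedge \<alpha> \<beta> | \<alpha> \<beta>. \<alpha> \<in> X \<and> \<beta> \<in> Y} + BC_boundaries (p + q)),
      gone = BC_class 0 (unit_form M),
      gdiff = (\<lambda>k X. BC_boundaries (k + 1))\<rparr>"

text \<open>\<open>C_zero k\<close> is the image of \<open>dd\<^sup>c + d\<^sup>cd\<close> in degree \<open>k\<close>, i.e. the zero coset of \<open>C_forms k\<close>.\<close>

definition C_zero :: "int \<Rightarrow> ('a, 'v) form set" where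
  "C_zero k = ddc_plus_dcd M J ` forms M (k - 2)"

definition C_class :: "int \<Rightarrow> ('a, 'v) form \<Rightarrow> ('a, 'v) form set" where
  "C_class k \<alpha> = \<alpha> +o C_zero k"

definition C_forms :: "int \<Rightarrow> ('a, 'v) form set set" where
  "C_forms k = C_class k ` forms M k"

definition C_d :: "int \<Rightarrow> ('a, 'v) form set \<Rightarrow> ('a, 'v) form set" where
  "C_d k = coset_map (C_zero (k + 1)) (ext_d M)"

definition C_dc :: "int \<Rightarrow> ('a, 'v) form set \<Rightarrow> ('a, 'v) form set" where
  "C_dc k = coset_map (C_zero (k + 1)) (dc M J)"

definition A_cycles :: "int \<Rightarrow> ('a, 'v) form set set" where
  "A_cycles k = {X \<in> C_forms k. C_d (k + 1) (C_dc k X) = C_zero (k + 2)}"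

definition A_boundaries :: "int \<Rightarrow> ('a, 'v) form set set" where
  "A_boundaries k = C_d (k - 1) ` C_forms (k - 1) + C_dc (k - 1) ` C_forms (k - 1)"

definition A_class :: "int \<Rightarrow> ('a, 'v) form set \<Rightarrow> ('a, 'v) form set set" where
  "A_class k X = X +o A_boundaries k"

definition aeppli :: "(('a, 'v) form set, ('a, 'v) form set set) dgmod" where
  "aeppli =
     \<lparr>mcomp = (\<lambda>k. \<lparr>carrier = A_class k ` A_cycles k, mult = undefined, one = undefined,
                     zero = A_boundaries k, add = (+),
                     smult = (\<lambda>z. coset_map (A_boundaries k) (coset_map (C_zero k) (scale_form z)))\<rparr>),
      mact = (\<lambda>p q X Y. {coset_map (C_zero (p + q)) (wedge \<alpha>) c | \<alpha> c. \<alpha> \<in> X \<and> c \<in> Y}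
                          + A_boundaries (p + q)),
      mdiff = (\<lambda>k Y. A_boundaries (k + 1))\<rparr>"

end

text \<open>The maps induced by the pullback of forms from \<open>(N, J')\<close> to \<open>(M, J)\<close>.\<close>

definition BC_pullback ::
  "('a, 'v::euclidean_space) manifold \<Rightarrow> ('a \<Rightarrow> ('a, 'v) tvec \<Rightarrow> ('a, 'v) tvec) \<Rightarrow>
   ('b, 'w::euclidean_space) manifold \<Rightarrow> ('a \<Rightarrow> 'b) \<Rightarrow>
   int \<Rightarrow> ('b, 'w) form set \<Rightarrow> ('a, 'v) form set" where
  "BC_pullback M J N f k = coset_map (BC_boundaries M J k) (pullback M N f)"

definition A_pullback ::
  "('a, 'v::euclidean_space) manifold \<Rightarrow> ('a \<Rightarrow> ('a, 'v) tvec \<Rightarrow> ('a, 'v) tvec) \<Rightarrow>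
   ('b, 'w::euclidean_space) manifold \<Rightarrow> ('a \<Rightarrow> 'b) \<Rightarrow>
   int \<Rightarrow> ('b, 'w) form set set \<Rightarrow> ('a, 'v) form set set" where
  "A_pullback M J N f k =
     coset_map (A_boundaries M J k) (coset_map (C_zero M J k) (pullback M N f))"

end

theory Submission
  imports Defs
begin

text \<open>
  Everything follows from identities between forms: \<open>d\<close> and \<open>d\<^sup>c\<close> are odd derivations of
  square zero, so \<open>D = dd\<^sup>c + d\<^sup>cd\<close> is an even derivation commuting with both, and the pullback
  along a pseudo-holomorphic map is multiplicative and commutes with \<open>d\<close> and with \<open>J\<close>, hence with
  \<open>d\<^sup>c\<close> and \<open>D\<close>. Pullback along the inverse of a diffeomorphism, which is again pseudo-holomorphic,
  inverts the maps on cohomology.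

  In a chart, both the wedge product and the exterior derivative obey recursions in the first
  argument \<open>v\<close>, namely \<open>\<iota>\<^sub>v(\<alpha> \<and> \<beta>) = \<iota>\<^sub>v\<alpha> \<and> \<beta> + \<epsilon>\<alpha> \<and> \<iota>\<^sub>v\<beta>\<close>, with \<open>\<epsilon> = (-1)\<^sup>k\<close> in degree \<open>k\<close>, and
  Cartan's formula \<open>\<iota>\<^sub>vd\<omega> = \<partial>\<^sub>v\<omega> - d\<iota>\<^sub>v\<omega>\<close>. With these, the Leibniz rule, associativity and
  \<open>d\<^sup>2 = 0\<close> are inductions on the list of arguments in which no shuffles appear. Independence
  of \<open>d\<close> from the chart is its naturality applied to the identity map.
\<close>

section \<open>Calculus of smooth functions\<close>

text \<open>A form is a function on lists, without a degree in its type, and its smoothness is known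
  only on constant coordinate fields. So the calculus treats coefficient functions on all lists at
  once, with signs read off the length of the list, and a vector that moves with the point is
  expanded in the standard basis before anything is differentiated. This makes pullbacks and the
  action of \<open>J\<close> smooth and gives the product rule behind naturality of
  \<open>d\<close>; there the second derivatives of the coordinate map cancel because they are
  symmetric while the form alternates. Classes are sets of forms, in the Aeppli case sets of sets.
  Addition of sets has no inverses, and its zero is not the zero of the quotient. Hence each
  operation is first computed on representatives, after which the axioms are identities between
  forms. The delicate point is a Bott-Chern boundary acting on an Aeppli cycle
  \<open>\<gamma>\<close>: only \<open>dd\<^sup>c\<gamma>\<close> is given to lie in the image of
  \<open>D\<close>, and this has to be turned into the same for
  \<open>d\<^sup>cd\<gamma>\<close>.\<close>

abbreviation fd :: "('v::euclidean_space \<Rightarrow> 'w::real_normed_vector) \<Rightarrow> 'v \<Rightarrow> 'v \<Rightarrow> 'w" where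
  "fd f x \<equiv> frechet_derivative f (at x)"

lemma fd_has_derivative: "f differentiable (at x) \<Longrightarrow> (f has_derivative fd f x) (at x)"
  by (simp add: frechet_derivative_works)

lemma fd_eqI: "(f has_derivative f') (at x) \<Longrightarrow> fd f x = f'"
  using frechet_derivative_at by metis

text \<open>\<open>frechet_derivative\<close> chooses among all derivatives at the point, so it is
  enough that both functions have the same ones. This covers points without a derivative
  too.\<close>

lemma fd_cong:
  assumes "open S" "x \<in> S" "\<And>y. y \<in> S \<Longrightarrow> f y = g y"
  shows "fd f x = fd g x"
proof -
  have "(f has_derivative f') (at x) \<longleftrightarrow> (g has_derivative f') (at x)" for f'
    using assms has_derivative_transform_within_open[of f f' x UNIV S g]
      has_derivative_transform_within_open[of g f' x UNIV S f] by auto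
  then show ?thesis unfolding frechet_derivative_def by simp
qed

lemma differentiable_cong_open:
  assumes "open S" "x \<in> S" "\<And>y. y \<in> S \<Longrightarrow> f y = g y" "f differentiable (at x)"
  shows "g differentiable (at x)"
  using assms has_derivative_transform_within_open[of f _ x UNIV S g]
  unfolding differentiable_def by blast

lemma C_k_on_cong:
  assumes "open S" "\<And>x. x \<in> S \<Longrightarrow> f x = g x" "C_k_on n S f"
  shows "C_k_on n S g"
  using assms(2,3)
proof (induction n arbitrary: f g)
  case 0
  then show ?case by (simp cong: continuous_on_cong)
next
  case (Suc n)
  have "g differentiable (at x)" if "x \<in> S" for x
    using differentiable_cong_open[OF assms(1) that Suc.prems(1)] Suc.prems(2) that by auto
  moreover have "C_k_on n S (\<lambda>x. fd g x v)" for v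
    by (rule Suc.IH[of "\<lambda>x. fd f x v"])
      (use Suc.prems fd_cong[OF assms(1) _ Suc.prems(1)] in auto)
  ultimately show ?case by simp
qed

lemma C_k_on_SucD: "C_k_on (Suc n) S f \<Longrightarrow> C_k_on n S f"
proof (induction n arbitrary: f)
  case 0
  then show ?case
    by (auto intro!: continuous_at_imp_continuous_on differentiable_imp_continuous_within)
qed auto

text \<open>Derivatives are taken at a point rather than within \<open>S\<close>, so all conditions
  are local. This serves pullbacks, which are seen to be smooth only on pieces of a chart that map
  into one chart of the target.\<close>

lemma C_k_on_local:
  assumes "\<And>x. x \<in> S \<Longrightarrow> \<exists>T. open T \<and> x \<in> T \<and> C_k_on n T f"
  shows "C_k_on n S f"
  using assms
proof (induction n arbitrary: f)
  case 0
  have "isCont f x" if x: "x \<in> S" for x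
  proof -
    obtain T where "open T" "x \<in> T" "continuous_on T f" using "0"[OF x] by auto
    then show ?thesis by (simp add: continuous_on_eq_continuous_at)
  qed
  then show ?case by (simp add: continuous_at_imp_continuous_on)
next
  case (Suc n)
  have "C_k_on n S (\<lambda>x. fd f x v)" for v
  proof (rule Suc.IH)
    fix x assume "x \<in> S"
    from Suc.prems[OF this] show "\<exists>T. open T \<and> x \<in> T \<and> C_k_on n T (\<lambda>x. fd f x v)" by auto
  qed
  moreover have "f differentiable (at x)" if "x \<in> S" for x
    using Suc.prems[OF that] by auto
  ultimately show ?case by simp
qed

lemma C_k_on_const: "C_k_on n S (\<lambda>x. c)"
  by (induction n arbitrary: c) auto

lemma C_k_on_add:
  assumes "open S" "C_k_on n S f" "C_k_on n S g"
  shows "C_k_on n S (\<lambda>x. f x + g x)"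
  using assms(2,3)
proof (induction n arbitrary: f g)
  case 0
  then show ?case by (auto intro: continuous_intros)
next
  case (Suc n)
  have *: "((\<lambda>x. f x + g x) has_derivative (\<lambda>v. fd f x v + fd g x v)) (at x)" if "x \<in> S" for x
    using Suc.prems that by (auto intro!: has_derivative_add fd_has_derivative)
  have "C_k_on n S (\<lambda>x. fd (\<lambda>x. f x + g x) x v)" for v
    by (rule C_k_on_cong[OF assms(1) _ Suc.IH[of "\<lambda>x. fd f x v" "\<lambda>x. fd g x v"]])
      (use Suc.prems * fd_eqI in fastforce)+
  then show ?case using * by (auto simp: differentiable_def)
qed

lemma C_k_on_bilinear:
  assumes "bounded_bilinear pr" "open S" "C_k_on n S f" "C_k_on n S g"
  shows "C_k_on n S (\<lambda>x. pr (f x) (g x))"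
  using assms(3,4)
proof (induction n arbitrary: f g)
  case 0
  then show ?case using bounded_bilinear.continuous_on[OF assms(1)] by auto
next
  case (Suc n)
  have *: "((\<lambda>x. pr (f x) (g x)) has_derivative (\<lambda>v. pr (f x) (fd g x v) + pr (fd f x v) (g x))) (at x)"
    if "x \<in> S" for x
    using Suc.prems that by (auto intro!: bounded_bilinear.FDERIV[OF assms(1)] fd_has_derivative)
  have "C_k_on n S (\<lambda>x. pr (f x) (fd g x v) + pr (fd f x v) (g x))" for v
    by (intro C_k_on_add assms(2) Suc.IH) (use Suc.prems C_k_on_SucD in auto)
  then have "C_k_on n S (\<lambda>x. fd (\<lambda>x. pr (f x) (g x)) x v)" for v
    by (rule C_k_on_cong[OF assms(2), rotated]) (use * fd_eqI in fastforce)
  then show ?case using * by (auto simp: differentiable_def)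
qed

lemma C_k_on_sum:
  assumes "open S" "\<And>i. i \<in> I \<Longrightarrow> C_k_on n S (f i)"
  shows "C_k_on n S (\<lambda>x. \<Sum>i\<in>I. f i x)"
  using assms(2)
  by (induction I rule: infinite_finite_induct) (auto intro!: C_k_on_const C_k_on_add assms(1))

text \<open>\<open>C_k_on\<close> controls derivatives in fixed directions only. A direction that
  varies, as in the chain rule, is traded for smooth coordinates against fixed basis
  vectors.\<close>

lemma fd_basis:
  assumes "g differentiable (at y)"
  shows "fd g y v = (\<Sum>b\<in>Basis. (v \<bullet> b) *\<^sub>R fd g y b)"
proof -
  have l: "linear (fd g y)" using assms by (rule linear_frechet_derivative)
  have "fd g y v = fd g y (\<Sum>b\<in>Basis. (v \<bullet> b) *\<^sub>R b)" by (simp add: euclidean_representation)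
  also have "\<dots> = (\<Sum>b\<in>Basis. (v \<bullet> b) *\<^sub>R fd g y b)"
    by (simp add: linear_sum[OF l] linear_scale[OF l])
  finally show ?thesis .
qed

lemma C_k_on_inner_const:
  assumes "open S" "C_k_on n S f"
  shows "C_k_on n S (\<lambda>x. f x \<bullet> b)"
  by (intro C_k_on_bilinear[OF bounded_bilinear_inner] C_k_on_const assms)

text \<open>The derivative in direction \<open>v\<close> is a sum of products of a coordinate of
  \<open>fd f x v\<close> with a partial derivative of \<open>g\<close> at \<open>f x\<close>. So
  the induction varies \<open>g\<close> and keeps \<open>f\<close>, whose order of smoothness is
  lowered by \<open>C_k_on_SucD\<close>.\<close>

lemma C_k_on_compose:
  fixes f :: "'u::euclidean_space \<Rightarrow> 'v::euclidean_space" and g :: "'v \<Rightarrow> 'w::real_normed_vector"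
  assumes "open S" "open T" "f ` S \<subseteq> T" "C_k_on n S f" "C_k_on n T g"
  shows "C_k_on n S (\<lambda>x. g (f x))"
  using assms(4,5)
proof (induction n arbitrary: g)
  case 0
  then show ?case using assms(3) by (auto intro: continuous_on_compose2)
next
  case (Suc n)
  have df: "f differentiable (at x)" "g differentiable (at (f x))" if "x \<in> S" for x
    using Suc.prems that assms(3) by auto
  have *: "((\<lambda>x. g (f x)) has_derivative (\<lambda>v. \<Sum>b\<in>Basis. (fd f x v \<bullet> b) *\<^sub>R fd g (f x) b)) (at x)"
    if "x \<in> S" for x
    using has_derivative_compose[OF fd_has_derivative[OF df(1)[OF that]] fd_has_derivative[OF df(2)[OF that]]]
    by (simp only: fd_basis[OF df(2)[OF that], of "fd f x _"])
  have "C_k_on n S (\<lambda>x. \<Sum>b\<in>Basis. (fd f x v \<bullet> b) *\<^sub>R fd g (f x) b)" for v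
    by (intro C_k_on_sum assms(1) C_k_on_bilinear[OF bounded_bilinear_scaleR] C_k_on_inner_const Suc.IH)
      (use Suc.prems C_k_on_SucD in auto)
  then have "C_k_on n S (\<lambda>x. fd (\<lambda>x. g (f x)) x v)" for v
    by (rule C_k_on_cong[OF assms(1), rotated]) (use * fd_eqI in fastforce)
  then show ?case using * by (auto simp: differentiable_def)
qed

lemma smooth_on_cong: "open S \<Longrightarrow> (\<And>x. x \<in> S \<Longrightarrow> f x = g x) \<Longrightarrow> smooth_on S f \<Longrightarrow> smooth_on S g"
  unfolding smooth_on_def using C_k_on_cong by blast

lemma smooth_on_local:
  "(\<And>x. x \<in> S \<Longrightarrow> \<exists>T. open T \<and> x \<in> T \<and> smooth_on T f) \<Longrightarrow> smooth_on S f"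
  unfolding smooth_on_def using C_k_on_local by metis

lemma smooth_on_const: "smooth_on S (\<lambda>x. c)"
  unfolding smooth_on_def using C_k_on_const by blast

lemma smooth_on_add: "open S \<Longrightarrow> smooth_on S f \<Longrightarrow> smooth_on S g \<Longrightarrow> smooth_on S (\<lambda>x. f x + g x)"
  unfolding smooth_on_def using C_k_on_add by blast

lemma smooth_on_bilinear:
  "bounded_bilinear pr \<Longrightarrow> open S \<Longrightarrow> smooth_on S f \<Longrightarrow> smooth_on S g \<Longrightarrow>
    smooth_on S (\<lambda>x. pr (f x) (g x))"
  unfolding smooth_on_def using C_k_on_bilinear by blast

lemmas smooth_on_mult = smooth_on_bilinear[OF bounded_bilinear_mult]
  and smooth_on_scaleR = smooth_on_bilinear[OF bounded_bilinear_scaleR]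

lemma smooth_on_inner_const: "open S \<Longrightarrow> smooth_on S f \<Longrightarrow> smooth_on S (\<lambda>x. f x \<bullet> b)"
  unfolding smooth_on_def using C_k_on_inner_const by blast

lemma smooth_on_minus:
  assumes "open S" "smooth_on S f"
  shows "smooth_on S (\<lambda>x. - f x)"
  using smooth_on_scaleR[OF assms(1) smooth_on_const[of S "-1"] assms(2)] by simp

lemma smooth_on_sum:
  "open S \<Longrightarrow> (\<And>i. i \<in> I \<Longrightarrow> smooth_on S (f i)) \<Longrightarrow> smooth_on S (\<lambda>x. \<Sum>i\<in>I. f i x)"
  by (simp add: smooth_on_def C_k_on_sum)

lemma smooth_on_compose:
  fixes f :: "'u::euclidean_space \<Rightarrow> 'v::euclidean_space" and g :: "'v \<Rightarrow> 'w::real_normed_vector"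
  assumes "open S" "open T" "f ` S \<subseteq> T" "smooth_on S f" "smooth_on T g"
  shows "smooth_on S (\<lambda>x. g (f x))"
  using assms(4,5) by (simp add: smooth_on_def C_k_on_compose[OF assms(1-3)])

lemma smooth_on_differentiable: "smooth_on S f \<Longrightarrow> x \<in> S \<Longrightarrow> f differentiable (at x)"
  unfolding smooth_on_def by (metis C_k_on.simps(2))

lemma smooth_on_fd: "smooth_on S f \<Longrightarrow> smooth_on S (\<lambda>x. fd f x v)"
  unfolding smooth_on_def by (metis C_k_on.simps(2))

lemma fd_smooth: "smooth_on S f \<Longrightarrow> x \<in> S \<Longrightarrow> (f has_derivative fd f x) (at x)"
  by (intro fd_has_derivative smooth_on_differentiable)

lemma fd_smooth_linear: "smooth_on S f \<Longrightarrow> x \<in> S \<Longrightarrow> linear (fd f x)"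
  by (intro linear_frechet_derivative smooth_on_differentiable)

section \<open>Symmetry of second derivatives\<close>

lemma line_has_derivative:
  assumes "f differentiable (at (a + s *\<^sub>R v))"
  shows "((\<lambda>s. f (a + s *\<^sub>R v)) has_real_derivative fd f (a + s *\<^sub>R v) v) (at s)"
proof -
  have *: "((\<lambda>s. a + s *\<^sub>R v) has_derivative (\<lambda>h. h *\<^sub>R v)) (at s)"
    by (auto intro!: derivative_eq_intros)
  have "((\<lambda>s. f (a + s *\<^sub>R v)) has_derivative (\<lambda>h. fd f (a + s *\<^sub>R v) (h *\<^sub>R v))) (at s)"
    by (rule has_derivative_compose[OF * fd_has_derivative[OF assms]])
  moreover have "(\<lambda>h. fd f (a + s *\<^sub>R v) (h *\<^sub>R v)) = (*) (fd f (a + s *\<^sub>R v) v)"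
    by (simp add: fun_eq_iff linear_scale[OF linear_frechet_derivative[OF assms]])
  ultimately show ?thesis by (simp add: has_field_derivative_def)
qed

text \<open>Two uses of the mean value theorem, first along \<open>v\<close> and then along
  \<open>w\<close>. The left side is symmetric in \<open>v\<close> and \<open>w\<close>, which is
  what \<open>fd_symmetric_real\<close> exploits.\<close>

lemma second_difference_mvt:
  fixes f :: "'v::euclidean_space \<Rightarrow> real"
  assumes S: "smooth_on S f" and h: "h > 0"
    and sub: "\<And>s t. 0 \<le> s \<Longrightarrow> s \<le> h \<Longrightarrow> 0 \<le> t \<Longrightarrow> t \<le> h \<Longrightarrow> x + s *\<^sub>R v + t *\<^sub>R w \<in> S"
  shows "\<exists>s t. 0 \<le> s \<and> s \<le> h \<and> 0 \<le> t \<and> t \<le> h \<and>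
    f (x + h *\<^sub>R v + h *\<^sub>R w) - f (x + h *\<^sub>R v) - f (x + h *\<^sub>R w) + f x
      = h * h * fd (\<lambda>y. fd f y v) (x + s *\<^sub>R v + t *\<^sub>R w) w"
proof -
  note d = smooth_on_differentiable[OF S] smooth_on_differentiable[OF smooth_on_fd[OF S, of v]]
  \<comment> \<open>The increment of \<open>\<phi>\<close> from 0 to \<open>h\<close> is the whole
    second difference.\<close>
  define \<phi> where "\<phi> s = f ((x + h *\<^sub>R w) + s *\<^sub>R v) - f (x + s *\<^sub>R v)" for s
  have "DERIV \<phi> s :> fd f ((x + h *\<^sub>R w) + s *\<^sub>R v) v - fd f (x + s *\<^sub>R v) v"
    if "0 \<le> s" "s \<le> h" for s
    unfolding \<phi>_def
    by (intro DERIV_diff line_has_derivative d)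
      (use sub[of s h] sub[of s 0] that h in \<open>auto simp: algebra_simps\<close>)
  from MVT2[OF h this] obtain s where s: "0 < s" "s < h"
    "\<phi> h - \<phi> 0 = (h - 0) * (fd f ((x + h *\<^sub>R w) + s *\<^sub>R v) v - fd f (x + s *\<^sub>R v) v)" by blast
  have "DERIV (\<lambda>t. fd f ((x + s *\<^sub>R v) + t *\<^sub>R w) v) t :>
      fd (\<lambda>y. fd f y v) ((x + s *\<^sub>R v) + t *\<^sub>R w) w" if "0 \<le> t" "t \<le> h" for t
    by (intro line_has_derivative d) (use sub[of s t] that s in auto)
  from MVT2[OF h this] obtain t where t: "0 < t" "t < h"
    "fd f (x + s *\<^sub>R v + h *\<^sub>R w) v - fd f (x + s *\<^sub>R v + 0 *\<^sub>R w) v =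
      (h - 0) * fd (\<lambda>y. fd f y v) ((x + s *\<^sub>R v) + t *\<^sub>R w) w" by blast
  have "f (x + h *\<^sub>R v + h *\<^sub>R w) - f (x + h *\<^sub>R v) - f (x + h *\<^sub>R w) + f x = \<phi> h - \<phi> 0"
    by (simp add: \<phi>_def algebra_simps)
  also have "\<dots> = h * h * fd (\<lambda>y. fd f y v) (x + s *\<^sub>R v + t *\<^sub>R w) w"
    using s(3) t(3) by (simp add: algebra_simps)
  finally show ?thesis using s t by (intro exI[of _ s] exI[of _ t]) auto
qed

lemma fd_symmetric_real:
  fixes f :: "'v::euclidean_space \<Rightarrow> real"
  assumes "open S" "x \<in> S" "smooth_on S f"
  shows "fd (\<lambda>y. fd f y v) x w = fd (\<lambda>y. fd f y w) x v"
proof (rule ccontr)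
  define A where "A v w y = fd (\<lambda>y. fd f y v) y w" for v w y
  assume "fd (\<lambda>y. fd f y v) x w \<noteq> fd (\<lambda>y. fd f y w) x v"
  then have ne: "A v w x - A w v x \<noteq> 0" by (simp add: A_def)
  have "smooth_on S (A v w)" for v w
    unfolding A_def by (intro smooth_on_fd assms)
  then have "isCont (A v w) x" for v w
    by (intro differentiable_imp_continuous_within smooth_on_differentiable[OF _ assms(2)])
  \<comment> \<open>Half the gap: values within \<open>e\<close> of the two numbers cannot
    coincide.\<close>
  define e where "e = \<bar>A v w x - A w v x\<bar> / 2"
  have e: "e > 0" using ne by (simp add: e_def)
  define P where "P y \<longleftrightarrow> dist (A v w y) (A v w x) < e" for y
  define Q where "Q y \<longleftrightarrow> dist (A w v y) (A w v x) < e" for y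
  have PQ: "eventually P (nhds x)" "eventually Q (nhds x)"
    using \<open>isCont (A v w) x\<close> \<open>isCont (A w v) x\<close> e unfolding P_def Q_def isCont_def
    by (auto simp: tendsto_at_iff_tendsto_nhds dest: tendstoD)
  have PQ3: "A v w y \<noteq> A w v z" if "P y" "Q z" for y z
    using that unfolding P_def Q_def e_def dist_real_def by (smt (verit) field_sum_of_halves)
  have "\<forall>\<^sub>F y in nhds x. P y \<and> Q y \<and> y \<in> S"
    using PQ(1,2) eventually_nhds_in_open[OF assms(1,2)] by (auto intro: eventually_conj)
  then obtain d where d: "d > 0" "\<And>y. dist y x < d \<Longrightarrow> P y \<and> Q y \<and> y \<in> S"
    by (auto simp: eventually_nhds_metric)
  \<comment> \<open>Keeps the parallelogram spanned by \<open>h\<close> times \<open>v\<close> and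
    \<open>w\<close> within \<open>d / 2\<close> of \<open>x\<close>; the summand 1 avoids a zero
    denominator.\<close>
  define h where "h = d / (2 * (norm v + norm w + 1))"
  have n: "norm v + norm w + 1 > 0" by (simp add: add_nonneg_pos)
  have h: "h > 0" using d(1) n by (simp add: h_def)
  have near: "dist (x + s *\<^sub>R v + t *\<^sub>R w) x < d" if "0 \<le> s" "s \<le> h" "0 \<le> t" "t \<le> h" for s t
  proof -
    have "dist (x + s *\<^sub>R v + t *\<^sub>R w) x \<le> s * norm v + t * norm w"
      using that norm_triangle_ineq[of "s *\<^sub>R v" "t *\<^sub>R w"] by (simp add: dist_norm add.assoc)
    also have "\<dots> \<le> h * norm v + h * norm w"
      using that by (intro add_mono mult_right_mono) auto
    also have "\<dots> \<le> h * (norm v + norm w + 1)" using h by (simp add: algebra_simps)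
    also have "\<dots> = d / 2" using n by (simp add: h_def field_simps)
    also have "\<dots> < d" using d(1) by simp
    finally show ?thesis .
  qed
  obtain s t where st: "0 \<le> s" "s \<le> h" "0 \<le> t" "t \<le> h"
    "f (x + h *\<^sub>R v + h *\<^sub>R w) - f (x + h *\<^sub>R v) - f (x + h *\<^sub>R w) + f x
      = h * h * A v w (x + s *\<^sub>R v + t *\<^sub>R w)"
    using second_difference_mvt[OF assms(3) h, of x v w] near d(2) unfolding A_def by metis
  have near': "dist (x + s *\<^sub>R w + t *\<^sub>R v) x < d" if "0 \<le> s" "s \<le> h" "0 \<le> t" "t \<le> h" for s t
    using near[of t s] that by (simp add: ac_simps)
  obtain s' t' where st': "0 \<le> s'" "s' \<le> h" "0 \<le> t'" "t' \<le> h"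
    "f (x + h *\<^sub>R w + h *\<^sub>R v) - f (x + h *\<^sub>R w) - f (x + h *\<^sub>R v) + f x
      = h * h * A w v (x + s' *\<^sub>R w + t' *\<^sub>R v)"
    using second_difference_mvt[OF assms(3) h, of x w v] near' d(2) unfolding A_def by metis
  have "A v w (x + s *\<^sub>R v + t *\<^sub>R w) = A w v (x + s' *\<^sub>R w + t' *\<^sub>R v)"
  proof -
    have eq: "x + h *\<^sub>R w + h *\<^sub>R v = x + h *\<^sub>R v + h *\<^sub>R w" by simp
    have "h * h * A v w (x + s *\<^sub>R v + t *\<^sub>R w) = h * h * A w v (x + s' *\<^sub>R w + t' *\<^sub>R v)"
      using st(5) st'(5)[unfolded eq] by linarith
    then show ?thesis using h by simp
  qed
  then show False
    using PQ3 d(2)[OF near[OF st(1-4)]] d(2)[OF near'[OF st'(1-4)]] by blast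
qed

lemma fd_inner:
  assumes "f differentiable (at x)"
  shows "fd (\<lambda>y. f y \<bullet> b) x v = fd f x v \<bullet> b"
  using fd_eqI[OF has_derivative_inner_left[OF fd_has_derivative[OF assms]], of b] by simp

text \<open>The mean value theorem needs real values, so the claim is checked on each
  coordinate.\<close>

lemma fd_symmetric:
  fixes f :: "'v::euclidean_space \<Rightarrow> 'w::euclidean_space"
  assumes S: "open S" "x \<in> S" and f: "smooth_on S f"
  shows "fd (\<lambda>y. fd f y v) x w = fd (\<lambda>y. fd f y w) x v"
proof (rule euclidean_eqI)
  fix b :: 'w assume "b \<in> Basis"
  have *: "fd (\<lambda>y. fd f y v) x w \<bullet> b = fd (\<lambda>y. fd (\<lambda>z. f z \<bullet> b) y v) x w" for v w
  proof -
    have "fd (\<lambda>y. fd f y v) x w \<bullet> b = fd (\<lambda>y. fd f y v \<bullet> b) x w"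
      by (rule fd_inner[symmetric]) (rule smooth_on_differentiable[OF smooth_on_fd[OF f] S(2)])
    also have "\<dots> = fd (\<lambda>y. fd (\<lambda>z. f z \<bullet> b) y v) x w"
      by (rule fun_cong[OF fd_cong[OF S]]) (simp add: fd_inner[OF smooth_on_differentiable[OF f]])
    finally show ?thesis .
  qed
  show "fd (\<lambda>y. fd f y v) x w \<bullet> b = fd (\<lambda>y. fd f y w) x v \<bullet> b"
    unfolding * by (rule fd_symmetric_real[OF S smooth_on_inner_const[OF S(1) f]])
qed

section \<open>Wedge product and exterior derivative on lists of vectors\<close>

text \<open>The sign of the overview, read off the length of the list, so that functions on lists
  need no fixed degree.\<close>

definition parity :: "('x list \<Rightarrow> complex) \<Rightarrow> 'x list \<Rightarrow> complex" where
  "parity a l = (-1) ^ length l * a l"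

fun lwedge :: "('x list \<Rightarrow> complex) \<Rightarrow> ('x list \<Rightarrow> complex) \<Rightarrow> 'x list \<Rightarrow> complex" where
  "lwedge a b [] = a [] * b []"
| "lwedge a b (v # vs) = lwedge (\<lambda>l. a (v # l)) b vs + lwedge (parity a) (\<lambda>l. b (v # l)) vs"

lemma parity_simps [simp]:
  "parity (parity a) = a" "parity (\<lambda>l. 0) l = 0" "parity a [] = a []" "parity a (v # l) = - parity (\<lambda>l. a (v # l)) l"
  by (auto simp: parity_def fun_eq_iff power_mult_distrib[symmetric] simp flip: mult.assoc)

lemma parity_cons: "(\<lambda>l. parity a (v # l)) = (\<lambda>l. - parity (\<lambda>l. a (v # l)) l)"
  by (simp add: fun_eq_iff)

lemma parity_add: "parity (\<lambda>l. a l + b l) = (\<lambda>l. parity a l + parity b l)"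
  and parity_scale: "parity (\<lambda>l. c * a l) = (\<lambda>l. c * parity a l)"
  by (auto simp: parity_def fun_eq_iff algebra_simps)

lemma lwedge_add_left: "lwedge (\<lambda>l. a l + b l) c vs = lwedge a c vs + lwedge b c vs"
  by (induction vs arbitrary: a b c) (auto simp: algebra_simps parity_add)

lemma lwedge_add_right: "lwedge c (\<lambda>l. a l + b l) vs = lwedge c a vs + lwedge c b vs"
  by (induction vs arbitrary: a b c) (auto simp: algebra_simps)

lemma lwedge_scale_left: "lwedge (\<lambda>l. z * a l) c vs = z * lwedge a c vs"
  by (induction vs arbitrary: a c) (auto simp: algebra_simps parity_scale)

lemma lwedge_scale_right: "lwedge c (\<lambda>l. z * a l) vs = z * lwedge c a vs"
  by (induction vs arbitrary: a c) (auto simp: algebra_simps)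

lemma lwedge_minus_left: "lwedge (\<lambda>l. - a l) c vs = - lwedge a c vs"
  using lwedge_scale_left[of "-1" a] by simp

lemma lwedge_minus_right: "lwedge c (\<lambda>l. - a l) vs = - lwedge c a vs"
  using lwedge_scale_right[of c "-1" a] by simp

lemma lwedge_diff_left: "lwedge (\<lambda>l. a l - b l) c vs = lwedge a c vs - lwedge b c vs"
  using lwedge_add_left[of a "\<lambda>l. - b l"] by (simp add: lwedge_minus_left)

lemma lwedge_diff_right: "lwedge c (\<lambda>l. a l - b l) vs = lwedge c a vs - lwedge c b vs"
  using lwedge_add_right[of c a "\<lambda>l. - b l"] by (simp add: lwedge_minus_right)

lemmas lwedge_linear = lwedge_add_left lwedge_add_right lwedge_scale_left lwedge_scale_right lwedge_minus_left lwedge_minus_right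
  lwedge_diff_left lwedge_diff_right

text \<open>Each term of the product feeds complementary sublists to the factors. Used to see that a
  wedge product has the right degree and vanishes off the tangent vectors.\<close>

lemma lwedge_eq_0:
  assumes "\<And>l l'. set vs = set l \<union> set l' \<Longrightarrow> length vs = length l + length l' \<Longrightarrow> a l = 0 \<or> b l' = 0"
  shows "lwedge a b vs = 0"
  using assms
proof (induction vs arbitrary: a b)
  case Nil
  from Nil[of "[]" "[]"] show ?case by auto
next
  case (Cons v vs)
  have "lwedge (\<lambda>l. a (v # l)) b vs = 0"
  proof (rule Cons.IH)
    fix l l' assume "set vs = set l \<union> set l'" "length vs = length l + length l'"
    then show "a (v # l) = 0 \<or> b l' = 0" using Cons.prems[of "v # l" l'] by auto
  qed
  moreover have "lwedge (parity a) (\<lambda>l. b (v # l)) vs = 0"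
  proof (rule Cons.IH)
    fix l l' assume "set vs = set l \<union> set l'" "length vs = length l + length l'"
    then show "parity a l = 0 \<or> b (v # l') = 0" using Cons.prems[of l "v # l'"] by (auto simp: parity_def)
  qed
  ultimately show ?case by simp
qed

lemma lwedge_0 [simp]: "lwedge (\<lambda>l. 0) b vs = 0" "lwedge a (\<lambda>l. 0) vs = 0"
  by (rule lwedge_eq_0, simp)+

lemma lwedge_cong:
  assumes "\<And>l. set l \<subseteq> set vs \<Longrightarrow> a l = a' l" "\<And>l. set l \<subseteq> set vs \<Longrightarrow> b l = b' l"
  shows "lwedge a b vs = lwedge a' b' vs"
  using assms
proof (induction vs arbitrary: a b a' b')
  case Nil
  then show ?case by simp
next
  case (Cons v vs)
  have "lwedge (\<lambda>l. a (v # l)) b vs = lwedge (\<lambda>l. a' (v # l)) b' vs"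
    by (rule Cons.IH; rule Cons.prems) auto
  moreover have "lwedge (parity a) (\<lambda>l. b (v # l)) vs = lwedge (parity a') (\<lambda>l. b' (v # l)) vs"
    by (rule Cons.IH) (use Cons.prems in \<open>auto simp: parity_def subset_insertI2\<close>)
  ultimately show ?case by simp
qed

lemma lwedge_map: "lwedge a b (map h vs) = lwedge (\<lambda>l. a (map h l)) (\<lambda>l. b (map h l)) vs"
proof (induction vs arbitrary: a b)
  case (Cons v vs)
  have "parity (\<lambda>l. a (map h l)) = (\<lambda>l. parity a (map h l))" for a by (simp add: parity_def fun_eq_iff)
  then show ?case by (simp add: Cons.IH)
qed simp

text \<open>Lengths of complementary sublists add up, so the sign is multiplicative. Associativity
  needs this for the term in which the first vector passes the product
  \<open>lwedge a b\<close>.\<close>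

lemma parity_lwedge: "parity (lwedge a b) = lwedge (parity a) (parity b)"
proof
  fix vs show "parity (lwedge a b) vs = lwedge (parity a) (parity b) vs"
  proof (induction vs arbitrary: a b)
    case (Cons v vs)
    have "parity (lwedge a b) (v # vs) = - parity (lwedge (\<lambda>l. a (v # l)) b) vs - parity (lwedge (parity a) (\<lambda>l. b (v # l))) vs"
      by (simp add: parity_def algebra_simps)
    then show ?case by (simp add: Cons.IH parity_cons lwedge_linear)
  qed simp
qed

lemma lwedge_assoc: "lwedge (lwedge a b) c vs = lwedge a (lwedge b c) vs"
proof (induction vs arbitrary: a b c)
  case (Cons v vs)
  then show ?case by (simp add: lwedge_linear parity_lwedge)
qed simp

lemma lwedge_unit_left: "lwedge (\<lambda>l. if l = [] then 1 else 0) b vs = b vs"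
proof (induction vs arbitrary: b)
  case (Cons v vs)
  have *: "parity (\<lambda>l. if l = [] then 1 else 0) = (\<lambda>l. if l = [] then 1 else 0)"
    by (auto simp: parity_def fun_eq_iff)
  show ?case unfolding lwedge.simps * by (simp add: Cons.IH)
qed simp

lemma lwedge_unit_right: "lwedge a (\<lambda>l. if l = [] then 1 else 0) vs = a vs"
  by (induction vs arbitrary: a) auto

text \<open>The shuffles are split by whether position 0 goes to \<open>a\<close>. If it does, no
  inversion is added and the first term of the recursion results. If not, position 0 is overtaken by
  all of \<open>I\<close>, and the sign \<open>(-1) ^ card I\<close> is the \<open>parity\<close> in
  the second term.\<close>

lemma lwedge_shuffle:
  "lwedge a b vs = (\<Sum>I\<in>Pow {..<length vs}.
     (-1) ^ card {(i, j). i \<in> I \<and> j \<in> {..<length vs} - I \<and> j < i} * a (nths vs I) * b (nths vs (- I)))"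
proof (induction vs arbitrary: a b)
  case Nil
  then show ?case by simp
next
  case (Cons v vs)
  let ?n = "length vs"
  define ivs where "ivs n I = {(i, j). i \<in> I \<and> j \<in> {..<n} - I \<and> j < i}" for n and I :: "nat set"
  define t where "t I = (-1) ^ card (ivs (Suc ?n) I) * a (nths (v # vs) I) * b (nths (v # vs) (- I))" for I
  have fin: "finite (ivs ?n I)" if "I \<subseteq> {..<?n}" for I
    by (rule finite_subset[of _ "{..<?n} \<times> {..<?n}"]) (use that in \<open>auto simp: ivs_def\<close>)
  have inj: "inj_on (map_prod Suc Suc) A" for A by (auto simp: inj_on_def)
  have inv1: "card (ivs (Suc ?n) (insert 0 (Suc ` I))) = card (ivs ?n I)" if "I \<subseteq> {..<?n}" for I
  proof -
    have "ivs (Suc ?n) (insert 0 (Suc ` I)) = map_prod Suc Suc ` ivs ?n I"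
    proof (intro subset_antisym subsetI)
      fix x assume "x \<in> ivs (Suc ?n) (insert 0 (Suc ` I))"
      then obtain i j where x: "x = (i, j)" "i \<in> insert 0 (Suc ` I)" "j < Suc ?n" "j \<notin> insert 0 (Suc ` I)" "j < i"
        by (auto simp: ivs_def)
      then obtain i' j' where "i = Suc i'" "j = Suc j'" by (metis insertCI not_less0 old.nat.exhaust)
      with x show "x \<in> map_prod Suc Suc ` ivs ?n I" by (auto simp: ivs_def)
    qed (auto simp: ivs_def)
    then show ?thesis by (simp add: card_image[OF inj])
  qed
  have inv0: "card (ivs (Suc ?n) (Suc ` I)) = card I + card (ivs ?n I)" if "I \<subseteq> {..<?n}" for I
  proof -
    have "ivs (Suc ?n) (Suc ` I) = (\<lambda>i. (Suc i, 0)) ` I \<union> map_prod Suc Suc ` ivs ?n I"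
    proof (intro subset_antisym subsetI)
      fix x assume "x \<in> ivs (Suc ?n) (Suc ` I)"
      then obtain i j where x: "x = (Suc i, j)" "i \<in> I" "j < Suc ?n" "j \<notin> Suc ` I" "j < Suc i"
        by (auto simp: ivs_def)
      then show "x \<in> (\<lambda>i. (Suc i, 0)) ` I \<union> map_prod Suc Suc ` ivs ?n I"
        by (cases j) (auto simp: ivs_def)
    qed (auto simp: ivs_def)
    moreover have "card ((\<lambda>i. (Suc i, 0::nat)) ` I \<union> map_prod Suc Suc ` ivs ?n I)
        = card ((\<lambda>i. (Suc i, 0::nat)) ` I) + card (map_prod Suc Suc ` ivs ?n I)"
      by (rule card_Un_disjoint) (use fin[OF that] finite_subset[OF that] in auto)
    ultimately show ?thesis by (simp add: card_image[OF inj] card_image[of "\<lambda>i. (Suc i, 0)"] inj_on_def)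
  qed
  have Pow_Suc: "Pow {..<Suc ?n} = (`) Suc ` Pow {..<?n} \<union> (\<lambda>I. insert 0 (Suc ` I)) ` Pow {..<?n}"
    by (simp add: lessThan_Suc_eq_insert_0 Pow_insert image_Pow_surj[symmetric] image_image)
  have "(\<Sum>I\<in>Pow {..<Suc ?n}. t I)
      = (\<Sum>I\<in>(`) Suc ` Pow {..<?n}. t I) + (\<Sum>I\<in>(\<lambda>I. insert 0 (Suc ` I)) ` Pow {..<?n}. t I)"
    unfolding Pow_Suc by (rule sum.union_disjoint) auto
  also have "(\<Sum>I\<in>(`) Suc ` Pow {..<?n}. t I) = (\<Sum>I\<in>Pow {..<?n}. t (Suc ` I))"
    by (rule sum.reindex_cong[of "(`) Suc"]) (auto simp: inj_on_def inj_image_eq_iff)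
  also have "\<dots> = lwedge (parity a) (\<lambda>l. b (v # l)) vs"
    unfolding Cons.IH
  proof (rule sum.cong)
    fix I assume "I \<in> Pow {..<?n}"
    then have I: "I \<subseteq> {..<?n}" by simp
    \<comment> \<open>This is the length of \<open>nths vs I\<close>, which turns the sign into
      \<open>parity\<close>.\<close>
    then have "card {i. i < length vs \<and> i \<in> I} = card I" by (metis (no_types, lifting) Collect_mem_eq lessThan_iff subsetD Collect_cong)
    moreover have "{j. Suc j \<in> Suc ` I} = I" "{j. Suc j \<in> - Suc ` I} = - I" by auto
    ultimately show "t (Suc ` I) = (-1) ^ card {(i, j). i \<in> I \<and> j \<in> {..<?n} - I \<and> j < i}
        * parity a (nths vs I) * b (v # nths vs (- I))"
      using inv0[OF I] by (simp add: t_def nths_Cons parity_def length_nths power_add ivs_def[of ?n])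
  qed simp
  also have "(\<Sum>I\<in>(\<lambda>I. insert 0 (Suc ` I)) ` Pow {..<?n}. t I) = (\<Sum>I\<in>Pow {..<?n}. t (insert 0 (Suc ` I)))"
  proof (rule sum.reindex_cong[of "\<lambda>I. insert 0 (Suc ` I)"])
    show "inj_on (\<lambda>I. insert 0 (Suc ` I)) (Pow {..<?n})"
    proof (rule inj_onI)
      fix I K :: "nat set" assume "insert 0 (Suc ` I) = insert 0 (Suc ` K)"
      then have "Suc ` I = Suc ` K" by (metis Diff_insert_absorb image_iff nat.distinct(1))
      then show "I = K" by (simp add: inj_image_eq_iff)
    qed
  qed auto
  also have "\<dots> = lwedge (\<lambda>l. a (v # l)) b vs"
    unfolding Cons.IH
  proof (rule sum.cong)
    fix I assume "I \<in> Pow {..<?n}"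
    then have I: "I \<subseteq> {..<?n}" by simp
    have "{j. Suc j \<in> insert 0 (Suc ` I)} = I" "{j. Suc j \<in> - insert 0 (Suc ` I)} = - I" by auto
    then show "t (insert 0 (Suc ` I)) = (-1) ^ card {(i, j). i \<in> I \<and> j \<in> {..<?n} - I \<and> j < i}
        * a (v # nths vs I) * b (nths vs (- I))"
      using inv1[OF I] by (simp add: t_def nths_Cons ivs_def[of ?n])
  qed simp
  finally show ?case by (simp add: t_def ivs_def)
qed

lemma wedge_lwedge: "wedge \<alpha> \<beta> p = lwedge (\<alpha> p) (\<beta> p)"
  by (simp add: fun_eq_iff wedge_def lwedge_shuffle)

section \<open>Exterior derivative of coefficient functions in a chart\<close>

fun ldiff :: "('v::euclidean_space list \<Rightarrow> 'v \<Rightarrow> complex) \<Rightarrow> 'v list \<Rightarrow> 'v \<Rightarrow> complex" where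
  "ldiff a [] x = 0"
| "ldiff a (v # vs) x = fd (a vs) x v - ldiff (\<lambda>l. a (v # l)) vs x"

abbreviation del :: "nat \<Rightarrow> 'x list \<Rightarrow> 'x list" where
  "del i ws \<equiv> take i ws @ drop (Suc i) ws"

text \<open>Unrolling Cartan's recursion gives the alternating sum by which \<open>ext_d\<close> is
  defined.\<close>

lemma ldiff_sum: "ldiff a ws x = (\<Sum>i<length ws. (-1) ^ i * fd (a (del i ws)) x (ws ! i))"
proof (induction ws arbitrary: a)
  case (Cons v vs)
  then show ?case by (simp add: sum.lessThan_Suc_shift sum_negf del: sum.lessThan_Suc)
qed simp

abbreviation smooth_coeffs :: "'v::euclidean_space set \<Rightarrow> ('x list \<Rightarrow> 'v \<Rightarrow> complex) \<Rightarrow> bool" where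
  "smooth_coeffs S a \<equiv> \<forall>l. smooth_on S (a l)"

lemma ldiff_cong:
  assumes "open S" "x \<in> S" "\<And>l y. y \<in> S \<Longrightarrow> a l y = b l y"
  shows "ldiff a ws x = ldiff b ws x"
  unfolding ldiff_sum using fd_cong[OF assms(1,2), of "a _" "b _"] assms(3) by simp

lemma ldiff_eq_0:
  assumes "open S" "x \<in> S" "\<And>l y. y \<in> S \<Longrightarrow> Suc (length l) = length ws \<Longrightarrow> a l y = 0"
  shows "ldiff a ws x = 0"
  unfolding ldiff_sum
proof (rule sum.neutral, safe)
  fix i assume "i < length ws"
  then have "fd (a (del i ws)) x = fd (\<lambda>_. 0) x"
    by (intro fd_cong[OF assms(1,2)]) (simp add: assms(3))
  then show "(-1) ^ i * fd (a (del i ws)) x (ws ! i) = 0" by simp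
qed

context
  fixes S :: "'v::euclidean_space set" and x :: 'v
  assumes S: "open S" "x \<in> S"
begin

lemma fd_add: "smooth_on S f \<Longrightarrow> smooth_on S g \<Longrightarrow> fd (\<lambda>y. f y + g y) x v = fd f x v + fd g x v"
  using fd_eqI[OF has_derivative_add[OF fd_smooth[OF _ S(2)] fd_smooth[OF _ S(2)]], of f g] by simp

lemma fd_mult:
  fixes f g :: "'v \<Rightarrow> complex"
  shows "smooth_on S f \<Longrightarrow> smooth_on S g \<Longrightarrow> fd (\<lambda>y. f y * g y) x v = f x * fd g x v + fd f x v * g x"
  using fd_eqI[OF has_derivative_mult[OF fd_smooth[OF _ S(2)] fd_smooth[OF _ S(2)]], of f g] by simp

lemma fd_scaleR:
  "smooth_on S f \<Longrightarrow> smooth_on S g \<Longrightarrow> fd (\<lambda>y. f y *\<^sub>R g y) x v = f x *\<^sub>R fd g x v + fd f x v *\<^sub>R g x"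
  using fd_eqI[OF has_derivative_scaleR[OF fd_smooth[OF _ S(2)] fd_smooth[OF _ S(2)]], of f g] by simp

lemma fd_cmult:
  fixes f :: "'v \<Rightarrow> complex"
  shows "smooth_on S f \<Longrightarrow> fd (\<lambda>y. c * f y) x v = c * fd f x v"
  using fd_mult[OF smooth_on_const, of f c v] by simp

lemma fd_uminus:
  fixes f :: "'v \<Rightarrow> complex"
  shows "smooth_on S f \<Longrightarrow> fd (\<lambda>y. - f y) x v = - fd f x v"
  using fd_cmult[of f "-1"] by simp

lemma fd_diff:
  fixes f g :: "'v \<Rightarrow> complex"
  shows "smooth_on S f \<Longrightarrow> smooth_on S g \<Longrightarrow> fd (\<lambda>y. f y - g y) x v = fd f x v - fd g x v"
  using fd_add[of f "\<lambda>y. - g y"] by (simp add: fd_uminus smooth_on_minus[OF S(1)])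

lemma fd_sum:
  assumes "finite I" "\<And>i. i \<in> I \<Longrightarrow> smooth_on S (f i)"
  shows "fd (\<lambda>y. \<Sum>i\<in>I. f i y) x v = (\<Sum>i\<in>I. fd (f i) x v)"
  using assms
  by (induction I rule: finite_induct) (simp_all add: fd_add smooth_on_sum[OF S(1)])

lemma ldiff_add: "smooth_coeffs S a \<Longrightarrow> smooth_coeffs S b \<Longrightarrow> ldiff (\<lambda>l y. a l y + b l y) ws x = ldiff a ws x + ldiff b ws x"
  by (simp add: ldiff_sum fd_add distrib_left sum.distrib)

lemma ldiff_cmult: "smooth_coeffs S a \<Longrightarrow> ldiff (\<lambda>l y. c * a l y) ws x = c * ldiff a ws x"
  by (simp add: ldiff_sum fd_cmult sum_distrib_left ac_simps)

lemma ldiff_diff: "smooth_coeffs S a \<Longrightarrow> smooth_coeffs S b \<Longrightarrow> ldiff (\<lambda>l y. a l y - b l y) ws x = ldiff a ws x - ldiff b ws x"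
  by (simp add: ldiff_sum fd_diff right_diff_distrib sum_subtractf)

text \<open>Each summand of \<open>ldiff\<close> sees a list shorter by one, whence the
  sign.\<close>

lemma ldiff_parity:
  assumes "smooth_coeffs S a"
  shows "ldiff (\<lambda>l y. parity (\<lambda>m. a m y) l) ws x = - parity (\<lambda>m. ldiff a m x) ws"
proof -
  have "(-1) ^ i * fd (\<lambda>y. (-1) ^ length (del i ws) * a (del i ws) y) x (ws ! i)
      = - ((-1) ^ length ws * ((-1) ^ i * fd (a (del i ws)) x (ws ! i)))" if "i < length ws" for i
  proof -
    obtain n where n: "length ws = Suc n" using \<open>i < length ws\<close> by (cases "length ws") auto
    then have "length (del i ws) = n" using that by simp
    then show ?thesis using assms by (simp add: fd_cmult n ac_simps)
  qed
  then show ?thesis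
    by (simp add: ldiff_sum parity_def sum_distrib_left sum_negf[symmetric] del: length_append)
qed

end

lemma smooth_coeffs_parity: "open S \<Longrightarrow> smooth_coeffs S a \<Longrightarrow> smooth_coeffs S (\<lambda>l y. parity (\<lambda>m. a m y) l)"
  unfolding parity_def by (auto intro!: smooth_on_mult smooth_on_const)

lemma smooth_on_ldiff: "open S \<Longrightarrow> smooth_coeffs S a \<Longrightarrow> smooth_on S (ldiff a ws)"
proof (induction ws arbitrary: a)
  case Nil
  show ?case using smooth_on_const by (simp add: fun_eq_iff[symmetric])
next
  case (Cons v vs)
  have "smooth_on S (\<lambda>x. fd (a vs) x v + - ldiff (\<lambda>l. a (v # l)) vs x)"
    by (intro smooth_on_add smooth_on_minus smooth_on_fd Cons.IH) (use Cons.prems in auto)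
  then show ?case by simp
qed

lemma smooth_on_lwedge: "open S \<Longrightarrow> smooth_coeffs S a \<Longrightarrow> smooth_coeffs S b \<Longrightarrow> smooth_on S (\<lambda>y. lwedge (\<lambda>l. a l y) (\<lambda>l. b l y) ws)"
proof (induction ws arbitrary: a b)
  case Nil
  then show ?case by (simp add: smooth_on_mult)
next
  case (Cons v vs)
  have "smooth_on S (\<lambda>y. lwedge (\<lambda>l. a (v # l) y) (\<lambda>l. b l y) vs)"
    by (rule Cons.IH) (use Cons.prems in auto)
  moreover have "smooth_on S (\<lambda>y. lwedge (\<lambda>l. parity (\<lambda>m. a m y) l) (\<lambda>l. b (v # l) y) vs)"
    by (rule Cons.IH) (use Cons.prems in \<open>auto simp: smooth_coeffs_parity\<close>)
  ultimately show ?case using smooth_on_add[OF Cons.prems(1)] by simp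
qed

lemma fd_lwedge:
  assumes "open S" "x \<in> S" "smooth_coeffs S a" "smooth_coeffs S b"
  shows "fd (\<lambda>y. lwedge (\<lambda>l. a l y) (\<lambda>l. b l y) ws) x v
    = lwedge (\<lambda>l. fd (a l) x v) (\<lambda>l. b l x) ws + lwedge (\<lambda>l. a l x) (\<lambda>l. fd (b l) x v) ws"
  using assms(3,4)
proof (induction ws arbitrary: a b)
  case Nil
  then show ?case using fd_mult[OF assms(1,2)] by (simp add: ac_simps)
next
  case (Cons w ws)
  have p: "fd (\<lambda>y. parity (\<lambda>m. a m y) l) x v = parity (\<lambda>m. fd (a m) x v) l" for l
    unfolding parity_def using Cons.prems by (simp add: fd_cmult[OF assms(1,2)])
  have "fd (\<lambda>y. lwedge (\<lambda>l. a l y) (\<lambda>l. b l y) (w # ws)) x v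
    = fd (\<lambda>y. lwedge (\<lambda>l. a (w # l) y) (\<lambda>l. b l y) ws) x v
      + fd (\<lambda>y. lwedge (\<lambda>l. parity (\<lambda>m. a m y) l) (\<lambda>l. b (w # l) y) ws) x v"
    by (simp, rule fd_add[OF assms(1,2)])
      (use Cons.prems in \<open>auto simp: smooth_on_lwedge[OF assms(1)] smooth_coeffs_parity[OF assms(1)]\<close>)
  also have "fd (\<lambda>y. lwedge (\<lambda>l. a (w # l) y) (\<lambda>l. b l y) ws) x v =
      lwedge (\<lambda>l. fd (a (w # l)) x v) (\<lambda>l. b l x) ws + lwedge (\<lambda>l. a (w # l) x) (\<lambda>l. fd (b l) x v) ws"
    by (rule Cons.IH) (use Cons.prems in auto)
  also have "fd (\<lambda>y. lwedge (\<lambda>l. parity (\<lambda>m. a m y) l) (\<lambda>l. b (w # l) y) ws) x v =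
     lwedge (\<lambda>l. fd (\<lambda>y. parity (\<lambda>m. a m y) l) x v) (\<lambda>l. b (w # l) x) ws
      + lwedge (\<lambda>l. parity (\<lambda>m. a m x) l) (\<lambda>l. fd (b (w # l)) x v) ws"
    by (rule Cons.IH) (use Cons.prems in \<open>auto simp: smooth_coeffs_parity[OF assms(1)]\<close>)
  finally show ?case by (simp add: p)
qed

text \<open>For a first vector \<open>v\<close>, the derivative along \<open>v\<close> is split by
  \<open>fd_lwedge\<close>, and the induction hypothesis is applied to the pairs
  (\<open>\<iota>\<^sub>va\<close>, \<open>b\<close>) and (\<open>\<epsilon>a\<close>,
  \<open>\<iota>\<^sub>vb\<close>). The sign in \<open>ldiff_parity\<close> makes the pieces
  recombine into contractions of \<open>da\<close> and \<open>db\<close>.\<close>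

lemma ldiff_lwedge:
  assumes "open S" "x \<in> S" "smooth_coeffs S a" "smooth_coeffs S b"
  shows "ldiff (\<lambda>l y. lwedge (\<lambda>m. a m y) (\<lambda>m. b m y) l) ws x
    = lwedge (\<lambda>m. ldiff a m x) (\<lambda>m. b m x) ws + lwedge (parity (\<lambda>m. a m x)) (\<lambda>m. ldiff b m x) ws"
  using assms(3,4)
proof (induction ws arbitrary: a b)
  case Nil
  then show ?case by simp
next
  case (Cons v vs)
  note sw = smooth_on_lwedge[OF assms(1)] and sp = smooth_coeffs_parity[OF assms(1)]
  have "ldiff (\<lambda>l y. lwedge (\<lambda>m. a m y) (\<lambda>m. b m y) l) (v # vs) x
    = fd (\<lambda>y. lwedge (\<lambda>m. a m y) (\<lambda>m. b m y) vs) x v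
      - ldiff (\<lambda>l y. lwedge (\<lambda>m. a (v # m) y) (\<lambda>m. b m y) l + lwedge (\<lambda>l. parity (\<lambda>m. a m y) l) (\<lambda>m. b (v # m) y) l) vs x"
    by simp
  also have "ldiff (\<lambda>l y. lwedge (\<lambda>m. a (v # m) y) (\<lambda>m. b m y) l + lwedge (\<lambda>l. parity (\<lambda>m. a m y) l) (\<lambda>m. b (v # m) y) l) vs x
    = ldiff (\<lambda>l y. lwedge (\<lambda>m. a (v # m) y) (\<lambda>m. b m y) l) vs x
      + ldiff (\<lambda>l y. lwedge (\<lambda>l. parity (\<lambda>m. a m y) l) (\<lambda>m. b (v # m) y) l) vs x"
    by (rule ldiff_add[OF assms(1,2)]) (use Cons.prems in \<open>auto simp: sw sp\<close>)
  also have "ldiff (\<lambda>l y. lwedge (\<lambda>m. a (v # m) y) (\<lambda>m. b m y) l) vs x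
    = lwedge (\<lambda>m. ldiff (\<lambda>m. a (v # m)) m x) (\<lambda>m. b m x) vs + lwedge (parity (\<lambda>m. a (v # m) x)) (\<lambda>m. ldiff b m x) vs"
    by (rule Cons.IH) (use Cons.prems in auto)
  also have "ldiff (\<lambda>l y. lwedge (\<lambda>l. parity (\<lambda>m. a m y) l) (\<lambda>m. b (v # m) y) l) vs x
    = lwedge (\<lambda>l. ldiff (\<lambda>l y. parity (\<lambda>m. a m y) l) l x) (\<lambda>m. b (v # m) x) vs
      + lwedge (parity (\<lambda>l. parity (\<lambda>m. a m x) l)) (\<lambda>m. ldiff (\<lambda>m. b (v # m)) m x) vs"
    by (rule Cons.IH) (use Cons.prems in \<open>auto simp: sp\<close>)
  also have "lwedge (\<lambda>l. ldiff (\<lambda>l y. parity (\<lambda>m. a m y) l) l x) (\<lambda>m. b (v # m) x) vs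
     = - lwedge (parity (\<lambda>l. ldiff a l x)) (\<lambda>m. b (v # m) x) vs"
    using Cons.prems by (simp add: ldiff_parity[OF assms(1,2)] lwedge_minus_left)
  finally show ?case
    using Cons.prems by (simp add: fd_lwedge[OF assms(1,2)] lwedge_diff_left lwedge_diff_right parity_cons lwedge_minus_left)
qed

text \<open>This is where the symmetry of second derivatives enters the proof of
  \<open>d\<^sup>2 = 0\<close>.\<close>

lemma fd_ldiff:
  assumes "open S" "x \<in> S" "smooth_coeffs S a"
  shows "fd (ldiff a ws) x v = ldiff (\<lambda>l y. fd (a l) y v) ws x"
  using assms(3)
proof (induction ws arbitrary: a)
  case Nil
  have "ldiff a [] = (\<lambda>_. 0)" by auto
  then show ?case by simp
next
  case (Cons w ws)
  have "ldiff a (w # ws) = (\<lambda>y. fd (a ws) y w - ldiff (\<lambda>l. a (w # l)) ws y)" by auto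
  then have "fd (ldiff a (w # ws)) x v = fd (\<lambda>y. fd (a ws) y w) x v - fd (ldiff (\<lambda>l. a (w # l)) ws) x v"
    using Cons.prems by (simp add: fd_diff[OF assms(1,2)] smooth_on_fd smooth_on_ldiff[OF assms(1)])
  also have "fd (\<lambda>y. fd (a ws) y w) x v = fd (\<lambda>y. fd (a ws) y v) x w"
    by (rule fd_symmetric[OF assms(1,2)]) (use Cons.prems in auto)
  also have "fd (ldiff (\<lambda>l. a (w # l)) ws) x v = ldiff (\<lambda>l y. fd (a (w # l)) y v) ws x"
    by (rule Cons.IH) (use Cons.prems in auto)
  finally show ?case by simp
qed

text \<open>Contracting with \<open>v\<close> and using Cartan's formula twice gives
  \<open>\<partial>\<^sub>vd - d\<partial>\<^sub>v + dd\<iota>\<^sub>v\<close>. The first two terms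
  cancel by \<open>fd_ldiff\<close> and the last vanishes by the induction hypothesis.\<close>

lemma ldiff_ldiff:
  assumes "open S" "x \<in> S" "smooth_coeffs S a"
  shows "ldiff (ldiff a) ws x = 0"
  using assms(3)
proof (induction ws arbitrary: a)
  case Nil
  then show ?case by simp
next
  case (Cons v vs)
  have "ldiff (\<lambda>l y. fd (a l) y v - ldiff (\<lambda>l. a (v # l)) l y) vs x
      = ldiff (\<lambda>l y. fd (a l) y v) vs x - ldiff (ldiff (\<lambda>l. a (v # l))) vs x"
    by (rule ldiff_diff[OF assms(1,2)]) (use Cons.prems in \<open>auto simp: smooth_on_fd smooth_on_ldiff[OF assms(1)]\<close>)
  also have "ldiff (ldiff (\<lambda>l. a (v # l))) vs x = 0" by (rule Cons.IH) (use Cons.prems in auto)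
  also have "ldiff (\<lambda>l y. fd (a l) y v - ldiff (\<lambda>l. a (v # l)) l y) vs x = ldiff (\<lambda>l. ldiff a (v # l)) vs x"
    by (rule arg_cong[of _ _ "\<lambda>a. ldiff a vs x"]) (auto simp: fun_eq_iff)
  finally show ?case using Cons.prems by (simp add: fd_ldiff[OF assms(1,2)])
qed

section \<open>Multilinear alternating functions on lists\<close>

definition multilin :: "('v::real_vector list \<Rightarrow> complex) \<Rightarrow> bool" where
  "multilin a \<longleftrightarrow> (\<forall>us \<xi> \<eta> vs s t. a (us @ (s *\<^sub>R \<xi> + t *\<^sub>R \<eta>) # vs)
     = of_real s * a (us @ \<xi> # vs) + of_real t * a (us @ \<eta> # vs))"

text \<open>Only neighbouring equal arguments are considered, which suits inductions on the list;
  with multilinearity the general case follows in \<open>adj_alternating\<close>.\<close>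

definition adj_alt :: "('x list \<Rightarrow> complex) \<Rightarrow> bool" where
  "adj_alt a \<longleftrightarrow> (\<forall>us \<xi> vs. a (us @ \<xi> # \<xi> # vs) = 0)"

lemma multilinD: "multilin a \<Longrightarrow> a (us @ (s *\<^sub>R \<xi> + t *\<^sub>R \<eta>) # vs)
     = of_real s * a (us @ \<xi> # vs) + of_real t * a (us @ \<eta> # vs)"
  unfolding multilin_def by blast

lemma adj_altD: "adj_alt a \<Longrightarrow> a (us @ \<xi> # \<xi> # vs) = 0"
  unfolding adj_alt_def by blast

lemma multilin_cons: "multilin a \<Longrightarrow> multilin (\<lambda>l. a (v # l))"
  and adj_alt_cons: "adj_alt a' \<Longrightarrow> adj_alt (\<lambda>l. a' (v' # l))"
  unfolding multilin_def adj_alt_def by (metis append_Cons)+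

lemma multilin_parity: "multilin a \<Longrightarrow> multilin (parity a)"
  and adj_alt_parity: "adj_alt a' \<Longrightarrow> adj_alt (parity a')"
  unfolding multilin_def adj_alt_def by (auto simp: parity_def algebra_simps)

lemma multilin_lwedge:
  assumes "multilin a" "multilin b"
  shows "multilin (lwedge a b)"
proof -
  have "lwedge a b (us @ (s *\<^sub>R \<xi> + t *\<^sub>R \<eta>) # vs)
     = of_real s * lwedge a b (us @ \<xi> # vs) + of_real t * lwedge a b (us @ \<eta> # vs)" for us \<xi> \<eta> vs s t
    using assms
  proof (induction us arbitrary: a b)
    case Nil
    have "(\<lambda>l. a ((s *\<^sub>R \<xi> + t *\<^sub>R \<eta>) # l)) = (\<lambda>l. of_real s * a (\<xi> # l) + of_real t * a (\<eta> # l))"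
      "(\<lambda>l. b ((s *\<^sub>R \<xi> + t *\<^sub>R \<eta>) # l)) = (\<lambda>l. of_real s * b (\<xi> # l) + of_real t * b (\<eta> # l))"
      using multilinD[OF Nil(1), of "[]"] multilinD[OF Nil(2), of "[]"] by (auto simp: fun_eq_iff)
    then show ?case by (simp add: lwedge_linear algebra_simps)
  next
    case (Cons u us)
    show ?case
      using Cons.IH[OF multilin_cons[OF Cons.prems(1)] Cons.prems(2)]
        Cons.IH[OF multilin_parity[OF Cons.prems(1)] multilin_cons[OF Cons.prems(2)]]
      by (simp add: algebra_simps)
  qed
  then show ?thesis unfolding multilin_def by blast
qed

lemma adj_alt_lwedge:
  assumes "adj_alt a" "adj_alt b"
  shows "adj_alt (lwedge a b)"
proof -
  have "lwedge a b (us @ \<xi> # \<xi> # vs) = 0" for us \<xi> vs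
    using assms
  proof (induction us arbitrary: a b)
    case Nil
    have "(\<lambda>l. a (\<xi> # \<xi> # l)) = (\<lambda>l. 0)" "(\<lambda>l. b (\<xi> # \<xi> # l)) = (\<lambda>l. 0)"
      using adj_altD[OF Nil(1), of "[]"] adj_altD[OF Nil(2), of "[]"] by (auto simp: fun_eq_iff)
    then show ?case by (simp add: parity_cons lwedge_linear)
  next
    case (Cons u us)
    show ?case
      using Cons.IH[OF adj_alt_cons[OF Cons.prems(1)] Cons.prems(2)]
        Cons.IH[OF adj_alt_parity[OF Cons.prems(1)] adj_alt_cons[OF Cons.prems(2)]]
      by simp
  qed
  then show ?thesis unfolding adj_alt_def by blast
qed

text \<open>Polarization: the vanishing value with \<open>\<xi> + \<eta>\<close> in both slots is
  expanded.\<close>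

lemma adj_swap:
  assumes "multilin a" "adj_alt a"
  shows "a (us @ \<xi> # \<eta> # vs) = - a (us @ \<eta> # \<xi> # vs)"
proof -
  have l: "a (us @ (\<xi> + \<eta>) # vs) = a (us @ \<xi> # vs) + a (us @ \<eta> # vs)" for us \<xi> \<eta> vs
    using multilinD[OF assms(1), of us 1 \<xi> 1 \<eta> vs] by simp
  have "0 = a (us @ (\<xi> + \<eta>) # (\<xi> + \<eta>) # vs)" using adj_altD[OF assms(2)] by simp
  also have "\<dots> = a (us @ \<xi> # (\<xi> + \<eta>) # vs) + a (us @ \<eta> # (\<xi> + \<eta>) # vs)" by (rule l)
  also have "\<dots> = a (us @ \<xi> # \<eta> # vs) + a (us @ \<eta> # \<xi> # vs)"
    using l[of "us @ [\<xi>]" \<xi> \<eta> vs] l[of "us @ [\<eta>]" \<xi> \<eta> vs] adj_altD[OF assms(2)] by simp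
  finally show ?thesis by (metis add.commute add_eq_0_iff)
qed

lemma adj_move:
  assumes "multilin a" "adj_alt a"
  shows "a (us @ \<xi> # vs) = (-1) ^ length us * a (\<xi> # us @ vs)"
  using assms
proof (induction us arbitrary: a)
  case (Cons u us)
  have "a (u # us @ \<xi> # vs) = (-1) ^ length us * a (u # \<xi> # us @ vs)"
    using Cons.IH[OF multilin_cons[OF Cons.prems(1)] adj_alt_cons[OF Cons.prems(2)]] .
  also have "a (u # \<xi> # us @ vs) = - a (\<xi> # u # us @ vs)"
    using adj_swap[OF Cons.prems, of "[]" u \<xi> "us @ vs"] by (simp only: append_Nil)
  finally show ?case by simp
qed simp

lemma adj_alternating:
  assumes "multilin a" "adj_alt a"
  shows "a (us @ \<xi> # vs @ \<xi> # ws) = 0"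
proof -
  have "a (us @ \<xi> # vs @ \<xi> # ws) = (-1) ^ length us * a (\<xi> # (us @ vs) @ \<xi> # ws)"
    using adj_move[OF assms, of us \<xi> "vs @ \<xi> # ws"] by simp
  also have "a (\<xi> # (us @ vs) @ \<xi> # ws) = 0"
    using adj_move[OF multilin_cons[OF assms(1)] adj_alt_cons[OF assms(2)], of \<xi> "us @ vs" \<xi> ws]
      adj_altD[OF assms(2), of "[]"] by simp
  finally show ?thesis by simp
qed

lemma multilin_ldiff:
  assumes "open S" "x \<in> S" "smooth_coeffs S a" "\<And>y. y \<in> S \<Longrightarrow> multilin (\<lambda>l. a l y)"
  shows "multilin (\<lambda>l. ldiff a l x)"
proof -
  have "ldiff a (us @ (s *\<^sub>R \<xi> + t *\<^sub>R \<eta>) # vs) x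
     = of_real s * ldiff a (us @ \<xi> # vs) x + of_real t * ldiff a (us @ \<eta> # vs) x" for us \<xi> \<eta> vs s t
    using assms(3,4)
  proof (induction us arbitrary: a)
    case Nil
    have l: "linear (fd (a vs) x)" using fd_smooth_linear[OF _ assms(2)] Nil(1) by blast
    have "ldiff (\<lambda>l. a ((s *\<^sub>R \<xi> + t *\<^sub>R \<eta>) # l)) vs x
        = ldiff (\<lambda>l y. of_real s * a (\<xi> # l) y + of_real t * a (\<eta> # l) y) vs x"
      by (rule ldiff_cong[OF assms(1,2)]) (use multilinD[OF Nil(2), of _ "[]"] in simp)
    also have "\<dots> = ldiff (\<lambda>l y. of_real s * a (\<xi> # l) y) vs x + ldiff (\<lambda>l y. of_real t * a (\<eta> # l) y) vs x"
      by (rule ldiff_add[OF assms(1,2)]) (use Nil in \<open>auto intro!: smooth_on_mult smooth_on_const assms(1)\<close>)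
    also have "\<dots> = of_real s * ldiff (\<lambda>l. a (\<xi> # l)) vs x + of_real t * ldiff (\<lambda>l. a (\<eta> # l)) vs x"
      using Nil by (simp add: ldiff_cmult[OF assms(1,2)])
    finally show ?case
      by (simp add: linear_add[OF l] linear_scale[OF l] scaleR_conv_of_real algebra_simps)
  next
    case (Cons u us)
    have "fd (a (us @ (s *\<^sub>R \<xi> + t *\<^sub>R \<eta>) # vs)) x u
       = fd (\<lambda>y. of_real s * a (us @ \<xi> # vs) y + of_real t * a (us @ \<eta> # vs) y) x u"
      by (rule fun_cong[OF fd_cong[OF assms(1,2)]]) (use multilinD[OF Cons.prems(2)] in simp)
    also have "\<dots> = fd (\<lambda>y. of_real s * a (us @ \<xi> # vs) y) x u + fd (\<lambda>y. of_real t * a (us @ \<eta> # vs) y) x u"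
      by (rule fd_add[OF assms(1,2)])
        (use Cons.prems in \<open>auto intro!: smooth_on_mult smooth_on_const assms(1)\<close>)
    also have "\<dots> = of_real s * fd (a (us @ \<xi> # vs)) x u + of_real t * fd (a (us @ \<eta> # vs)) x u"
      using Cons.prems by (simp add: fd_cmult[OF assms(1,2)])
    finally show ?case
      using Cons.IH[of "\<lambda>l. a (u # l)"] Cons.prems(1) multilin_cons[OF Cons.prems(2)]
      by (simp add: algebra_simps)
  qed
  then show ?thesis unfolding multilin_def by blast
qed

text \<open>If the equal vectors come first, the two derivative terms agree and have opposite signs,
  and what remains is \<open>ldiff\<close> of a function that vanishes.\<close>

lemma adj_alt_ldiff:
  assumes "open S" "x \<in> S" "\<And>y. y \<in> S \<Longrightarrow> adj_alt (\<lambda>l. a l y)"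
  shows "adj_alt (\<lambda>l. ldiff a l x)"
proof -
  have "ldiff a (us @ \<xi> # \<xi> # vs) x = 0" for us \<xi> vs
    using assms(3)
  proof (induction us arbitrary: a)
    case Nil
    have "ldiff (\<lambda>l. a (\<xi> # \<xi> # l)) vs x = 0"
      by (rule ldiff_eq_0[OF assms(1,2)]) (use adj_altD[OF Nil, of _ "[]"] in simp)
    then show ?case by simp
  next
    case (Cons u us)
    have "fd (a (us @ \<xi> # \<xi> # vs)) x = fd (\<lambda>y. 0) x"
      by (rule fd_cong[OF assms(1,2)]) (use adj_altD[OF Cons.prems] in simp)
    then show ?case using Cons.IH[of "\<lambda>l. a (u # l)"] adj_alt_cons[OF Cons.prems] by simp
  qed
  then show ?thesis unfolding adj_alt_def by blast
qed

text \<open>A differential form of mixed degree on \<open>S\<close>, given by its values on constant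
  vector fields.\<close>

definition local_form :: "'v::euclidean_space set \<Rightarrow> ('v list \<Rightarrow> 'v \<Rightarrow> complex) \<Rightarrow> bool" where
  "local_form S a \<longleftrightarrow> (\<forall>x\<in>S. multilin (\<lambda>l. a l x) \<and> adj_alt (\<lambda>l. a l x)) \<and> smooth_coeffs S a"

lemma local_form_cong:
  assumes "open S" "local_form S a" "\<And>l x. x \<in> S \<Longrightarrow> a l x = b l x"
  shows "local_form S b"
proof -
  have "(\<lambda>l. a l x) = (\<lambda>l. b l x)" if "x \<in> S" for x using assms(3)[OF that] by simp
  moreover have "smooth_on S (b l)" for l
    using smooth_on_cong[OF assms(1), of "a l" "b l"] assms(2,3) by (auto simp: local_form_def)
  ultimately show ?thesis using assms(2) by (auto simp: local_form_def)
qed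

lemma local_form_ldiff: "open S \<Longrightarrow> local_form S a \<Longrightarrow> local_form S (ldiff a)"
  by (auto simp: local_form_def intro: multilin_ldiff adj_alt_ldiff smooth_on_ldiff)

lemma local_form_lwedge: "open S \<Longrightarrow> local_form S a \<Longrightarrow> local_form S b \<Longrightarrow> local_form S (\<lambda>l y. lwedge (\<lambda>m. a m y) (\<lambda>m. b m y) l)"
  by (auto simp: local_form_def intro: multilin_lwedge adj_alt_lwedge smooth_on_lwedge)

lemma multilin_linear: "multilin a \<Longrightarrow> linear (\<lambda>\<xi>. a (us @ \<xi> # vs))"
  using multilinD[of a us 1 _ 1 _ vs] multilinD[of a us _ _ 0 _ vs]
  by (intro linearI) (simp_all add: scaleR_conv_of_real)

lemma multilin_basis:
  fixes \<xi> :: "'v::euclidean_space"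
  assumes "multilin a"
  shows "a (us @ \<xi> # vs) = (\<Sum>b\<in>Basis. (\<xi> \<bullet> b) *\<^sub>R a (us @ b # vs))"
proof -
  note l = multilin_linear[OF assms, of us vs]
  have "a (us @ \<xi> # vs) = a (us @ (\<Sum>b\<in>Basis. (\<xi> \<bullet> b) *\<^sub>R b) # vs)" by (simp add: euclidean_representation)
  also have "\<dots> = (\<Sum>b\<in>Basis. (\<xi> \<bullet> b) *\<^sub>R a (us @ b # vs))"
    by (simp add: linear_sum[OF l] linear_scale[OF l])
  finally show ?thesis .
qed

section \<open>Substituting a map and point-dependent vectors into a local form\<close>

context
  fixes S :: "'u::euclidean_space set" and T :: "'v::euclidean_space set"
    and \<phi> :: "'u \<Rightarrow> 'v" and a :: "'v list \<Rightarrow> 'v \<Rightarrow> complex"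
  assumes ST: "open S" "open T" "\<phi> ` S \<subseteq> T" "smooth_on S \<phi>"
    and a: "local_form T a"
begin

lemma subst_facts:
  "x \<in> S \<Longrightarrow> \<phi> x \<in> T" "y \<in> T \<Longrightarrow> multilin (\<lambda>l. a l y)" "y \<in> T \<Longrightarrow> adj_alt (\<lambda>l. a l y)" "smooth_on T (a l)"
  using a ST(3) by (auto simp: local_form_def)

text \<open>Smoothness of \<open>a\<close> is known for constant arguments only, so the last moving
  argument is expanded in the basis and its basis vectors join the constant tail \<open>cs\<close>.
  Hence the induction from the right.\<close>

lemma smooth_on_subst_aux:
  assumes "\<And>u. u \<in> set us \<Longrightarrow> smooth_on S u"
  shows "smooth_on S (\<lambda>x. a (map (\<lambda>u. u x) us @ cs) (\<phi> x))"
  using assms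
proof (induction us arbitrary: cs rule: rev_induct)
  case Nil
  then show ?case using smooth_on_compose[OF ST subst_facts(4)] by simp
next
  case (snoc u us)
  have "smooth_on S (\<lambda>x. \<Sum>b\<in>Basis. (u x \<bullet> b) *\<^sub>R a (map (\<lambda>u. u x) us @ b # cs) (\<phi> x))"
    by (intro smooth_on_sum ST smooth_on_scaleR smooth_on_inner_const snoc.IH)
      (use snoc.prems in auto)
  then show ?case
    by (rule smooth_on_cong[OF ST(1), rotated]) (simp add: multilin_basis[OF subst_facts(2)[OF subst_facts(1)], of _ _ "u _"])
qed

text \<open>The same expansion yields the product rule: one term moves the base point, and one term
  for each slot differentiates the vector there.\<close>

lemma fd_subst_aux:
  assumes "\<And>u. u \<in> set us \<Longrightarrow> smooth_on S u" and x: "x \<in> S"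
  shows "fd (\<lambda>x. a (map (\<lambda>u. u x) us @ cs) (\<phi> x)) x h
    = fd (a (map (\<lambda>u. u x) us @ cs)) (\<phi> x) (fd \<phi> x h)
      + (\<Sum>j<length us. a ((map (\<lambda>u. u x) us)[j := fd (us ! j) x h] @ cs) (\<phi> x))"
  using assms(1)
proof (induction us arbitrary: cs rule: rev_induct)
  case Nil
  show ?case
    using has_derivative_compose[OF fd_smooth[OF ST(4) x] fd_smooth[OF subst_facts(4)[of cs] subst_facts(1)[OF x]]]
    by (simp add: fd_eqI)
next
  case (snoc u us)
  let ?G = "\<lambda>b x. a (map (\<lambda>u. u x) us @ b # cs) (\<phi> x)"
  let ?us = "map (\<lambda>u. u x) us"
  note [simp] = multilin_basis[OF subst_facts(2)[OF subst_facts(1)[OF x]], of _ "u x", symmetric]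
    multilin_basis[OF subst_facts(2)[OF subst_facts(1)[OF x]], of _ "fd u x h", symmetric]
  have sG: "smooth_on S (?G b)" for b
    by (rule smooth_on_subst_aux) (use snoc.prems in auto)
  have su: "smooth_on S (\<lambda>y. u y \<bullet> b)" for b
    by (intro smooth_on_inner_const ST) (use snoc.prems in auto)
  have fu: "fd (\<lambda>y. u y \<bullet> b) x h = fd u x h \<bullet> b" for b
    by (rule fd_inner, rule smooth_on_differentiable[OF _ x]) (use snoc.prems in auto)
  have "fd (\<lambda>x. a (map (\<lambda>u. u x) (us @ [u]) @ cs) (\<phi> x)) x h
      = fd (\<lambda>x. \<Sum>b\<in>Basis. (u x \<bullet> b) *\<^sub>R ?G b x) x h"
    by (rule fun_cong[OF fd_cong[OF ST(1) x]])
      (simp add: multilin_basis[OF subst_facts(2)[OF subst_facts(1)], of _ _ "u _"])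
  also have "\<dots> = (\<Sum>b\<in>Basis. fd (\<lambda>x. (u x \<bullet> b) *\<^sub>R ?G b x) x h)"
    by (rule fd_sum[OF ST(1) x]) (auto intro!: smooth_on_scaleR ST sG su)
  also have "\<dots> = (\<Sum>b\<in>Basis. (u x \<bullet> b) *\<^sub>R fd (?G b) x h + (fd u x h \<bullet> b) *\<^sub>R ?G b x)"
    using fd_scaleR[OF ST(1) x su sG] by (simp add: fu)
  \<comment> \<open>The three groups come from moving the base point, an earlier slot and the last
    slot; the first two are reassembled from the basis below.\<close>
  also have "\<dots> = (\<Sum>b\<in>Basis. (u x \<bullet> b) *\<^sub>R fd (a (?us @ b # cs)) (\<phi> x) (fd \<phi> x h))
      + (\<Sum>b\<in>Basis. \<Sum>j<length us. (u x \<bullet> b) *\<^sub>R a (?us[j := fd (us ! j) x h] @ b # cs) (\<phi> x))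
      + a (?us @ fd u x h # cs) (\<phi> x)"
    using snoc.IH snoc.prems by (simp add: sum.distrib scaleR_add_right scaleR_sum_right)
  also have "(\<Sum>b\<in>Basis. (u x \<bullet> b) *\<^sub>R fd (a (?us @ b # cs)) (\<phi> x) (fd \<phi> x h))
      = fd (a (?us @ u x # cs)) (\<phi> x) (fd \<phi> x h)"
  proof -
    have "fd (a (?us @ u x # cs)) (\<phi> x) (fd \<phi> x h)
        = fd (\<lambda>y. \<Sum>b\<in>Basis. (u x \<bullet> b) *\<^sub>R a (?us @ b # cs) y) (\<phi> x) (fd \<phi> x h)"
      by (rule fun_cong[OF fd_cong[OF ST(2) subst_facts(1)[OF x]]])
        (simp add: multilin_basis[OF subst_facts(2), of _ _ "u x"])
    also have "\<dots> = (\<Sum>b\<in>Basis. fd (\<lambda>y. (u x \<bullet> b) *\<^sub>R a (?us @ b # cs) y) (\<phi> x) (fd \<phi> x h))"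
      by (rule fd_sum[OF ST(2) subst_facts(1)[OF x]])
        (auto intro!: smooth_on_scaleR ST smooth_on_const subst_facts)
    also have "\<dots> = (\<Sum>b\<in>Basis. (u x \<bullet> b) *\<^sub>R fd (a (?us @ b # cs)) (\<phi> x) (fd \<phi> x h))"
      by (simp add: fd_scaleR[OF ST(2) subst_facts(1)[OF x] smooth_on_const subst_facts(4)])
    finally show ?thesis by simp
  qed
  also have "(\<Sum>b\<in>Basis. \<Sum>j<length us. (u x \<bullet> b) *\<^sub>R a (?us[j := fd (us ! j) x h] @ b # cs) (\<phi> x))
      = (\<Sum>j<length us. a (?us[j := fd (us ! j) x h] @ u x # cs) (\<phi> x))"
    by (subst sum.swap) simp
  finally show ?case
    by (simp add: list_update_append nth_append)
qed

lemma smooth_on_subst: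
  assumes "\<And>w. smooth_on S (\<lambda>x. L x w)"
  shows "smooth_on S (\<lambda>x. a (map (L x) ws) (\<phi> x))"
  using smooth_on_subst_aux[of "map (\<lambda>w x. L x w) ws" "[]"] assms by (auto simp: comp_def)

text \<open>Used with \<open>L x\<close> the derivative of a coordinate map for pullbacks, and with
  \<open>\<phi>\<close> the identity and \<open>L x\<close> the matrix of an endomorphism for the
  action of \<open>J\<close>.\<close>

lemma local_form_subst:
  assumes "\<And>x. x \<in> S \<Longrightarrow> linear (L x)" "\<And>w. smooth_on S (\<lambda>x. L x w)"
  shows "local_form S (\<lambda>ws x. a (map (L x) ws) (\<phi> x))"
  unfolding local_form_def
proof (intro conjI ballI allI)
  fix x assume x: "x \<in> S"
  show "multilin (\<lambda>l. a (map (L x) l) (\<phi> x))"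
    using multilinD[OF subst_facts(2)[OF subst_facts(1)[OF x]]]
    by (simp add: multilin_def linear_add[OF assms(1)[OF x]] linear_scale[OF assms(1)[OF x]])
  show "adj_alt (\<lambda>l. a (map (L x) l) (\<phi> x))"
    using adj_altD[OF subst_facts(3)[OF subst_facts(1)[OF x]]] by (simp add: adj_alt_def)
qed (rule smooth_on_subst[OF assms(2)])

lemma fd_subst:
  assumes "\<And>w. smooth_on S (\<lambda>x. L x w)" and x: "x \<in> S"
  shows "fd (\<lambda>x. a (map (L x) ws) (\<phi> x)) x h
    = fd (a (map (L x) ws)) (\<phi> x) (fd \<phi> x h)
      + (\<Sum>j<length ws. a ((map (L x) ws)[j := fd (\<lambda>y. L y (ws ! j)) x h]) (\<phi> x))"
  using fd_subst_aux[of "map (\<lambda>w x. L x w) ws" x "[]"] assms by (auto simp: comp_def)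

end

lemma del_Cons: "del 0 (v # vs) = vs" "del (Suc i) (v # vs) = v # del i vs"
  by auto

lemma update_move:
  assumes "multilin a" "adj_alt a" "i < length us"
  shows "a (us[i := b]) = (-1) ^ i * a (b # del i us)"
proof -
  have "us[i := b] = take i us @ b # drop (Suc i) us" using assms(3) by (rule upd_conv_take_nth_drop)
  then show ?thesis using adj_move[OF assms(1,2), of "take i us" b] assms(3) by simp
qed

text \<open>\<open>B\<close> is the second derivative of a change of variables; by alternation the terms for
  \<open>(i, j)\<close> and \<open>(j, i)\<close> differ by a sign.\<close>

lemma second_order_terms_cancel:
  assumes "multilin a" "adj_alt a" and sym: "\<And>v w. B v w = B w v"
  shows "(\<Sum>i<length ws. (-1) ^ i *
      (\<Sum>j<length ws - 1. a ((map L (del i ws))[j := B (ws ! i) (del i ws ! j)]))) = (0 :: complex)"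
  using assms(1,2)
proof (induction ws arbitrary: a)
  case (Cons v vs)
  \<comment> \<open>Beyond the head, slot 0 of the shortened list holds \<open>L v\<close>.
    Replacing it gives the partners of the head's terms, by symmetry of \<open>B\<close>; replacing
    another slot gives a term of the tail's sum.\<close>
  have eq: "(\<Sum>j<length vs. a ((map L (del (Suc i) (v # vs)))[j := B (vs ! i) (del (Suc i) (v # vs) ! j)]))
      = a (B v (vs ! i) # map L (del i vs))
        + (\<Sum>j<length vs - 1. a (L v # (map L (del i vs))[j := B (vs ! i) (del i vs ! j)]))"
    if i: "i < length vs" for i
  proof -
    obtain n where n: "length vs = Suc n" using i by (cases "length vs") auto
    show ?thesis
      unfolding del_Cons n sum.lessThan_Suc_shift by (simp add: sym[of v])
  qed
  have "(\<Sum>i<length (v # vs). (-1) ^ i *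
      (\<Sum>j<length (v # vs) - 1. a ((map L (del i (v # vs)))[j := B ((v # vs) ! i) (del i (v # vs) ! j)])))
    = (\<Sum>j<length vs. a ((map L vs)[j := B v (vs ! j)]))
      - (\<Sum>i<length vs. (-1) ^ i *
      (\<Sum>j<length vs. a ((map L (del (Suc i) (v # vs)))[j := B (vs ! i) (del (Suc i) (v # vs) ! j)])))"
    by (simp add: sum.lessThan_Suc_shift sum_negf del: sum.lessThan_Suc)
  also have "(\<Sum>i<length vs. (-1) ^ i *
      (\<Sum>j<length vs. a ((map L (del (Suc i) (v # vs)))[j := B (vs ! i) (del (Suc i) (v # vs) ! j)])))
    = (\<Sum>i<length vs. (-1) ^ i * a (B v (vs ! i) # map L (del i vs))) +
      (\<Sum>i<length vs. (-1) ^ i * (\<Sum>j<length vs - 1. a (L v # (map L (del i vs))[j := B (vs ! i) (del i vs ! j)])))"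
    unfolding sum.distrib[symmetric] distrib_left[symmetric]
    by (rule sum.cong[OF refl]) (simp only: eq lessThan_iff)
  also have "(\<Sum>i<length vs. (-1) ^ i * (\<Sum>j<length vs - 1. a (L v # (map L (del i vs))[j := B (vs ! i) (del i vs ! j)]))) = 0"
    by (rule Cons.IH[OF multilin_cons[OF Cons.prems(1)] adj_alt_cons[OF Cons.prems(2)]])
  also have "(\<Sum>j<length vs. a ((map L vs)[j := B v (vs ! j)]))
    = (\<Sum>i<length vs. (-1) ^ i * a (B v (vs ! i) # map L (del i vs)))"
    by (rule sum.cong) (simp_all add: update_move[OF Cons.prems] take_map drop_map)
  finally show ?case by simp
qed simp

text \<open>By \<open>fd_subst\<close> the left side is the right side plus terms with the second
  derivative of \<open>\<phi>\<close>, and \<open>second_order_terms_cancel\<close> removes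
  these.\<close>

lemma ldiff_pullback:
  assumes ST: "open S" "open T" "\<phi> ` S \<subseteq> T" "smooth_on S \<phi>" and a: "local_form T a" and x: "x \<in> S"
  shows "ldiff (\<lambda>ws x. a (map (fd \<phi> x) ws) (\<phi> x)) ws x = ldiff a (map (fd \<phi> x) ws) (\<phi> x)"
proof -
  note A = ST a
  have "ldiff (\<lambda>ws x. a (map (fd \<phi> x) ws) (\<phi> x)) ws x
    = (\<Sum>i<length ws. (-1) ^ i * fd (a (map (fd \<phi> x) (del i ws))) (\<phi> x) (fd \<phi> x (ws ! i)))
     + (\<Sum>i<length ws. (-1) ^ i * (\<Sum>j<length (del i ws).
          a ((map (fd \<phi> x) (del i ws))[j := fd (\<lambda>y. fd \<phi> y (del i ws ! j)) x (ws ! i)]) (\<phi> x)))"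
    by (simp only: ldiff_sum fd_subst[OF A smooth_on_fd[OF ST(4)] x] distrib_left sum.distrib)
  also have "(\<Sum>i<length ws. (-1) ^ i * (\<Sum>j<length (del i ws).
          a ((map (fd \<phi> x) (del i ws))[j := fd (\<lambda>y. fd \<phi> y (del i ws ! j)) x (ws ! i)]) (\<phi> x)))
     = (\<Sum>i<length ws. (-1) ^ i * (\<Sum>j<length ws - 1.
          a ((map (fd \<phi> x) (del i ws))[j := fd (\<lambda>y. fd \<phi> y (del i ws ! j)) x (ws ! i)]) (\<phi> x)))"
    by (intro sum.cong refl arg_cong2[of _ _ _ _ "(*)"]) auto
  also have "\<dots> = 0"
    by (rule second_order_terms_cancel[where B = "\<lambda>v w. fd (\<lambda>y. fd \<phi> y w) x v"])
      (use subst_facts[OF A] x fd_symmetric[OF ST(1) x ST(4)] in auto)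
  finally show ?thesis by (simp add: ldiff_sum take_map drop_map)
qed

section \<open>Coefficients of forms in charts\<close>

lemma local_form_local:
  assumes "\<And>x. x \<in> S \<Longrightarrow> \<exists>T. open T \<and> x \<in> T \<and> local_form T a"
  shows "local_form S a"
  unfolding local_form_def
proof (intro conjI ballI allI)
  fix l show "smooth_on S (a l)"
    by (rule smooth_on_local) (use assms in \<open>unfold local_form_def, blast\<close>)
qed (use assms in \<open>unfold local_form_def, blast+\<close>)

abbreviation lrep :: "('a, 'v) chart \<Rightarrow> ('a \<Rightarrow> 'b) \<Rightarrow> ('b, 'w) chart \<Rightarrow> 'v \<Rightarrow> 'w" where
  "lrep c f c' \<equiv> cmap c' \<circ> f \<circ> cinv c"

abbreviation ldom :: "('a, 'v) chart \<Rightarrow> ('a \<Rightarrow> 'b) \<Rightarrow> ('b, 'w) chart \<Rightarrow> 'v set" where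
  "ldom c f c' \<equiv> cmap c ` (cdom c \<inter> f -` cdom c')"

lemma charts_at_iff: "c \<in> charts_at M p \<longleftrightarrow> c \<in> atlas M \<and> p \<in> cdom c"
  by (simp add: charts_at_def)

context
  fixes M :: "('a, 'v::euclidean_space) manifold"
  assumes M: "smooth_manifold M"
begin

lemma atlasD:
  assumes "c \<in> atlas M"
  shows "openin (space_of M) (cdom c)" "open (cimg c)" "cdom c \<subseteq> points M"
    "homeomorphic_map (subtopology (space_of M) (cdom c)) (top_of_set (cimg c)) (cmap c)"
    "inj_on (cmap c) (cdom c)"
proof -
  show o: "openin (space_of M) (cdom c)" "open (cimg c)"
    and h: "homeomorphic_map (subtopology (space_of M) (cdom c)) (top_of_set (cimg c)) (cmap c)"
    using M assms by (auto simp: smooth_manifold_def)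
  show s: "cdom c \<subseteq> points M" using o(1) by (rule openin_subset)
  show "inj_on (cmap c) (cdom c)"
    using homeomorphic_imp_injective_map[OF h] s by (simp add: Int_absorb1)
qed

lemma cinv_cmap: "c \<in> atlas M \<Longrightarrow> p \<in> cdom c \<Longrightarrow> cinv c (cmap c p) = p"
  using atlasD(5) by (rule inv_into_f_f)

lemma cimgD:
  assumes "c \<in> atlas M" "x \<in> cimg c"
  shows "cinv c x \<in> cdom c" "cmap c (cinv c x) = x" "c \<in> charts_at M (cinv c x)" "cinv c x \<in> points M"
proof -
  show *: "cinv c x \<in> cdom c" "cmap c (cinv c x) = x"
    using assms(2) by (auto intro: inv_into_into f_inv_into_f)
  show "c \<in> charts_at M (cinv c x)" "cinv c x \<in> points M"
    using * assms(1) subsetD[OF atlasD(3)[OF assms(1)]] by (simp_all add: charts_at_iff)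
qed

lemma charts_atD:
  assumes "c \<in> charts_at M p"
  shows "c \<in> atlas M" "p \<in> cdom c" "cmap c p \<in> cimg c" "cinv c (cmap c p) = p" "p \<in> points M"
proof -
  show *: "c \<in> atlas M" "p \<in> cdom c" using assms by (simp_all add: charts_at_iff)
  then show "cmap c p \<in> cimg c" "cinv c (cmap c p) = p" by (simp_all add: cinv_cmap)
  show "p \<in> points M" using *(2) atlasD(3)[OF *(1)] by blast
qed

lemma ex_chart: "p \<in> points M \<Longrightarrow> \<exists>c. c \<in> charts_at M p"
proof -
  assume "p \<in> points M"
  moreover have "(\<Union>c\<in>atlas M. cdom c) = points M" using M by (simp add: smooth_manifold_def)
  ultimately show ?thesis unfolding charts_at_iff by blast
qed

lemma open_chart_image:
  assumes "c \<in> atlas M" "openin (space_of M) U"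
  shows "open (cmap c ` (cdom c \<inter> U))"
proof -
  have "openin (subtopology (space_of M) (cdom c)) (cdom c \<inter> U)"
    using assms(2) by (metis Int_commute openin_subtopology)
  then have "openin (top_of_set (cimg c)) (cmap c ` (cdom c \<inter> U))"
    using homeomorphic_imp_open_map[OF atlasD(4)[OF assms(1)]] by (simp add: open_map_def)
  then show ?thesis using atlasD(2)[OF assms(1)] by (simp add: openin_open_eq)
qed

text \<open>The coordinate expressions of the identity are the transition maps, so facts on smooth
  maps also serve for changes of chart.\<close>

lemma smooth_map_id: "smooth_map M M id"
proof -
  have "id -` A = A" for A :: "'a set" by auto
  then show ?thesis using M by (auto simp: smooth_map_def smooth_manifold_def)
qed

context
  fixes N :: "('b, 'w::euclidean_space) manifold" and f :: "'a \<Rightarrow> 'b"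
  assumes N: "smooth_manifold N" and f: "smooth_map M N f"
begin

lemma smooth_map_points: "p \<in> points M \<Longrightarrow> f p \<in> points N"
  using f by (auto simp: smooth_map_def continuous_map_def Pi_def)

lemma ldom_open:
  assumes "c \<in> atlas M" "c' \<in> atlas N"
  shows "open (ldom c f c')"
proof -
  \<comment> \<open>Continuity controls \<open>f\<close> on \<open>points M\<close> only; outside,
    its values are arbitrary. Inside a chart domain the two preimages agree.\<close>
  have "openin (space_of M) {p \<in> points M. f p \<in> cdom c'}"
    using f N assms(2)
    by (auto simp: smooth_map_def smooth_manifold_def intro: openin_continuous_map_preimage)
  from open_chart_image[OF assms(1) this]
  have "open (cmap c ` (cdom c \<inter> {p \<in> points M. f p \<in> cdom c'}))" .
  moreover have "cdom c \<inter> {p \<in> points M. f p \<in> cdom c'} = cdom c \<inter> f -` cdom c'"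
    using atlasD(3)[OF assms(1)] by auto
  ultimately show ?thesis by simp
qed

lemma lrep_smooth: "c \<in> atlas M \<Longrightarrow> c' \<in> atlas N \<Longrightarrow> smooth_on (ldom c f c') (lrep c f c')"
  using f by (simp add: smooth_map_def)

lemma ldom_iff:
  assumes "c \<in> atlas M"
  shows "x \<in> ldom c f c' \<longleftrightarrow> x \<in> cimg c \<and> f (cinv c x) \<in> cdom c'"
proof
  assume "x \<in> ldom c f c'"
  then obtain p where "p \<in> cdom c" "f p \<in> cdom c'" "x = cmap c p" by auto
  then show "x \<in> cimg c \<and> f (cinv c x) \<in> cdom c'" using cinv_cmap[OF assms] by auto
next
  assume x: "x \<in> cimg c \<and> f (cinv c x) \<in> cdom c'"
  then show "x \<in> ldom c f c'"
    using cimgD(1,2)[OF assms, of x] by (intro image_eqI[of _ _ "cinv c x"]) auto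
qed

lemma lrep_ldom: "c \<in> atlas M \<Longrightarrow> lrep c f c' ` ldom c f c' \<subseteq> cimg c'"
  using cinv_cmap by auto

lemma ldom_point:
  assumes "c \<in> charts_at M p" "c' \<in> charts_at N (f p)"
  shows "cmap c p \<in> ldom c f c'" "lrep c f c' (cmap c p) = cmap c' (f p)"
  using assms charts_atD(4)[OF assms(1)] by (auto simp: charts_at_iff)

lemma lrep_linear:
  assumes "c \<in> charts_at M p" "c' \<in> charts_at N (f p)"
  shows "linear (fd (lrep c f c') (cmap c p))"
  using assms ldom_point(1)[OF assms] by (auto intro: fd_smooth_linear lrep_smooth simp: charts_at_iff)

end

end

text \<open>With the identity for \<open>f\<close> or \<open>g\<close> this chain rule becomes the
  rule for changing the chart on either side.\<close>

lemma lrep_chain: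
  assumes M: "smooth_manifold M" and N: "smooth_manifold N" and P: "smooth_manifold P"
    and f: "smooth_map M N f" and g: "smooth_map N P g"
    and c: "c \<in> charts_at M p" "c' \<in> charts_at N (f p)" "c'' \<in> charts_at P (g (f p))"
  shows "fd (lrep c (g \<circ> f) c'') (cmap c p) v
    = fd (lrep c' g c'') (cmap c' (f p)) (fd (lrep c f c') (cmap c p) v)"
proof -
  note A = charts_atD(1)[OF M c(1)] charts_atD(1)[OF N c(2)] charts_atD(1)[OF P c(3)]
  have 1: "(lrep c f c' has_derivative fd (lrep c f c') (cmap c p)) (at (cmap c p))"
    by (rule fd_smooth[OF lrep_smooth[OF M N f A(1,2)] ldom_point(1)[OF M N f c(1,2)]])
  have 2: "(lrep c' g c'' has_derivative fd (lrep c' g c'') (cmap c' (f p))) (at (lrep c f c' (cmap c p)))"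
    unfolding ldom_point(2)[OF M N f c(1,2)]
    by (rule fd_smooth[OF lrep_smooth[OF N P g A(2,3)] ldom_point(1)[OF N P g c(2,3)]])
  have "fd (lrep c (g \<circ> f) c'') (cmap c p) = fd (\<lambda>x. lrep c' g c'' (lrep c f c' x)) (cmap c p)"
    by (rule fd_cong[OF ldom_open[OF M N f A(1,2)] ldom_point(1)[OF M N f c(1,2)]])
      (use cinv_cmap[OF M A(1)] cinv_cmap[OF N A(2)] in auto)
  also have "\<dots> = (\<lambda>v. fd (lrep c' g c'') (cmap c' (f p)) (fd (lrep c f c') (cmap c p) v))"
    by (rule fd_eqI[OF has_derivative_compose[OF 1 2]])
  finally show ?thesis by simp
qed

section \<open>Tangent vectors and forms in a chart\<close>

context
  fixes M :: "('a, 'v::euclidean_space) manifold"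
  assumes M: "smooth_manifold M"
begin

lemma tvec_of_same:
  assumes "c \<in> charts_at M p"
  shows "tvec_of M c p w c = w"
proof -
  have "fd (cmap c \<circ> cinv c) (cmap c p) = fd (\<lambda>x. x) (cmap c p)"
    by (rule fd_cong[OF atlasD(2)[OF M charts_atD(1)[OF M assms]] charts_atD(3)[OF M assms]])
      (use cimgD(2)[OF M charts_atD(1)[OF M assms]] in auto)
  then show ?thesis using assms by (simp add: tvec_of_def)
qed

text \<open>The cocycle rule for transition maps is \<open>lrep_chain\<close> with the identity map
  taken twice.\<close>

lemma tvec_of_tangent:
  assumes "c \<in> charts_at M p"
  shows "tvec_of M c p w \<in> tangent_space M p"
proof -
  note i = smooth_map_id[OF M]
  have *: "fd (cmap c'' \<circ> cinv c) (cmap c p) w = fd (cmap c'' \<circ> cinv c') (cmap c' p) (fd (cmap c' \<circ> cinv c) (cmap c p) w)"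
    if "c' \<in> charts_at M p" "c'' \<in> charts_at M p" for c' c''
    using lrep_chain[OF M M M i i, of c p c' c'' w] assms that by simp
  show ?thesis
    unfolding tangent_space_def tvec_of_def mem_Collect_eq
  proof (intro conjI ballI allI impI)
    fix c' c'' assume "c' \<in> charts_at M p" "c'' \<in> charts_at M p"
    then show "(if c'' \<in> charts_at M p then fd (cmap c'' \<circ> cinv c) (cmap c p) w else 0)
      = fd (cmap c'' \<circ> cinv c') (cmap c' p)
          (if c' \<in> charts_at M p then fd (cmap c' \<circ> cinv c) (cmap c p) w else 0)"
      using *[of c' c''] by (simp only: if_True)
  qed simp
qed

text \<open>With \<open>tvec_of_same\<close> this identifies the tangent space with the coordinate
  space of the chart, so that forms can be recovered from their coefficients.\<close>

lemma tvec_of_chart: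
  assumes "c \<in> charts_at M p" "\<xi> \<in> tangent_space M p"
  shows "tvec_of M c p (\<xi> c) = \<xi>"
proof
  fix c' show "tvec_of M c p (\<xi> c) c' = \<xi> c'"
  proof (cases "c' \<in> charts_at M p")
    case True
    then have "\<xi> c' = fd (cmap c' \<circ> cinv c) (cmap c p) (\<xi> c)" using assms unfolding tangent_space_def by blast
    then show ?thesis using True by (simp add: tvec_of_def)
  next
    case False
    then have "\<xi> c' = 0" using assms unfolding tangent_space_def by blast
    then show ?thesis using False by (simp add: tvec_of_def)
  qed
qed

lemma tvec_of_tlin:
  assumes "c \<in> charts_at M p"
  shows "tvec_of M c p (s *\<^sub>R v + t *\<^sub>R w) = tlin s (tvec_of M c p v) t (tvec_of M c p w)"
proof
  fix c'
  have l: "linear (fd (cmap c' \<circ> cinv c) (cmap c p))" if "c' \<in> charts_at M p"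
    using lrep_linear[OF M M smooth_map_id[OF M], of c p c'] assms that by simp
  show "tvec_of M c p (s *\<^sub>R v + t *\<^sub>R w) c' = tlin s (tvec_of M c p v) t (tvec_of M c p w) c'"
    using linear_add[OF l] linear_scale[OF l] by (auto simp: tvec_of_def tlin_def)
qed

lemma tlin_tangent:
  assumes "p \<in> points M" "\<xi> \<in> tangent_space M p" "\<eta> \<in> tangent_space M p"
  shows "tlin s \<xi> t \<eta> \<in> tangent_space M p"
proof -
  obtain c where c: "c \<in> charts_at M p" using ex_chart[OF M assms(1)] by blast
  show ?thesis
    using tvec_of_tangent[OF c] tvec_of_tlin[OF c, of s "\<xi> c" t "\<eta> c"] by (metis tvec_of_chart[OF c] assms(2,3))
qed

lemma tangent_list_tvec: "c \<in> charts_at M p \<Longrightarrow> tangent_list M p (map (tvec_of M c p) ws)"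
  using tvec_of_tangent[of c p] charts_atD(5)[OF M, of c p] by (auto simp: tangent_list_def)

lemma map_tvec_chart:
  assumes "c \<in> charts_at M p" "tangent_list M p vs"
  shows "map (tvec_of M c p) (map (\<lambda>\<xi>. \<xi> c) vs) = vs"
  using assms tvec_of_chart[OF assms(1)] by (auto simp: tangent_list_def subset_iff intro!: map_idI)

lemma map_chart_tvec: "c \<in> charts_at M p \<Longrightarrow> map (\<lambda>\<xi>. \<xi> c) (map (tvec_of M c p) ws) = ws"
  by (simp add: comp_def tvec_of_same)

lemma coeff_eval:
  assumes "c \<in> charts_at M p" "tangent_list M p vs"
  shows "coeff_in M \<omega> c (map (\<lambda>\<xi>. \<xi> c) vs) (cmap c p) = \<omega> p vs"
  unfolding coeff_in_def charts_atD(4)[OF M assms(1)] map_tvec_chart[OF assms] ..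

lemma forms_local_form:
  assumes "\<omega> \<in> forms M k" "c \<in> atlas M"
  shows "local_form (cimg c) (coeff_in M \<omega> c)"
  unfolding local_form_def
proof (intro conjI ballI allI)
  fix x assume x: "x \<in> cimg c"
  note c = cimgD(3)[OF M assms(2) x]
  have "\<omega> p (us @ tlin a \<xi> b \<eta> # vs) = of_real a * \<omega> p (us @ \<xi> # vs) + of_real b * \<omega> p (us @ \<eta> # vs)"
    if "tangent_list M p (us @ \<xi> # \<eta> # vs)" for p us \<xi> \<eta> vs a b
    using assms(1) that unfolding forms_def by blast
  then have "\<omega> (cinv c x) (map (tvec_of M c (cinv c x)) us @ tlin s (tvec_of M c (cinv c x) \<xi>) t (tvec_of M c (cinv c x) \<eta>) # map (tvec_of M c (cinv c x)) vs)
      = of_real s * \<omega> (cinv c x) (map (tvec_of M c (cinv c x)) us @ (tvec_of M c (cinv c x) \<xi>) # map (tvec_of M c (cinv c x)) vs)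
      + of_real t * \<omega> (cinv c x) (map (tvec_of M c (cinv c x)) us @ (tvec_of M c (cinv c x) \<eta>) # map (tvec_of M c (cinv c x)) vs)"
    for us \<xi> \<eta> vs s t
    using tangent_list_tvec[OF c, of "us @ \<xi> # \<eta> # vs"] by simp
  then show "multilin (\<lambda>l. coeff_in M \<omega> c l x)"
    unfolding multilin_def coeff_in_def by (simp add: tvec_of_tlin[OF c])
  have "\<omega> p (us @ \<xi> # vs @ \<xi> # ws) = 0" for p us \<xi> vs ws
    using assms(1) unfolding forms_def by blast
  from this[of _ _ _ "[]"] show "adj_alt (\<lambda>l. coeff_in M \<omega> c l x)"
    unfolding adj_alt_def coeff_in_def by simp
qed (use assms in \<open>simp add: forms_def\<close>)

text \<open>Multilinearity and alternation are pointwise, so one chart around the point suffices.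
  This is the converse of \<open>forms_local_form\<close>.\<close>

lemma formsI:
  assumes "\<And>p vs. \<not> (tangent_list M p vs \<and> int (length vs) = k) \<Longrightarrow> \<omega> p vs = 0"
    and "\<And>c. c \<in> atlas M \<Longrightarrow> local_form (cimg c) (coeff_in M \<omega> c)"
  shows "\<omega> \<in> forms M k"
  unfolding forms_def mem_Collect_eq
proof (intro conjI allI impI ballI)
  have chart: "\<exists>c. c \<in> charts_at M p \<and> multilin (\<lambda>l. coeff_in M \<omega> c l (cmap c p)) \<and>
      adj_alt (\<lambda>l. coeff_in M \<omega> c l (cmap c p))" if p: "p \<in> points M" for p
  proof -
    obtain c where c: "c \<in> charts_at M p" using ex_chart[OF M p] by blast
    then show ?thesis using assms(2)[OF charts_atD(1)[OF M c]] charts_atD(3)[OF M c]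
      unfolding local_form_def by blast
  qed
  fix p us \<xi> \<eta> vs a b
  assume t: "tangent_list M p (us @ \<xi> # \<eta> # vs)"
  then have p: "p \<in> points M" and \<xi>\<eta>: "\<xi> \<in> tangent_space M p" "\<eta> \<in> tangent_space M p"
    by (auto simp: tangent_list_def)
  obtain c where c: "c \<in> charts_at M p" and m: "multilin (\<lambda>l. coeff_in M \<omega> c l (cmap c p))"
    using chart[OF p] by blast
  have t': "tangent_list M p (us @ \<xi> # vs)" "tangent_list M p (us @ \<eta> # vs)"
    "tangent_list M p (us @ tlin a \<xi> b \<eta> # vs)"
    using t tlin_tangent[OF p \<xi>\<eta>] by (auto simp: tangent_list_def)
  have "map (\<lambda>\<xi>. \<xi> c) (us @ tlin a \<xi> b \<eta> # vs)
      = map (\<lambda>\<xi>. \<xi> c) us @ (a *\<^sub>R \<xi> c + b *\<^sub>R \<eta> c) # map (\<lambda>\<xi>. \<xi> c) vs"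
    by (simp add: tlin_def)
  then show "\<omega> p (us @ tlin a \<xi> b \<eta> # vs) = of_real a * \<omega> p (us @ \<xi> # vs) + of_real b * \<omega> p (us @ \<eta> # vs)"
    using t'[THEN coeff_eval[OF c, of _ \<omega>]] multilinD[OF m] by simp
next
  fix p us \<xi> vs ws
  show "\<omega> p (us @ \<xi> # vs @ \<xi> # ws) = 0"
  proof (cases "tangent_list M p (us @ \<xi> # vs @ \<xi> # ws)")
    case True
    then have p: "p \<in> points M" by (simp add: tangent_list_def)
    obtain c where c: "c \<in> charts_at M p" using ex_chart[OF M p] by blast
    then have m: "multilin (\<lambda>l. coeff_in M \<omega> c l (cmap c p))" "adj_alt (\<lambda>l. coeff_in M \<omega> c l (cmap c p))"
      using assms(2)[OF charts_atD(1)[OF M c]] charts_atD(3)[OF M c] unfolding local_form_def by blast+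
    show ?thesis using coeff_eval[OF c True, of \<omega>] adj_alternating[OF m] by simp
  next
    \<comment> \<open>\<open>forms\<close> asks for alternation on all lists; on those that are not
      tangent the value is zero.\<close>
    case False
    then show ?thesis using assms(1) by blast
  qed
qed (use assms in \<open>auto simp: local_form_def\<close>)

lemma forms_eq_0: "\<omega> \<in> forms M k \<Longrightarrow> \<not> tangent_list M p vs \<or> int (length vs) \<noteq> k \<Longrightarrow> \<omega> p vs = 0"
  unfolding forms_def by blast

lemma coeff_wedge:
  "coeff_in M (wedge \<alpha> \<beta>) c ws x = lwedge (\<lambda>l. coeff_in M \<alpha> c l x) (\<lambda>l. coeff_in M \<beta> c l x) ws"
  unfolding coeff_in_def wedge_lwedge lwedge_map ..

lemma wedge_forms:
  assumes "\<alpha> \<in> forms M p" "\<beta> \<in> forms M q"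
  shows "wedge \<alpha> \<beta> \<in> forms M (p + q)"
proof (rule formsI)
  fix x vs assume "\<not> (tangent_list M x vs \<and> int (length vs) = p + q)"
  then show "wedge \<alpha> \<beta> x vs = 0"
    unfolding wedge_lwedge
    \<comment> \<open>If both factors were nonzero, their sublists would be tangent of lengths
      \<open>p\<close> and \<open>q\<close>, so the whole list would be tangent of length
      \<open>p + q\<close>.\<close>
    by (intro lwedge_eq_0) (use forms_eq_0[OF assms(1), of x] forms_eq_0[OF assms(2), of x] in
        \<open>fastforce simp: tangent_list_def\<close>)
next
  fix c assume c: "c \<in> atlas M"
  show "local_form (cimg c) (coeff_in M (wedge \<alpha> \<beta>) c)"
    by (rule local_form_cong[OF _ local_form_lwedge[OF _ forms_local_form[OF assms(1) c] forms_local_form[OF assms(2) c]]])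
      (simp_all add: coeff_wedge atlasD[OF M c])
qed

end

lemma local_form_add: "open S \<Longrightarrow> local_form S a \<Longrightarrow> local_form S b \<Longrightarrow> local_form S (\<lambda>l x. a l x + b l x)"
  by (auto simp: local_form_def multilin_def adj_alt_def algebra_simps intro!: smooth_on_add)

lemma local_form_cmult: "open S \<Longrightarrow> local_form S a \<Longrightarrow> local_form S (\<lambda>l x. c * a l x)"
  by (auto simp: local_form_def multilin_def adj_alt_def algebra_simps intro!: smooth_on_mult smooth_on_const)

lemma coeff_add: "coeff_in M (\<alpha> + \<beta>) c l x = coeff_in M \<alpha> c l x + coeff_in M \<beta> c l x"
  and coeff_scale: "coeff_in M (scale_form z \<alpha>) c l x = z * coeff_in M \<alpha> c l x"
  by (simp_all add: coeff_in_def scale_form_def)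

lemma ext_d_ldiff:
  "ext_d M \<omega> p vs = (if tangent_list M p vs then
     ldiff (coeff_in M \<omega> (SOME c. c \<in> charts_at M p)) (map (\<lambda>\<xi>. \<xi> (SOME c. c \<in> charts_at M p)) vs)
       (cmap (SOME c. c \<in> charts_at M p) p) else 0)"
  by (simp add: ext_d_def ldiff_sum Let_def)

definition parity_form :: "('a, 'v) form \<Rightarrow> ('a, 'v) form" where
  "parity_form \<alpha> = (\<lambda>p. parity (\<alpha> p))"

lemma tangent_list_sub: "tangent_list M p vs \<Longrightarrow> set l \<subseteq> set vs \<Longrightarrow> tangent_list M p l"
  by (auto simp: tangent_list_def)

lemma wedge_add_left: "wedge (\<alpha> + \<beta>) \<gamma> = wedge \<alpha> \<gamma> + wedge \<beta> \<gamma>"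
  and wedge_add_right: "wedge \<gamma> (\<alpha> + \<beta>) = wedge \<gamma> \<alpha> + wedge \<gamma> \<beta>"
  and wedge_scale_left: "wedge (scale_form z \<alpha>) \<gamma> = scale_form z (wedge \<alpha> \<gamma>)"
  and wedge_scale_right: "wedge \<gamma> (scale_form z \<alpha>) = scale_form z (wedge \<gamma> \<alpha>)"
  and wedge_zero_left: "wedge 0 \<gamma> = 0"
  and wedge_zero_right: "wedge \<gamma> 0 = 0"
  by (auto simp: fun_eq_iff wedge_lwedge plus_fun_def scale_form_def lwedge_linear zero_fun_def)

lemma wedge_assoc: "wedge (wedge \<alpha> \<beta>) \<gamma> = wedge \<alpha> (wedge \<beta> \<gamma>)"
  by (simp add: fun_eq_iff wedge_lwedge lwedge_assoc)

lemma parity_form_parity_form: "parity_form (parity_form \<alpha>) = \<alpha>"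
  by (simp add: parity_form_def)

context
  fixes M :: "('a, 'v::euclidean_space) manifold"
  assumes M: "smooth_manifold M"
begin

lemma some_chart: "p \<in> points M \<Longrightarrow> (SOME c. c \<in> charts_at M p) \<in> charts_at M p"
  using ex_chart[OF M] by (rule someI_ex)

lemma forms_smooth_coeffs: "\<alpha> \<in> forms M k \<Longrightarrow> c \<in> atlas M \<Longrightarrow> smooth_coeffs (cimg c) (coeff_in M \<alpha> c)"
  by (simp add: forms_def)

text \<open>Values are recovered from any chart by \<open>coeff_eval\<close>. The two degrees may be
  different terms, which spares arithmetic on degrees.\<close>

lemma forms_eqI:
  assumes "\<alpha> \<in> forms M k" "\<beta> \<in> forms M l"
    and "\<And>c ws x. c \<in> atlas M \<Longrightarrow> x \<in> cimg c \<Longrightarrow> coeff_in M \<alpha> c ws x = coeff_in M \<beta> c ws x"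
  shows "\<alpha> = \<beta>"
proof (intro ext)
  fix p vs show "\<alpha> p vs = \<beta> p vs"
  proof (cases "tangent_list M p vs")
    case True
    then obtain c where c: "c \<in> charts_at M p" using ex_chart[OF M, of p] by (auto simp: tangent_list_def)
    show ?thesis
      using assms(3)[OF charts_atD(1)[OF M c] charts_atD(3)[OF M c]] coeff_eval[OF M c True] by metis
  qed (use forms_eq_0[OF M assms(1)] forms_eq_0[OF M assms(2)] in simp)
qed

lemma forms_add:
  assumes "\<alpha> \<in> forms M k" "\<beta> \<in> forms M k"
  shows "\<alpha> + \<beta> \<in> forms M k"
proof (rule formsI[OF M])
  fix c assume c: "c \<in> atlas M"
  note o = atlasD(2)[OF M c]
  show "local_form (cimg c) (coeff_in M (\<alpha> + \<beta>) c)"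
    by (rule local_form_cong[OF o local_form_add[OF o forms_local_form[OF M assms(1) c] forms_local_form[OF M assms(2) c]]])
      (simp add: coeff_add)
qed (simp add: forms_eq_0[OF M assms(1)] forms_eq_0[OF M assms(2)])

lemma forms_scale:
  assumes "\<alpha> \<in> forms M k"
  shows "scale_form z \<alpha> \<in> forms M k"
proof (rule formsI[OF M])
  fix c assume c: "c \<in> atlas M"
  note o = atlasD(2)[OF M c]
  show "local_form (cimg c) (coeff_in M (scale_form z \<alpha>) c)"
    by (rule local_form_cong[OF o local_form_cmult[OF o forms_local_form[OF M assms c], of z]]) (simp add: coeff_scale)
qed (simp add: scale_form_def forms_eq_0[OF M assms])

lemma forms_zero: "0 \<in> forms M k"
proof (rule formsI[OF M])
  have "coeff_in M 0 c = (\<lambda>l x. 0)" for c by (simp add: fun_eq_iff coeff_in_def)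
  then show "local_form (cimg c) (coeff_in M 0 c)" for c
    by (simp add: local_form_def multilin_def adj_alt_def smooth_on_const)
qed simp

text \<open>Values live on lists of length \<open>k\<close> only, so the sign is constant. For
  negative \<open>k\<close> the exponent \<open>nat k\<close> is a dummy, as then
  \<open>\<alpha>\<close> is zero.\<close>

lemma parity_form_scale: "\<alpha> \<in> forms M k \<Longrightarrow> parity_form \<alpha> = scale_form ((-1) ^ nat k) \<alpha>"
  unfolding fun_eq_iff parity_form_def parity_def scale_form_def using forms_eq_0[OF M, of \<alpha> k] by fastforce

lemma parity_form_forms: "\<alpha> \<in> forms M k \<Longrightarrow> parity_form \<alpha> \<in> forms M k"
  by (simp add: parity_form_scale forms_scale)

lemma unit_forms: "unit_form M \<in> forms M 0"
proof (rule formsI[OF M])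
  fix c assume c: "c \<in> atlas M"
  have "local_form (cimg c) (\<lambda>l x. if l = [] then 1 else 0)"
    by (auto simp: local_form_def multilin_def adj_alt_def smooth_on_const)
  then show "local_form (cimg c) (coeff_in M (unit_form M) c)"
    by (rule local_form_cong[OF atlasD(2)[OF M c]])
      (use cimgD(4)[OF M c] in \<open>auto simp: coeff_in_def unit_form_def\<close>)
qed (auto simp: unit_form_def tangent_list_def)

lemma wedge_unit:
  assumes "\<alpha> \<in> forms M k"
  shows "wedge (unit_form M) \<alpha> = \<alpha>" "wedge \<alpha> (unit_form M) = \<alpha>"
proof -
  have "unit_form M p = (\<lambda>l. if l = [] then 1 else 0)" if "p \<in> points M" for p
    using that by (auto simp: unit_form_def)
  moreover have "\<alpha> p vs = 0" "unit_form M p vs = 0" if "p \<notin> points M" for p vs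
    using that forms_eq_0[OF M assms, of p] by (auto simp: unit_form_def tangent_list_def)
  ultimately have "wedge (unit_form M) \<alpha> p vs = \<alpha> p vs \<and> wedge \<alpha> (unit_form M) p vs = \<alpha> p vs" for p vs
    by (cases "p \<in> points M") (simp_all add: wedge_lwedge lwedge_unit_left lwedge_unit_right lwedge_eq_0)
  then show "wedge (unit_form M) \<alpha> = \<alpha>" "wedge \<alpha> (unit_form M) = \<alpha>"
    by (simp_all add: fun_eq_iff)
qed

lemma ext_d_linear:
  assumes "\<alpha> \<in> forms M k" "\<beta> \<in> forms M l"
  shows "ext_d M (\<alpha> + \<beta>) = ext_d M \<alpha> + ext_d M \<beta>" "ext_d M (scale_form z \<alpha>) = scale_form z (ext_d M \<alpha>)"
proof -
  have "ext_d M (\<alpha> + \<beta>) p vs = ext_d M \<alpha> p vs + ext_d M \<beta> p vs \<and>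
    ext_d M (scale_form z \<alpha>) p vs = z * ext_d M \<alpha> p vs" for p vs
  proof (cases "tangent_list M p vs")
    case True
    then have p: "p \<in> points M" by (simp add: tangent_list_def)
    let ?c = "SOME c. c \<in> charts_at M p"
    note c = charts_atD[OF M some_chart[OF p]]
    note s = atlasD(2)[OF M c(1)] c(3)
    have "coeff_in M (\<alpha> + \<beta>) ?c = (\<lambda>l x. coeff_in M \<alpha> ?c l x + coeff_in M \<beta> ?c l x)"
      "coeff_in M (scale_form z \<alpha>) ?c = (\<lambda>l x. z * coeff_in M \<alpha> ?c l x)"
      by (simp_all add: fun_eq_iff coeff_add coeff_scale)
    then show ?thesis
      using True ldiff_add[OF s forms_smooth_coeffs[OF assms(1) c(1)] forms_smooth_coeffs[OF assms(2) c(1)]]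
        ldiff_cmult[OF s forms_smooth_coeffs[OF assms(1) c(1)]] by (simp add: ext_d_ldiff)
  qed (simp add: ext_d_ldiff)
  then show "ext_d M (\<alpha> + \<beta>) = ext_d M \<alpha> + ext_d M \<beta>" "ext_d M (scale_form z \<alpha>) = scale_form z (ext_d M \<alpha>)"
    by (simp_all add: fun_eq_iff scale_form_def)
qed

end

section \<open>Differentials of maps and pullback of forms\<close>

context
  fixes M :: "('a, 'v::euclidean_space) manifold" and N :: "('b, 'w::euclidean_space) manifold"
    and f :: "'a \<Rightarrow> 'b"
  assumes M: "smooth_manifold M" and N: "smooth_manifold N" and f: "smooth_map M N f"
begin

text \<open>Frees \<open>differential\<close> from its chosen chart: \<open>c0\<close> below is that
  choice, and \<open>lrep_chain\<close> with the identity changes it to \<open>c\<close>.\<close>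

lemma differential_tvec:
  assumes c: "c \<in> charts_at M p" and c': "c' \<in> charts_at N (f p)"
  shows "differential M N f p (tvec_of M c p w) = tvec_of N c' (f p) (fd (lrep c f c') (cmap c p) w)"
proof
  fix c''
  define c0 where "c0 = (SOME c. c \<in> charts_at M p)"
  have c0: "c0 \<in> charts_at M p" unfolding c0_def using c by (rule someI)
  show "differential M N f p (tvec_of M c p w) c'' = tvec_of N c' (f p) (fd (lrep c f c') (cmap c p) w) c''"
  proof (cases "c'' \<in> charts_at N (f p)")
    case True
    have "fd (lrep c0 f c'') (cmap c0 p) (fd (cmap c0 \<circ> cinv c) (cmap c p) w) = fd (lrep c f c'') (cmap c p) w"
      using lrep_chain[OF M M N smooth_map_id[OF M] f, of c p c0 c'' w] c c0 True by simp
    moreover have "fd (cmap c'' \<circ> cinv c') (cmap c' (f p)) (fd (lrep c f c') (cmap c p) w) = fd (lrep c f c'') (cmap c p) w"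
      using lrep_chain[OF M N N f smooth_map_id[OF N], of c p c' c'' w] c c' True by simp
    ultimately show ?thesis
      using True c0 by (simp add: differential_def c0_def[symmetric] tvec_of_def)
  next
    case False
    then show ?thesis by (simp add: differential_def tvec_of_def Let_def)
  qed
qed

lemma differential_tangent:
  assumes "p \<in> points M" "\<xi> \<in> tangent_space M p"
  shows "differential M N f p \<xi> \<in> tangent_space N (f p)"
proof -
  obtain c where c: "c \<in> charts_at M p" using ex_chart[OF M assms(1)] by blast
  obtain c' where c': "c' \<in> charts_at N (f p)" using ex_chart[OF N smooth_map_points[OF M N f assms(1)]] by blast
  show ?thesis
    using tvec_of_tangent[OF N c'] differential_tvec[OF c c', of "\<xi> c"] tvec_of_chart[OF M c assms(2)] by simp
qed

lemma differential_tlin: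
  assumes "p \<in> points M" "\<xi> \<in> tangent_space M p" "\<eta> \<in> tangent_space M p"
  shows "differential M N f p (tlin s \<xi> t \<eta>) = tlin s (differential M N f p \<xi>) t (differential M N f p \<eta>)"
proof -
  obtain c where c: "c \<in> charts_at M p" using ex_chart[OF M assms(1)] by blast
  obtain c' where c': "c' \<in> charts_at N (f p)" using ex_chart[OF N smooth_map_points[OF M N f assms(1)]] by blast
  note l = lrep_linear[OF M N f c c']
  have "differential M N f p (tlin s (tvec_of M c p (\<xi> c)) t (tvec_of M c p (\<eta> c)))
    = tlin s (differential M N f p (tvec_of M c p (\<xi> c))) t (differential M N f p (tvec_of M c p (\<eta> c)))"
    by (simp only: tvec_of_tlin[OF M c, symmetric] differential_tvec[OF c c'] linear_add[OF l]
        linear_scale[OF l] tvec_of_tlin[OF N c'])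
  then show ?thesis by (simp add: tvec_of_chart[OF M c] assms(2,3))
qed

lemma differential_list: "tangent_list M p vs \<Longrightarrow> tangent_list N (f p) (map (differential M N f p) vs)"
  using differential_tangent smooth_map_points[OF M N f] by (auto simp: tangent_list_def)

text \<open>Brings the pullback into the shape treated by \<open>local_form_subst\<close> and
  \<open>ldiff_pullback\<close>.\<close>

lemma coeff_pullback:
  assumes "c \<in> atlas M" "c' \<in> atlas N" "x \<in> ldom c f c'"
  shows "coeff_in M (pullback M N f \<omega>) c ws x = coeff_in N \<omega> c' (map (fd (lrep c f c') x) ws) (lrep c f c' x)"
proof -
  have x: "x \<in> cimg c" "f (cinv c x) \<in> cdom c'" 
    using iffD1[OF ldom_iff[OF M N f assms(1)] assms(3)] by blast+
  note c = cimgD(3)[OF M assms(1) x(1)]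
  have c': "c' \<in> charts_at N (f (cinv c x))" using x(2) assms(2) by (simp add: charts_at_iff)
  have "differential M N f (cinv c x) \<circ> tvec_of M c (cinv c x)
      = tvec_of N c' (f (cinv c x)) \<circ> fd (lrep c f c') x"
    using differential_tvec[OF c c'] cimgD(2)[OF M assms(1) x(1)] by (simp add: fun_eq_iff)
  then show ?thesis
    using tangent_list_tvec[OF M c] cinv_cmap[OF N assms(2) x(2)]
    by (simp add: coeff_in_def pullback_def)
qed

lemma local_form_coeff_pullback:
  assumes "\<omega> \<in> forms N k" "c \<in> atlas M" "c' \<in> atlas N"
  shows "local_form (ldom c f c') (coeff_in M (pullback M N f \<omega>) c)"
proof (rule local_form_cong[OF ldom_open[OF M N f assms(2,3)]])
  note s = lrep_smooth[OF M N f assms(2,3)]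
  show "local_form (ldom c f c') (\<lambda>ws x. coeff_in N \<omega> c' (map (fd (lrep c f c') x) ws) (lrep c f c' x))"
    by (rule local_form_subst[OF ldom_open[OF M N f assms(2,3)] atlasD(2)[OF N assms(3)]
          lrep_ldom[OF M N f assms(2)] s forms_local_form[OF N assms(1,3)] fd_smooth_linear[OF s] smooth_on_fd[OF s]])
qed (rule coeff_pullback[OF assms(2,3), symmetric])

lemma ex_ldom:
  assumes "c \<in> atlas M" "x \<in> cimg c"
  shows "\<exists>c'\<in>atlas N. x \<in> ldom c f c'"
  using ex_chart[OF N smooth_map_points[OF M N f cimgD(4)[OF M assms]]] assms(2)
  unfolding charts_at_iff ldom_iff[OF M N f assms(1)] by blast

text \<open>A chart domain of \<open>M\<close> may fail to map into one chart of \<open>N\<close>,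
  but the open sets \<open>ldom c f c'\<close> cover its image, and being a local form is a local
  property.\<close>

lemma pullback_forms:
  assumes "\<omega> \<in> forms N k"
  shows "pullback M N f \<omega> \<in> forms M k"
proof (rule formsI[OF M])
  fix c assume c: "c \<in> atlas M"
  show "local_form (cimg c) (coeff_in M (pullback M N f \<omega>) c)"
  proof (rule local_form_local)
    fix x assume "x \<in> cimg c"
    then obtain c' where "c' \<in> atlas N" "x \<in> ldom c f c'" using ex_ldom[OF c] by blast
    then show "\<exists>T. open T \<and> x \<in> T \<and> local_form T (coeff_in M (pullback M N f \<omega>) c)"
      using ldom_open[OF M N f c] local_form_coeff_pullback[OF assms c] by blast
  qed
qed (use forms_eq_0[OF N assms] in \<open>auto simp: pullback_def\<close>)

lemma ldiff_coeff_pullback: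
  assumes "\<omega> \<in> forms N k" "c \<in> atlas M" "c' \<in> atlas N" "x \<in> ldom c f c'"
  shows "ldiff (coeff_in M (pullback M N f \<omega>) c) ws x
    = ldiff (coeff_in N \<omega> c') (map (fd (lrep c f c') x) ws) (lrep c f c' x)"
proof -
  note o = ldom_open[OF M N f assms(2,3)]
  have "ldiff (coeff_in M (pullback M N f \<omega>) c) ws x
     = ldiff (\<lambda>ws x. coeff_in N \<omega> c' (map (fd (lrep c f c') x) ws) (lrep c f c' x)) ws x"
    by (rule ldiff_cong[OF o assms(4) coeff_pullback[OF assms(2,3)]])
  also have "\<dots> = ldiff (coeff_in N \<omega> c') (map (fd (lrep c f c') x) ws) (lrep c f c' x)"
    by (rule ldiff_pullback[OF o atlasD(2)[OF N assms(3)] lrep_ldom[OF M N f assms(2)]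
          lrep_smooth[OF M N f assms(2,3)] forms_local_form[OF N assms(1,3)] assms(4)])
  finally show ?thesis .
qed

lemma differential_chart:
  assumes "c \<in> charts_at M p" "c' \<in> charts_at N (f p)" "\<xi> \<in> tangent_space M p"
  shows "differential M N f p \<xi> c' = fd (lrep c f c') (cmap c p) (\<xi> c)"
  using differential_tvec[OF assms(1,2), of "\<xi> c"] tvec_of_chart[OF M assms(1,3)] tvec_of_same[OF N assms(2)]
  by simp

end

section \<open>The exterior derivative on a manifold\<close>

context
  fixes M :: "('a, 'v::euclidean_space) manifold"
  assumes M: "smooth_manifold M"
begin

lemma differential_id:
  assumes "p \<in> points M" "\<xi> \<in> tangent_space M p"
  shows "differential M M id p \<xi> = \<xi>"
proof
  fix c'
  obtain c where c: "c \<in> charts_at M p" using ex_chart[OF M assms(1)] by blast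
  show "differential M M id p \<xi> c' = \<xi> c'"
  proof (cases "c' \<in> charts_at M p")
    case True
    then show ?thesis
      using differential_chart[OF M M smooth_map_id[OF M], of c' p c' \<xi>] assms(2)
        tvec_of_same[OF M True, of "\<xi> c'"] by (simp add: tvec_of_def)
  next
    case False
    then have "\<xi> c' = 0" using assms(2) unfolding tangent_space_def by blast
    then show ?thesis using False by (simp add: differential_def Let_def)
  qed
qed

lemma pullback_id:
  assumes "\<omega> \<in> forms M k"
  shows "pullback M M id \<omega> = \<omega>"
proof (intro ext)
  fix p vs show "pullback M M id \<omega> p vs = \<omega> p vs"
  proof (cases "tangent_list M p vs")
    case True
    then have "map (differential M M id p) vs = vs"
      using differential_id by (auto simp: tangent_list_def subset_iff intro!: map_idI)
    then show ?thesis using True by (simp add: pullback_def)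
  qed (use forms_eq_0[OF M assms] in \<open>simp add: pullback_def\<close>)
qed

lemma ldiff_coeff_chart:
  assumes "\<omega> \<in> forms M k" "tangent_list M p vs" "c \<in> charts_at M p" "c' \<in> charts_at M p"
  shows "ldiff (coeff_in M \<omega> c) (map (\<lambda>\<xi>. \<xi> c) vs) (cmap c p)
    = ldiff (coeff_in M \<omega> c') (map (\<lambda>\<xi>. \<xi> c') vs) (cmap c' p)"
proof -
  note i = smooth_map_id[OF M]
  have c'': "c' \<in> charts_at M (id p)" using assms(4) by simp
  note x = ldom_point[OF M M i assms(3) c'']
  have "ldiff (coeff_in M \<omega> c) (map (\<lambda>\<xi>. \<xi> c) vs) (cmap c p)
    = ldiff (coeff_in M \<omega> c') (map (fd (lrep c id c') (cmap c p)) (map (\<lambda>\<xi>. \<xi> c) vs)) (lrep c id c' (cmap c p))"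
    using ldiff_coeff_pullback[OF M M i assms(1) charts_atD(1)[OF M assms(3)] charts_atD(1)[OF M assms(4)] x(1)]
    by (simp only: pullback_id[OF assms(1)])
  also have "map (fd (lrep c id c') (cmap c p)) (map (\<lambda>\<xi>. \<xi> c) vs) = map (\<lambda>\<xi>. \<xi> c') vs"
  proof -
    have "fd (lrep c id c') (cmap c p) (\<xi> c) = \<xi> c'" if "\<xi> \<in> set vs" for \<xi>
    proof -
      have "p \<in> points M" "\<xi> \<in> tangent_space M p" using assms(2) that by (auto simp: tangent_list_def)
      then show ?thesis using differential_chart[OF M M i assms(3) c''] differential_id by metis
    qed
    then show ?thesis by simp
  qed
  finally show ?thesis using x(2) by simp
qed

lemma ext_d_chart:
  assumes "\<omega> \<in> forms M k" "tangent_list M p vs" "c \<in> charts_at M p"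
  shows "ext_d M \<omega> p vs = ldiff (coeff_in M \<omega> c) (map (\<lambda>\<xi>. \<xi> c) vs) (cmap c p)"
  unfolding ext_d_ldiff using ldiff_coeff_chart[OF assms(1,2) _ assms(3)] some_chart[OF M, of p] assms(2)
  by (simp add: tangent_list_def)

lemma coeff_ext_d:
  assumes "\<omega> \<in> forms M k" "c \<in> atlas M" "x \<in> cimg c"
  shows "coeff_in M (ext_d M \<omega>) c ws x = ldiff (coeff_in M \<omega> c) ws x"
proof -
  note c = cimgD(3)[OF M assms(2,3)]
  show ?thesis
    unfolding coeff_in_def[of M "ext_d M \<omega>"] ext_d_chart[OF assms(1) tangent_list_tvec[OF M c] c]
      map_chart_tvec[OF M c] cimgD(2)[OF M assms(2,3)] ..
qed

lemma ext_d_forms: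
  assumes "\<omega> \<in> forms M k"
  shows "ext_d M \<omega> \<in> forms M (k + 1)"
proof (rule formsI[OF M])
  fix p vs assume *: "\<not> (tangent_list M p vs \<and> int (length vs) = k + 1)"
  show "ext_d M \<omega> p vs = 0"
  proof (cases "tangent_list M p vs")
    case True
    obtain c where c: "c \<in> charts_at M p" using ex_chart[OF M, of p] True by (auto simp: tangent_list_def)
    have "ldiff (coeff_in M \<omega> c) (map (\<lambda>\<xi>. \<xi> c) vs) (cmap c p) = 0"
      by (rule ldiff_eq_0[OF atlasD(2)[OF M charts_atD(1)[OF M c]] charts_atD(3)[OF M c]])
        (use * True in \<open>auto simp: coeff_in_def intro!: forms_eq_0[OF M assms]\<close>)
    then show ?thesis using ext_d_chart[OF assms True c] by simp
  qed (simp add: ext_d_ldiff)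
next
  fix c assume c: "c \<in> atlas M"
  show "local_form (cimg c) (coeff_in M (ext_d M \<omega>) c)"
    by (rule local_form_cong[OF atlasD(2)[OF M c] local_form_ldiff[OF atlasD(2)[OF M c] forms_local_form[OF M assms c]]])
      (simp add: coeff_ext_d[OF assms c])
qed

lemma ext_d_ext_d:
  assumes "\<omega> \<in> forms M k"
  shows "ext_d M (ext_d M \<omega>) = 0"
proof (rule forms_eqI[OF M ext_d_forms[OF ext_d_forms[OF assms]] forms_zero[OF M]])
  fix c ws x assume c: "c \<in> atlas M" and x: "x \<in> cimg c"
  note o = atlasD(2)[OF M c]
  have "coeff_in M (ext_d M (ext_d M \<omega>)) c ws x = ldiff (coeff_in M (ext_d M \<omega>) c) ws x"
    by (rule coeff_ext_d[OF ext_d_forms[OF assms] c x])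
  also have "\<dots> = ldiff (ldiff (coeff_in M \<omega> c)) ws x"
    by (rule ldiff_cong[OF o x coeff_ext_d[OF assms c]])
  also have "\<dots> = 0" by (rule ldiff_ldiff[OF o x forms_smooth_coeffs[OF M assms c]])
  finally show "coeff_in M (ext_d M (ext_d M \<omega>)) c ws x = coeff_in M 0 c ws x" by (simp add: coeff_in_def)
qed

lemma ext_d_wedge:
  assumes "\<alpha> \<in> forms M p" "\<beta> \<in> forms M q"
  shows "ext_d M (wedge \<alpha> \<beta>) = wedge (ext_d M \<alpha>) \<beta> + wedge (parity_form \<alpha>) (ext_d M \<beta>)"
proof (rule forms_eqI[OF M ext_d_forms[OF wedge_forms[OF M assms]]])
  show "wedge (ext_d M \<alpha>) \<beta> + wedge (parity_form \<alpha>) (ext_d M \<beta>) \<in> forms M (p + q + 1)"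
    using wedge_forms[OF M ext_d_forms[OF assms(1)] assms(2)]
      wedge_forms[OF M parity_form_forms[OF M assms(1)] ext_d_forms[OF assms(2)]]
    by (intro forms_add[OF M]) (simp_all add: ac_simps)
  fix c ws x assume c: "c \<in> atlas M" and x: "x \<in> cimg c"
  note o = atlasD(2)[OF M c]
  have "coeff_in M (ext_d M (wedge \<alpha> \<beta>)) c ws x = ldiff (coeff_in M (wedge \<alpha> \<beta>) c) ws x"
    by (rule coeff_ext_d[OF wedge_forms[OF M assms] c x])
  also have "\<dots> = ldiff (\<lambda>l y. lwedge (\<lambda>m. coeff_in M \<alpha> c m y) (\<lambda>m. coeff_in M \<beta> c m y) l) ws x"
    by (rule ldiff_cong[OF o x coeff_wedge[OF M]])
  also have "\<dots> = lwedge (\<lambda>m. ldiff (coeff_in M \<alpha> c) m x) (\<lambda>m. coeff_in M \<beta> c m x) ws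
      + lwedge (parity (\<lambda>m. coeff_in M \<alpha> c m x)) (\<lambda>m. ldiff (coeff_in M \<beta> c) m x) ws"
    by (rule ldiff_lwedge[OF o x forms_smooth_coeffs[OF M assms(1) c] forms_smooth_coeffs[OF M assms(2) c]])
  also have "parity (\<lambda>m. coeff_in M \<alpha> c m x) = (\<lambda>m. coeff_in M (parity_form \<alpha>) c m x)"
    by (simp add: fun_eq_iff parity_def parity_form_def coeff_in_def)
  finally show "coeff_in M (ext_d M (wedge \<alpha> \<beta>)) c ws x
    = coeff_in M (wedge (ext_d M \<alpha>) \<beta> + wedge (parity_form \<alpha>) (ext_d M \<beta>)) c ws x"
    by (simp add: coeff_add coeff_wedge[OF M] coeff_ext_d[OF assms(1) c x] coeff_ext_d[OF assms(2) c x])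
qed

end

lemma pullback_ext_d:
  assumes M: "smooth_manifold M" and N: "smooth_manifold N" and f: "smooth_map M N f"
    and \<omega>: "\<omega> \<in> forms N k"
  shows "ext_d M (pullback M N f \<omega>) = pullback M N f (ext_d N \<omega>)"
proof (rule forms_eqI[OF M ext_d_forms[OF M pullback_forms[OF M N f \<omega>]]
      pullback_forms[OF M N f ext_d_forms[OF N \<omega>]]])
  fix c ws x assume c: "c \<in> atlas M" and x: "x \<in> cimg c"
  obtain c' where c': "c' \<in> atlas N" "x \<in> ldom c f c'" using ex_ldom[OF M N f c x] by blast
  have y: "lrep c f c' x \<in> cimg c'" by (rule subsetD[OF lrep_ldom[OF M N f c] imageI[OF c'(2)]])
  have "coeff_in M (ext_d M (pullback M N f \<omega>)) c ws x = ldiff (coeff_in M (pullback M N f \<omega>) c) ws x"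
    by (rule coeff_ext_d[OF M pullback_forms[OF M N f \<omega>] c x])
  also have "\<dots> = ldiff (coeff_in N \<omega> c') (map (fd (lrep c f c') x) ws) (lrep c f c' x)"
    by (rule ldiff_coeff_pullback[OF M N f \<omega> c c'])
  also have "\<dots> = coeff_in N (ext_d N \<omega>) c' (map (fd (lrep c f c') x) ws) (lrep c f c' x)"
    by (rule coeff_ext_d[OF N \<omega> c'(1) y, symmetric])
  also have "\<dots> = coeff_in M (pullback M N f (ext_d N \<omega>)) c ws x"
    by (rule coeff_pullback[OF M N f c c', symmetric])
  finally show "coeff_in M (ext_d M (pullback M N f \<omega>)) c ws x = coeff_in M (pullback M N f (ext_d N \<omega>)) c ws x" .
qed

section \<open>The operators of an almost complex manifold\<close>

lemma smooth_on_ident: "smooth_on S (\<lambda>x. x)"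
  unfolding smooth_on_def
proof
  show "C_k_on n S (\<lambda>x. x)" for n
    by (cases n) (simp_all add: C_k_on_const)
qed

lemma lwedge_nontangent:
  assumes "\<not> tangent_list M p vs" "\<And>l. \<not> tangent_list M p l \<Longrightarrow> a l = 0" "\<And>l. \<not> tangent_list M p l \<Longrightarrow> b l = 0"
  shows "lwedge a b vs = 0"
proof (rule lwedge_eq_0)
  fix l l' assume "set vs = set l \<union> set l'"
  then have "\<not> tangent_list M p l \<or> \<not> tangent_list M p l'"
    using assms(1) by (auto simp: tangent_list_def)
  then show "a l = 0 \<or> b l' = 0" using assms(2,3) by blast
qed

text \<open>Covers the pullback, where \<open>g\<close> moves the base point and \<open>h\<close> is
  the differential, and the action of an endomorphism, where \<open>g\<close> is the identity.
  Sublists of a tangent list are tangent, so the case distinction in \<open>T\<close> is compatible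
  with shuffles.\<close>

lemma wedge_pointwise:
  assumes "\<And>\<omega> p vs. T \<omega> p vs = (if tangent_list M p vs then \<omega> (g p) (map (h p) vs) else 0)"
  shows "T (wedge \<alpha> \<beta>) = wedge (T \<alpha>) (T \<beta>)"
proof (intro ext)
  fix p vs show "T (wedge \<alpha> \<beta>) p vs = wedge (T \<alpha>) (T \<beta>) p vs"
  proof (cases "tangent_list M p vs")
    case True
    have "lwedge (\<lambda>l. \<alpha> (g p) (map (h p) l)) (\<lambda>l. \<beta> (g p) (map (h p) l)) vs = lwedge (T \<alpha> p) (T \<beta> p) vs"
      by (rule lwedge_cong) (use tangent_list_sub[OF True] in \<open>simp_all add: assms\<close>)
    then show ?thesis using True by (simp add: assms[of "wedge \<alpha> \<beta>"] wedge_lwedge lwedge_map)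
  next
    case False
    then have "lwedge (T \<alpha> p) (T \<beta> p) vs = 0" by (rule lwedge_nontangent) (simp_all add: assms)
    then show ?thesis using False by (simp add: assms[of "wedge \<alpha> \<beta>"] wedge_lwedge)
  qed
qed

lemma pullback_wedge: "pullback M N f (wedge \<alpha> \<beta>) = wedge (pullback M N f \<alpha>) (pullback M N f \<beta>)"
  by (rule wedge_pointwise[where g = f and h = "differential M N f"]) (simp add: pullback_def)

lemma act_wedge: "act_on_forms M E (wedge \<alpha> \<beta>) = wedge (act_on_forms M E \<alpha>) (act_on_forms M E \<beta>)"
  by (rule wedge_pointwise[where g = "\<lambda>p. p" and h = E]) (simp add: act_on_forms_def)

lemma pullback_add: "pullback M N f (\<alpha> + \<beta>) = pullback M N f \<alpha> + pullback M N f \<beta>"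
  and pullback_scale: "pullback M N f (scale_form z \<alpha>) = scale_form z (pullback M N f \<alpha>)"
  by (auto simp: fun_eq_iff pullback_def scale_form_def)

lemma act_add: "act_on_forms M E (\<alpha> + \<beta>) = act_on_forms M E \<alpha> + act_on_forms M E \<beta>"
  and act_scale: "act_on_forms M E (scale_form z \<alpha>) = scale_form z (act_on_forms M E \<alpha>)"
  and act_parity_form: "act_on_forms M E (parity_form \<alpha>) = parity_form (act_on_forms M E \<alpha>)"
  by (auto simp: fun_eq_iff act_on_forms_def scale_form_def parity_form_def parity_def)

lemma scale_minus1: "scale_form (-1) \<alpha> = - \<alpha>"
  by (simp add: fun_eq_iff scale_form_def)

lemma scale_zero: "scale_form 0 \<alpha> = 0"
  by (simp add: fun_eq_iff scale_form_def)

lemma scale_add: "scale_form z (\<alpha> + \<beta>) = scale_form z \<alpha> + scale_form z \<beta>"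
  and scale_add_left: "scale_form (z + w) \<alpha> = scale_form z \<alpha> + scale_form w \<alpha>"
  and scale_scale: "scale_form (z * w) \<alpha> = scale_form z (scale_form w \<alpha>)"
  and scale_one: "scale_form 1 \<alpha> = \<alpha>"
  by (auto simp: fun_eq_iff scale_form_def algebra_simps)

lemma wedge_uminus_left: "wedge (- \<alpha>) \<beta> = - wedge \<alpha> \<beta>"
  and wedge_uminus_right: "wedge \<alpha> (- \<beta>) = - wedge \<alpha> \<beta>"
  using wedge_scale_left[of "-1" \<alpha> \<beta>] wedge_scale_right[of \<alpha> "-1" \<beta>] by (simp_all add: scale_minus1)

lemma wedge_diff_left: "wedge (\<alpha> - \<alpha>') \<beta> = wedge \<alpha> \<beta> - wedge \<alpha>' \<beta>"
  and wedge_diff_right: "wedge \<alpha> (\<beta> - \<beta>') = wedge \<alpha> \<beta> - wedge \<alpha> \<beta>'"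
  using wedge_add_left[of \<alpha> "- \<alpha>'" \<beta>] wedge_add_right[of \<alpha> \<beta> "- \<beta>'"]
  by (simp_all add: wedge_uminus_left wedge_uminus_right)

text \<open>Captures what \<open>J\<close> and its inverse \<open>-J\<close> share, so that both
  actions are treated at once.\<close>

definition endo_field ::
  "('a, 'v::euclidean_space) manifold \<Rightarrow> ('a \<Rightarrow> ('a, 'v) tvec \<Rightarrow> ('a, 'v) tvec) \<Rightarrow> bool" where
  "endo_field M E \<longleftrightarrow>
     (\<forall>p\<in>points M. \<forall>\<xi>\<in>tangent_space M p. E p \<xi> \<in> tangent_space M p \<and>
        (\<forall>\<eta>\<in>tangent_space M p. \<forall>a b. E p (tlin a \<xi> b \<eta>) = tlin a (E p \<xi>) b (E p \<eta>))) \<and>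
     (\<forall>c\<in>atlas M. \<forall>w. smooth_on (cimg c) (\<lambda>x. E (cinv c x) (tvec_of M c (cinv c x) w) c))"

lemma tlin_uminus: "tlin (-1) \<xi> 0 \<eta> = - \<xi>"
  by (simp add: tlin_def fun_eq_iff)

context
  fixes M :: "('a, 'v::euclidean_space) manifold"
  assumes M: "smooth_manifold M"
begin

lemma uminus_tangent: "p \<in> points M \<Longrightarrow> \<xi> \<in> tangent_space M p \<Longrightarrow> - \<xi> \<in> tangent_space M p"
  using tlin_tangent[OF M, of p \<xi> \<xi> "-1" 0] by (simp add: tlin_uminus)

lemma endo_uminus:
  assumes "endo_field M E"
  shows "endo_field M (\<lambda>p \<xi>. - E p \<xi>)"
  unfolding endo_field_def
proof (intro conjI ballI allI)
  fix p \<xi> assume *: "p \<in> points M" "\<xi> \<in> tangent_space M p"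
  then show "- E p \<xi> \<in> tangent_space M p"
    using assms uminus_tangent[OF *(1)] by (simp add: endo_field_def)
  fix \<eta> a b assume "\<eta> \<in> tangent_space M p"
  then have "E p (tlin a \<xi> b \<eta>) = tlin a (E p \<xi>) b (E p \<eta>)" using assms * by (simp add: endo_field_def)
  then show "- E p (tlin a \<xi> b \<eta>) = tlin a (- E p \<xi>) b (- E p \<eta>)"
    by (simp add: tlin_def fun_eq_iff)
next
  fix c w assume c: "c \<in> atlas M"
  then have "smooth_on (cimg c) (\<lambda>x. E (cinv c x) (tvec_of M c (cinv c x) w) c)"
    using assms by (simp add: endo_field_def)
  then show "smooth_on (cimg c) (\<lambda>x. (- E (cinv c x) (tvec_of M c (cinv c x) w)) c)"
    using smooth_on_minus[OF atlasD(2)[OF M c]] by simp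
qed

lemma coeff_act:
  assumes E: "endo_field M E" and c: "c \<in> atlas M" and x: "x \<in> cimg c"
  shows "coeff_in M (act_on_forms M E \<omega>) c ws x
    = coeff_in M \<omega> c (map (\<lambda>w. E (cinv c x) (tvec_of M c (cinv c x) w) c) ws) x"
proof -
  let ?p = "cinv c x"
  note cp = cimgD(3)[OF M c x]
  have "tvec_of M c ?p (E ?p (tvec_of M c ?p w) c) = E ?p (tvec_of M c ?p w)" for w
    using tvec_of_chart[OF M cp] tvec_of_tangent[OF M cp] E cimgD(4)[OF M c x]
    by (simp add: endo_field_def)
  then show ?thesis
    using tangent_list_tvec[OF M cp] by (simp add: coeff_in_def act_on_forms_def comp_def)
qed

lemma act_forms:
  assumes E: "endo_field M E" and \<omega>: "\<omega> \<in> forms M k"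
  shows "act_on_forms M E \<omega> \<in> forms M k"
proof (rule formsI[OF M])
  fix c assume c: "c \<in> atlas M"
  let ?L = "\<lambda>x w. E (cinv c x) (tvec_of M c (cinv c x) w) c"
  note o = atlasD(2)[OF M c]
  have "local_form (cimg c) (\<lambda>ws x. coeff_in M \<omega> c (map (?L x) ws) x)"
  proof (rule local_form_subst[OF o o _ smooth_on_ident forms_local_form[OF M \<omega> c]])
    fix x assume x: "x \<in> cimg c"
    note cp = cimgD(3)[OF M c x]
    have "?L x (a *\<^sub>R v + b *\<^sub>R w) = a *\<^sub>R ?L x v + b *\<^sub>R ?L x w" for a b v w
      using E tvec_of_tangent[OF M cp] cimgD(4)[OF M c x]
      by (simp add: tvec_of_tlin[OF M cp] endo_field_def tlin_def[of a "E _ _"])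
    \<comment> \<open>The coefficients 1, 1 give additivity, and a second coefficient 0 gives
      homogeneity.\<close>
    from this[of 1 _ 1] this[of _ _ 0] show "linear (?L x)" by (intro linearI) simp_all
  qed (use E c in \<open>auto simp: endo_field_def\<close>)
  then show "local_form (cimg c) (coeff_in M (act_on_forms M E \<omega>) c)"
    by (rule local_form_cong[OF o]) (simp add: coeff_act[OF E c])
qed (use forms_eq_0[OF M \<omega>] in \<open>auto simp: act_on_forms_def\<close>)

lemma forms_uminus: "\<alpha> \<in> forms M k \<Longrightarrow> - \<alpha> \<in> forms M k"
  using forms_scale[OF M, of \<alpha> k "-1"] by (simp add: scale_minus1)

lemma forms_diff: "\<alpha> \<in> forms M k \<Longrightarrow> \<beta> \<in> forms M k \<Longrightarrow> \<alpha> - \<beta> \<in> forms M k"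
  using forms_add[OF M, of \<alpha> k "- \<beta>"] forms_uminus by simp

lemma ext_d_zero: "ext_d M 0 = 0"
  using ext_d_linear(2)[OF M forms_zero[OF M] forms_zero[OF M], where z = 0] by (simp add: scale_zero)

lemma forms_neg:
  assumes "\<alpha> \<in> forms M k" "k < 0"
  shows "\<alpha> = 0"
  using forms_eq_0[OF M assms(1)] assms(2) by (auto simp: fun_eq_iff)

lemma ext_d_parity_form:
  assumes "\<alpha> \<in> forms M k"
  shows "ext_d M (parity_form \<alpha>) = - parity_form (ext_d M \<alpha>)"
\<comment> \<open>For negative \<open>k\<close> the exponents \<open>nat k\<close> and
  \<open>nat (k + 1)\<close> do not differ by one; there the form is zero.\<close>
proof (cases "k < 0")
  case True
  then have "\<alpha> = 0" by (rule forms_neg[OF assms])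
  moreover have "parity_form 0 = (0 :: ('a, 'v) form)" by (simp add: parity_form_def parity_def fun_eq_iff)
  ultimately show ?thesis by (simp add: ext_d_zero)
next
  case False
  then have "nat (k + 1) = Suc (nat k)" by simp
  then have "parity_form (ext_d M \<alpha>) = scale_form (- ((-1) ^ nat k)) (ext_d M \<alpha>)"
    using parity_form_scale[OF M ext_d_forms[OF M assms]] by simp
  moreover have "ext_d M (parity_form \<alpha>) = scale_form ((-1) ^ nat k) (ext_d M \<alpha>)"
    unfolding parity_form_scale[OF M assms] by (rule ext_d_linear(2)[OF M assms forms_zero[OF M]])
  ultimately show ?thesis
    by (simp add: fun_eq_iff scale_form_def)
qed

end

locale almost_complex =
  fixes M :: "('a, 'v::euclidean_space) manifold" and J :: "'a \<Rightarrow> ('a, 'v) tvec \<Rightarrow> ('a, 'v) tvec"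
  assumes acm: "almost_complex_manifold M J"
begin

lemma M: "smooth_manifold M"
  and J: "endo_field M J" "endo_field M (\<lambda>p \<xi>. - J p \<xi>)"
proof -
  show M: "smooth_manifold M" using acm by (simp add: almost_complex_manifold_def)
  show J: "endo_field M J"
    using acm by (simp add: almost_complex_manifold_def almost_complex_structure_def endo_field_def)
  show "endo_field M (\<lambda>p \<xi>. - J p \<xi>)" by (rule endo_uminus[OF M J])
qed

abbreviation "F \<equiv> forms M"
abbreviation "d \<equiv> ext_d M"
abbreviation "\<delta> \<equiv> dc M J"
abbreviation "D \<equiv> ddc_plus_dcd M J"
abbreviation "act \<equiv> act_on_forms M J"
abbreviation "act' \<equiv> act_on_forms M (\<lambda>p \<xi>. - J p \<xi>)"

lemma act_inverse:
  assumes "\<omega> \<in> F k"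
  shows "act (act' \<omega>) = \<omega>" "act' (act \<omega>) = \<omega>"
proof -
  have J': "J p \<xi> \<in> tangent_space M p \<and> - J p \<xi> \<in> tangent_space M p \<and>
      - J p (J p \<xi>) = \<xi> \<and> J p (- J p \<xi>) = \<xi>"
    if p: "p \<in> points M" and \<xi>: "\<xi> \<in> tangent_space M p" for p \<xi>
  proof -
    have *: "J p \<xi> \<in> tangent_space M p" "J p (J p \<xi>) = - \<xi>"
      using acm p \<xi> by (simp_all add: almost_complex_manifold_def almost_complex_structure_def)
    \<comment> \<open>Linearity of \<open>J\<close> is given through \<open>tlin\<close>, so
      negation is written as a combination with coefficients -1 and 0.\<close>
    have "J p (- J p \<xi>) = - J p (J p \<xi>)"
      using J(1) p *(1) tlin_uminus[of "J p \<xi>" "J p \<xi>"] tlin_uminus[of "J p (J p \<xi>)" "J p (J p \<xi>)"]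
      unfolding endo_field_def by metis
    then show ?thesis using * uminus_tangent[OF M p] by simp
  qed
  have "act (act' \<omega>) p vs = \<omega> p vs \<and> act' (act \<omega>) p vs = \<omega> p vs" for p vs
  proof (cases "tangent_list M p vs")
    case True
    have "tangent_list M p (map (J p) vs)" "tangent_list M p (map (\<lambda>\<xi>. - J p \<xi>) vs)"
      "map (\<lambda>\<xi>. - J p (J p \<xi>)) vs = vs" "map (\<lambda>\<xi>. J p (- J p \<xi>)) vs = vs"
      using True J' by (auto simp: tangent_list_def subset_iff intro!: map_idI)
    then show ?thesis using True by (simp add: act_on_forms_def comp_def)
  qed (use forms_eq_0[OF M assms] in \<open>simp add: act_on_forms_def\<close>)
  then show "act (act' \<omega>) = \<omega>" "act' (act \<omega>) = \<omega>" by (simp_all add: fun_eq_iff)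
qed

lemmas act_F = act_forms[OF M J(1)] act_forms[OF M J(2)]
lemmas d_F = ext_d_forms[OF M]

lemma dc_F: "\<alpha> \<in> F k \<Longrightarrow> \<delta> \<alpha> \<in> F (k + 1)"
  unfolding dc_def by (intro act_F d_F)

lemma d_add: "\<alpha> \<in> F k \<Longrightarrow> \<beta> \<in> F l \<Longrightarrow> d (\<alpha> + \<beta>) = d \<alpha> + d \<beta>"
  and d_scale: "\<alpha> \<in> F k \<Longrightarrow> d (scale_form z \<alpha>) = scale_form z (d \<alpha>)"
  using ext_d_linear[OF M, of \<alpha> k] forms_zero[OF M] by blast+

lemma dc_add: "\<alpha> \<in> F k \<Longrightarrow> \<beta> \<in> F l \<Longrightarrow> \<delta> (\<alpha> + \<beta>) = \<delta> \<alpha> + \<delta> \<beta>"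
  by (simp add: dc_def act_add d_add[OF act_F(1) act_F(1)])

lemma dc_scale: "\<alpha> \<in> F k \<Longrightarrow> \<delta> (scale_form z \<alpha>) = scale_form z (\<delta> \<alpha>)"
  by (simp add: dc_def act_scale d_scale[OF act_F(1)])

lemma d_d: "\<alpha> \<in> F k \<Longrightarrow> d (d \<alpha>) = 0"
  by (rule ext_d_ext_d[OF M])

lemma act_zero: "act 0 = 0" "act' 0 = 0"
  by (simp_all add: act_on_forms_def fun_eq_iff)

text \<open>In the middle \<open>J\<close> meets its inverse, which leaves \<open>dd\<close>
  conjugated by \<open>J\<close>.\<close>

lemma dc_dc: "\<alpha> \<in> F k \<Longrightarrow> \<delta> (\<delta> \<alpha>) = 0"
  unfolding dc_def by (simp add: act_inverse(1)[OF d_F[OF act_F(1)]] d_d[OF act_F(1)] act_zero)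

lemma d_zero: "d 0 = 0" and dc_zero: "\<delta> 0 = 0"
  by (simp_all add: dc_def act_zero ext_d_zero[OF M])

text \<open>\<open>\<delta>\<close> is \<open>d\<close> conjugated by \<open>act\<close>, which is
  multiplicative and commutes with the sign, so the Leibniz rule carries over.\<close>

lemma dc_wedge:
  assumes "\<alpha> \<in> F p" "\<beta> \<in> F q"
  shows "\<delta> (wedge \<alpha> \<beta>) = wedge (\<delta> \<alpha>) \<beta> + wedge (parity_form \<alpha>) (\<delta> \<beta>)"
  unfolding dc_def act_wedge ext_d_wedge[OF M act_F(1)[OF assms(1)] act_F(1)[OF assms(2)]] act_add
  by (simp add: act_parity_form act_inverse(2)[OF assms(1)] act_inverse(2)[OF assms(2)])

lemmas d_wedge = ext_d_wedge[OF M]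
lemmas F_intros = forms_add[OF M] forms_scale[OF M] forms_uminus[OF M] forms_diff[OF M] forms_zero[OF M] parity_form_forms[OF M]

lemma dc_parity_form: "\<alpha> \<in> F k \<Longrightarrow> \<delta> (parity_form \<alpha>) = - parity_form (\<delta> \<alpha>)"
  using act_scale[of M "\<lambda>p \<xi>. - J p \<xi>" "-1"]
  by (simp add: dc_def act_parity_form ext_d_parity_form[OF M act_F(1)] scale_minus1)

lemma D_F: "\<alpha> \<in> F k \<Longrightarrow> D \<alpha> \<in> F (k + 2)"
  using d_F[OF dc_F, of \<alpha> k] dc_F[OF d_F, of \<alpha> k] F_intros(1)[of "d (\<delta> \<alpha>)" "k + 2" "\<delta> (d \<alpha>)"]
  by (simp add: ddc_plus_dcd_def add.assoc)

lemma D_add: "\<alpha> \<in> F k \<Longrightarrow> \<beta> \<in> F l \<Longrightarrow> D (\<alpha> + \<beta>) = D \<alpha> + D \<beta>"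
  by (simp add: ddc_plus_dcd_def d_add dc_add d_add[OF dc_F dc_F] dc_add[OF d_F d_F])

lemma D_scale: "\<alpha> \<in> F k \<Longrightarrow> D (scale_form z \<alpha>) = scale_form z (D \<alpha>)"
  by (simp add: ddc_plus_dcd_def d_scale dc_scale d_scale[OF dc_F] dc_scale[OF d_F] scale_add)

text \<open>As \<open>dd = 0\<close>, both sides equal \<open>dd\<^sup>cd\<close>.\<close>

lemma d_D: "\<alpha> \<in> F k \<Longrightarrow> d (D \<alpha>) = D (d \<alpha>)"
  by (simp add: ddc_plus_dcd_def d_add[OF d_F[OF dc_F] dc_F[OF d_F]] d_d d_d[OF dc_F] dc_zero)

lemma dc_D: "\<alpha> \<in> F k \<Longrightarrow> \<delta> (D \<alpha>) = D (\<delta> \<alpha>)"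
  by (simp add: ddc_plus_dcd_def dc_add[OF d_F[OF dc_F] dc_F[OF d_F]] dc_dc dc_dc[OF d_F] d_zero)

text \<open>The mixed terms, with one derivative on each factor, occur in \<open>dd\<^sup>c\<close>
  and \<open>d\<^sup>cd\<close> with opposite signs, because \<open>d\<close> and
  \<open>\<delta>\<close> anticommute with the sign of a form.\<close>

lemma D_wedge:
  assumes "\<alpha> \<in> F p" "\<beta> \<in> F q"
  shows "D (wedge \<alpha> \<beta>) = wedge (D \<alpha>) \<beta> + wedge \<alpha> (D \<beta>)"
proof -
  note w = wedge_forms[OF M] and p = parity_form_forms[OF M]
  note a = assms(1) d_F[OF assms(1)] dc_F[OF assms(1)] p[OF assms(1)]
  note b = assms(2) d_F[OF assms(2)] dc_F[OF assms(2)]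
  have "d (\<delta> (wedge \<alpha> \<beta>)) = d (wedge (\<delta> \<alpha>) \<beta>) + d (wedge (parity_form \<alpha>) (\<delta> \<beta>))"
    unfolding dc_wedge[OF assms] by (rule d_add[OF w[OF a(3) b(1)] w[OF a(4) b(3)]])
  also have "\<dots> = (wedge (d (\<delta> \<alpha>)) \<beta> + wedge (parity_form (\<delta> \<alpha>)) (d \<beta>))
      + (- wedge (parity_form (d \<alpha>)) (\<delta> \<beta>) + wedge \<alpha> (d (\<delta> \<beta>)))"
    by (simp only: d_wedge[OF a(3) b(1)] d_wedge[OF a(4) b(3)] ext_d_parity_form[OF M a(1)] parity_form_parity_form
        wedge_uminus_left)
  finally have 1: "d (\<delta> (wedge \<alpha> \<beta>)) = \<dots>" .
  have "\<delta> (d (wedge \<alpha> \<beta>)) = \<delta> (wedge (d \<alpha>) \<beta>) + \<delta> (wedge (parity_form \<alpha>) (d \<beta>))"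
    unfolding d_wedge[OF assms] by (rule dc_add[OF w[OF a(2) b(1)] w[OF a(4) b(2)]])
  also have "\<dots> = (wedge (\<delta> (d \<alpha>)) \<beta> + wedge (parity_form (d \<alpha>)) (\<delta> \<beta>))
      + (- wedge (parity_form (\<delta> \<alpha>)) (d \<beta>) + wedge \<alpha> (\<delta> (d \<beta>)))"
    by (simp only: dc_wedge[OF a(2) b(1)] dc_wedge[OF a(4) b(2)] dc_parity_form[OF a(1)] parity_form_parity_form
        wedge_uminus_left)
  finally have 2: "\<delta> (d (wedge \<alpha> \<beta>)) = \<dots>" .
  show ?thesis
    by (simp add: ddc_plus_dcd_def 1 2 wedge_add_left wedge_add_right)
qed

end

locale pseudo_holomorphic_map = dom: almost_complex M J + cod: almost_complex N J'
  for M :: "('a, 'v::euclidean_space) manifold" and J and N :: "('b, 'w::euclidean_space) manifold" and J' +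
  fixes f :: "'a \<Rightarrow> 'b"
  assumes holo: "pseudo_holomorphic M J N J' f"
begin

abbreviation "pb \<equiv> pullback M N f"

lemma f: "smooth_map M N f"
  using holo by (simp add: pseudo_holomorphic_def)

lemmas pb_F = pullback_forms[OF dom.M cod.M f]

lemma pb_d: "\<omega> \<in> cod.F k \<Longrightarrow> pb (cod.d \<omega>) = dom.d (pb \<omega>)"
  by (rule pullback_ext_d[OF dom.M cod.M f, symmetric])

text \<open>Stated for a general pair of endomorphisms to serve both \<open>J\<close> and
  \<open>-J\<close>, as \<open>dc\<close> involves the two actions.\<close>

lemma pb_act_gen:
  assumes "\<And>p \<xi>. p \<in> points M \<Longrightarrow> \<xi> \<in> tangent_space M p \<Longrightarrow>
      differential M N f p (E p \<xi>) = E' (f p) (differential M N f p \<xi>)"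
    and "endo_field M E"
  shows "pb (act_on_forms N E' \<omega>) = act_on_forms M E (pb \<omega>)"
proof (intro ext)
  fix p vs show "pb (act_on_forms N E' \<omega>) p vs = act_on_forms M E (pb \<omega>) p vs"
  proof (cases "tangent_list M p vs")
    case True
    then have "tangent_list M p (map (E p) vs)" using assms(2) by (auto simp: tangent_list_def endo_field_def)
    moreover have "map (E' (f p)) (map (differential M N f p) vs) = map (differential M N f p) (map (E p) vs)"
      using True assms(1) by (auto simp: tangent_list_def)
    ultimately show ?thesis
      using True differential_list[OF dom.M cod.M f True] by (simp add: pullback_def act_on_forms_def del: map_map)
  qed (simp add: pullback_def act_on_forms_def)
qed

lemma pb_act: "pb (cod.act \<omega>) = dom.act (pb \<omega>)" "pb (cod.act' \<omega>) = dom.act' (pb \<omega>)"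
proof -
  have J: "differential M N f p (J p \<xi>) = J' (f p) (differential M N f p \<xi>)"
    if "p \<in> points M" "\<xi> \<in> tangent_space M p" for p \<xi>
    using holo that by (simp add: pseudo_holomorphic_def)
  have J': "differential M N f p (- J p \<xi>) = - J' (f p) (differential M N f p \<xi>)"
    if "p \<in> points M" "\<xi> \<in> tangent_space M p" for p \<xi>
  proof -
    have "J p \<xi> \<in> tangent_space M p" using dom.J(1) that by (simp add: endo_field_def)
    from differential_tlin[OF dom.M cod.M f that(1) this this, of "-1" 0]
    show ?thesis using J[OF that] by (simp add: tlin_uminus)
  qed
  show "pb (cod.act \<omega>) = dom.act (pb \<omega>)" by (rule pb_act_gen[OF J dom.J(1)])
  show "pb (cod.act' \<omega>) = dom.act' (pb \<omega>)" by (rule pb_act_gen[OF J' dom.J(2)])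
qed

lemma pb_dc: "\<omega> \<in> cod.F k \<Longrightarrow> pb (cod.\<delta> \<omega>) = dom.\<delta> (pb \<omega>)"
  unfolding dc_def pb_act pb_d[OF cod.act_F(1)] ..

lemma pb_D: "\<omega> \<in> cod.F k \<Longrightarrow> pb (cod.D \<omega>) = dom.D (pb \<omega>)"
  unfolding ddc_plus_dcd_def pullback_add
  by (simp add: pb_d pb_dc pb_d[OF cod.dc_F] pb_dc[OF cod.d_F])

lemma pb_unit: "pb (unit_form N) = unit_form M"
  using smooth_map_points[OF dom.M cod.M f]
  by (auto simp: fun_eq_iff pullback_def unit_form_def tangent_list_def)

end

section \<open>Bott-Chern cohomology\<close>

text \<open>Additivity of \<open>g\<close> is asked only at \<open>a\<close> and \<open>W\<close>,
  since \<open>d\<close> is known to be additive only on forms. The element \<open>w0\<close> stands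
  in for 0: among cosets the neutral element is the coset of 0, while the zero of set addition is
  \<open>{0}\<close>.\<close>

lemma coset_map_coset:
  fixes g :: "'x::plus \<Rightarrow> 'y::semigroup_add"
  assumes "a + w0 = a" "w0 \<in> W" "\<And>w. w \<in> W \<Longrightarrow> \<exists>w'\<in>W'. g (a + w) = g a + w'"
    and "\<And>w w'. w \<in> W' \<Longrightarrow> w' \<in> W' \<Longrightarrow> w + w' \<in> W'"
  shows "coset_map W' g (a +o W) = g a +o W'"
proof (intro subset_antisym subsetI)
  fix x assume "x \<in> coset_map W' g (a +o W)"
  then obtain w w'' where w: "w \<in> W" "w'' \<in> W'" "x = g (a + w) + w''"
    by (auto simp: coset_map_def elt_set_plus_def set_plus_def)
  obtain w' where "w' \<in> W'" "g (a + w) = g a + w'" using assms(3)[OF w(1)] by blast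
  then show "x \<in> g a +o W'"
    using w assms(4) by (auto simp: elt_set_plus_def add.assoc intro!: bexI[of _ "w' + w''"])
next
  fix x assume "x \<in> g a +o W'"
  then obtain w where "w \<in> W'" "x = g a + w" by (auto simp: elt_set_plus_def)
  moreover have "a \<in> a +o W" using assms(1,2) by (force simp: elt_set_plus_def)
  ultimately show "x \<in> coset_map W' g (a +o W)" unfolding coset_map_def set_plus_def by blast
qed

text \<open>Sets under addition have no inverses, so differences in both directions are supplied as
  witnesses.\<close>

lemma coset_eqI:
  fixes a b :: "'x::semigroup_add"
  assumes "a = b + w" "w \<in> W" "b = a + w'" "w' \<in> W"
    and "\<And>w w'. w \<in> W \<Longrightarrow> w' \<in> W \<Longrightarrow> w + w' \<in> W"
  shows "a +o W = b +o W"
proof -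
  have "a + x \<in> b +o W" if "x \<in> W" for x
    using assms(1,2,5) that by (auto simp: elt_set_plus_def add.assoc intro!: bexI[of _ "w + x"])
  moreover have "b + x \<in> a +o W" if "x \<in> W" for x
    using assms(3,4,5) that by (auto simp: elt_set_plus_def add.assoc intro!: bexI[of _ "w' + x"])
  ultimately show ?thesis by (auto simp: elt_set_plus_def)
qed

text \<open>Serves the products of classes, which collect the products of all representatives: it
  suffices that each of these gives the same coset.\<close>

lemma union_cosets:
  assumes "S \<noteq> {}" "\<And>s. s \<in> S \<Longrightarrow> s +o W = K"
  shows "S + W = K"
proof -
  have "S + W = (\<Union>s\<in>S. s +o W)" by (auto simp: set_plus_def elt_set_plus_def)
  then show ?thesis using assms by auto
qed

lemma coset_add:
  fixes a b :: "'x::comm_monoid_add"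
  shows "W + W = W \<Longrightarrow> (a +o W) + (b +o W) = (a + b) +o W"
  by (simp add: set_plus_rearrange)

lemma scale_form_0: "scale_form z 0 = 0"
  by (simp add: fun_eq_iff scale_form_def)

definition form_subspace :: "('a, 'v) form set \<Rightarrow> bool" where
  "form_subspace W \<longleftrightarrow> 0 \<in> W \<and> (\<forall>a\<in>W. \<forall>b\<in>W. a + b \<in> W) \<and> (\<forall>z. \<forall>a\<in>W. scale_form z a \<in> W)"

lemma form_subspaceD:
  assumes "form_subspace W"
  shows "0 \<in> W" "a \<in> W \<Longrightarrow> b \<in> W \<Longrightarrow> a + b \<in> W" "a \<in> W \<Longrightarrow> scale_form z a \<in> W" "a \<in> W \<Longrightarrow> - a \<in> W"
    "W + W = W"
proof -
  show *: "0 \<in> W" "a \<in> W \<Longrightarrow> b \<in> W \<Longrightarrow> a + b \<in> W" "a \<in> W \<Longrightarrow> scale_form z a \<in> W" for a b z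
    using assms by (auto simp: form_subspace_def)
  show "a \<in> W \<Longrightarrow> - a \<in> W" using *(3)[of a "-1"] by (simp add: scale_minus1)
  have "a \<in> W + W" if "a \<in> W" for a using set_plus_intro[OF *(1) that] by simp
  then show "W + W = W" using *(2) by (auto simp: set_plus_def)
qed

lemma form_coset_eqI: "form_subspace W \<Longrightarrow> a - b \<in> W \<Longrightarrow> a +o W = b +o W"
  by (rule coset_eqI[of _ _ "a - b" _ "- (a - b)"]) (use form_subspaceD in \<open>auto dest: form_subspaceD(4)\<close>)

lemma form_coset_0: "0 +o W = (W :: ('a, 'v) form set)"
  by (simp add: elt_set_plus_def)

lemma form_coset_scale:
  assumes "form_subspace W"
  shows "coset_map W (scale_form z) (a +o W) = scale_form z a +o W"
  by (rule coset_map_coset[of _ 0]) (auto simp: scale_add form_subspaceD[OF assms])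

lemma cring_complex: "cring complex_ring"
proof (intro cringI abelian_groupI comm_monoidI)
  fix x :: complex
  show "\<exists>y\<in>carrier complex_ring. y \<oplus>\<^bsub>complex_ring\<^esub> x = \<zero>\<^bsub>complex_ring\<^esub>"
    by (rule bexI[of _ "- x"]) (auto simp: complex_ring_def)
qed (auto simp: complex_ring_def algebra_simps)

text \<open>Transports the vector space structure of the cycles along the class map
  \<open>q\<close>, for both cohomologies.\<close>

lemma module_image:
  fixes q :: "('a, 'v) form \<Rightarrow> 'y::plus"
  assumes "form_subspace Z"
    and "\<And>x y. x \<in> Z \<Longrightarrow> y \<in> Z \<Longrightarrow> q x + q y = q (x + y)"
    and "\<And>z x. x \<in> Z \<Longrightarrow> s z (q x) = q (scale_form z x)"
    and "z0 = q 0"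
  shows "module complex_ring \<lparr>carrier = q ` Z, mult = undefined, one = undefined, zero = z0, add = (+), smult = s\<rparr>"
proof -
  note Z = form_subspaceD[OF assms(1)]
  let ?M = "\<lparr>carrier = q ` Z, mult = undefined, one = undefined, zero = z0, add = (+), smult = s\<rparr>"
  have "abelian_group ?M"
  proof (rule abelian_groupI)
    fix x assume "x \<in> carrier ?M"
    then obtain a where a: "a \<in> Z" "x = q a" by auto
    then show "\<exists>y\<in>carrier ?M. y \<oplus>\<^bsub>?M\<^esub> x = \<zero>\<^bsub>?M\<^esub>"
      by (intro bexI[of _ "q (- a)"]) (simp_all add: assms(2,4) Z)
  qed (use Z in \<open>auto simp: assms(2,4) ac_simps\<close>)
  then show ?thesis
    by (rule moduleI[OF cring_complex])
      (use Z in \<open>auto simp: assms(2,3) complex_ring_def scale_add scale_add_left scale_scale scale_one\<close>)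
qed

context almost_complex
begin

abbreviation "Z \<equiv> BC_cycles M J"
abbreviation "Bd \<equiv> BC_boundaries M J"
abbreviation "bcc \<equiv> BC_class M J"
abbreviation "BC \<equiv> bott_chern M J"

text \<open>If \<open>d \<alpha>\<close> and \<open>\<delta> \<alpha>\<close> vanish, both summands
  of \<open>D \<alpha>\<close> are derivatives of zero.\<close>

lemma Z_iff: "\<alpha> \<in> Z k \<longleftrightarrow> \<alpha> \<in> F k \<and> d \<alpha> = 0 \<and> \<delta> \<alpha> = 0"
  by (auto simp: BC_cycles_def B_forms_def ddc_plus_dcd_def d_zero dc_zero)

lemma Z_D: "\<alpha> \<in> Z k \<Longrightarrow> D \<alpha> = 0"
  by (simp add: BC_cycles_def B_forms_def)

lemma Bd_iff: "\<alpha> \<in> Bd k \<longleftrightarrow> (\<exists>\<beta>\<in>F (k - 2). D \<beta> = 0 \<and> \<alpha> = d (\<delta> \<beta>))"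
  by (auto simp: BC_boundaries_def B_forms_def)

text \<open>Closedness under \<open>\<delta>\<close> comes from \<open>D \<beta> = 0\<close>, which
  turns \<open>dd\<^sup>c\<beta>\<close> into \<open>- d\<^sup>cd\<beta>\<close>; this is killed by
  \<open>d\<^sup>c\<close>.\<close>

lemma Bd_Z: "\<alpha> \<in> Bd k \<Longrightarrow> \<alpha> \<in> Z k"
proof -
  assume "\<alpha> \<in> Bd k"
  then obtain \<beta> where \<beta>: "\<beta> \<in> F (k - 2)" "D \<beta> = 0" "\<alpha> = d (\<delta> \<beta>)" by (auto simp: Bd_iff)
  then have "\<alpha> = - \<delta> (d \<beta>)" by (simp add: ddc_plus_dcd_def eq_neg_iff_add_eq_0)
  then have "\<delta> \<alpha> = 0"
    using dc_scale[OF dc_F[OF d_F[OF \<beta>(1)]], of "-1"] dc_dc[OF d_F[OF \<beta>(1)]] by (simp add: scale_minus1)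
  then show "\<alpha> \<in> Z k"
    using \<beta> d_F[OF dc_F[OF \<beta>(1)]] d_d[OF dc_F[OF \<beta>(1)]] by (simp add: Z_iff)
qed

lemma Z_sub: "form_subspace (Z k)"
  by (auto simp: form_subspace_def Z_iff F_intros d_add dc_add d_scale dc_scale d_zero dc_zero scale_form_0)

lemma Bd_sub: "form_subspace (Bd k)"
  unfolding form_subspace_def
proof (intro conjI ballI allI)
  have "D 0 = 0" by (simp add: ddc_plus_dcd_def d_zero dc_zero)
  then show "0 \<in> Bd k" unfolding Bd_iff using F_intros(5) by (metis d_zero dc_zero)
next
  fix a b assume "a \<in> Bd k" "b \<in> Bd k"
  then obtain \<alpha> \<beta> where *: "\<alpha> \<in> F (k - 2)" "D \<alpha> = 0" "a = d (\<delta> \<alpha>)" "\<beta> \<in> F (k - 2)" "D \<beta> = 0" "b = d (\<delta> \<beta>)"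
    by (auto simp: Bd_iff)
  then show "a + b \<in> Bd k"
    unfolding Bd_iff by (intro bexI[of _ "\<alpha> + \<beta>"]) (simp_all add: F_intros D_add dc_add d_add[OF dc_F dc_F])
next
  fix z a assume "a \<in> Bd k"
  then obtain \<alpha> where *: "\<alpha> \<in> F (k - 2)" "D \<alpha> = 0" "a = d (\<delta> \<alpha>)" by (auto simp: Bd_iff)
  then show "scale_form z a \<in> Bd k"
    unfolding Bd_iff using * by (intro bexI[of _ "scale_form z \<alpha>"]) (simp_all add: F_intros D_scale dc_scale d_scale[OF dc_F] scale_form_0)
qed

lemma Z_wedge: "\<alpha> \<in> Z p \<Longrightarrow> \<beta> \<in> Z q \<Longrightarrow> wedge \<alpha> \<beta> \<in> Z (p + q)"
  by (auto simp: Z_iff wedge_forms[OF M] d_wedge dc_wedge wedge_zero_left wedge_zero_right)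

lemma Z_parity_form: "\<alpha> \<in> Z p \<Longrightarrow> parity_form \<alpha> \<in> Z p"
  using form_subspaceD(3)[OF Z_sub, of \<alpha> p "(-1) ^ nat p"] parity_form_scale[OF M, of \<alpha> p] by (simp add: Z_iff)

text \<open>By the Leibniz rule a cycle passes through a derivative at the price of its sign; a
  second derivative undoes the sign.\<close>

lemma d_cycle_wedge:
  assumes "\<alpha> \<in> Z p" "\<beta> \<in> F q"
  shows "wedge \<alpha> (d \<beta>) = d (wedge (parity_form \<alpha>) \<beta>)" "wedge \<alpha> (\<delta> \<beta>) = \<delta> (wedge (parity_form \<alpha>) \<beta>)"
    "wedge \<alpha> (d (\<delta> \<beta>)) = d (\<delta> (wedge \<alpha> \<beta>))" "wedge \<alpha> (D \<beta>) = D (wedge \<alpha> \<beta>)"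
proof -
  have 1: "wedge \<alpha> (d \<beta>) = d (wedge (parity_form \<alpha>) \<beta>)" "wedge \<alpha> (\<delta> \<beta>) = \<delta> (wedge (parity_form \<alpha>) \<beta>)"
    if "\<alpha> \<in> Z p" "\<beta> \<in> F q" for \<alpha> \<beta> p q
    using Z_parity_form[OF that(1)] that
    by (simp_all add: Z_iff d_wedge[of "parity_form \<alpha>" p \<beta> q] dc_wedge[of "parity_form \<alpha>" p \<beta> q] wedge_zero_left parity_form_parity_form)
  then show "wedge \<alpha> (d \<beta>) = d (wedge (parity_form \<alpha>) \<beta>)" "wedge \<alpha> (\<delta> \<beta>) = \<delta> (wedge (parity_form \<alpha>) \<beta>)"
    using assms by blast+
  show "wedge \<alpha> (d (\<delta> \<beta>)) = d (\<delta> (wedge \<alpha> \<beta>))"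
    using 1(1)[OF assms(1) dc_F[OF assms(2)]] 1(2)[OF Z_parity_form[OF assms(1)] assms(2)] by (simp add: parity_form_parity_form)
  show "wedge \<alpha> (D \<beta>) = D (wedge \<alpha> \<beta>)"
    using D_wedge[OF _ assms(2), of \<alpha> p] assms(1) Z_D[OF assms(1)] by (simp add: Z_iff wedge_zero_left)
qed

lemma Bd_wedge_right:
  assumes "\<alpha> \<in> Z p" "b \<in> Bd q"
  shows "wedge \<alpha> b \<in> Bd (p + q)"
proof -
  obtain \<beta> where \<beta>: "\<beta> \<in> F (q - 2)" "D \<beta> = 0" "b = d (\<delta> \<beta>)" using assms(2) by (auto simp: Bd_iff)
  have "wedge \<alpha> \<beta> \<in> F (p + (q - 2))" using assms(1) \<beta>(1) by (auto simp: Z_iff intro: wedge_forms[OF M])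
  then show ?thesis
    unfolding Bd_iff using d_cycle_wedge(3,4)[OF assms(1) \<beta>(1)] \<beta>
    by (intro bexI[of _ "wedge \<alpha> \<beta>"]) (simp_all add: wedge_zero_right algebra_simps)
qed

text \<open>With the cycle as right factor all terms that differentiate it drop out, so
  \<open>wedge b \<alpha>\<close> is \<open>dd\<^sup>c(\<beta> \<and> \<alpha>)\<close> without a
  sign.\<close>

lemma Bd_wedge_left:
  assumes "b \<in> Bd p" "\<alpha> \<in> Z q"
  shows "wedge b \<alpha> \<in> Bd (p + q)"
proof -
  obtain \<beta> where \<beta>: "\<beta> \<in> F (p - 2)" "D \<beta> = 0" "b = d (\<delta> \<beta>)" using assms(1) by (auto simp: Bd_iff)
  have \<alpha>: "\<alpha> \<in> F q" "d \<alpha> = 0" "\<delta> \<alpha> = 0" using assms(2) by (auto simp: Z_iff)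
  have "wedge \<beta> \<alpha> \<in> F (p - 2 + q)" by (rule wedge_forms[OF M \<beta>(1) \<alpha>(1)])
  moreover have "D (wedge \<beta> \<alpha>) = 0"
    using D_wedge[OF \<beta>(1) \<alpha>(1)] Z_D[OF assms(2)] \<beta>(2) by (simp add: wedge_zero_left wedge_zero_right)
  moreover have "d (\<delta> (wedge \<beta> \<alpha>)) = wedge b \<alpha>"
    using dc_wedge[OF \<beta>(1) \<alpha>(1)] d_wedge[OF dc_F[OF \<beta>(1)] \<alpha>(1)] \<alpha> \<beta>(3) by (simp add: wedge_zero_right)
  ultimately show ?thesis
    unfolding Bd_iff by (intro bexI[of _ "wedge \<beta> \<alpha>"]) (simp_all add: algebra_simps)
qed

lemma bcc_eqI: "\<alpha> - \<beta> \<in> Bd k \<Longrightarrow> bcc k \<alpha> = bcc k \<beta>"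
  unfolding BC_class_def by (rule form_coset_eqI[OF Bd_sub])

lemma bcc_0: "bcc k 0 = Bd k"
  unfolding BC_class_def by (rule form_coset_0)

lemma bcc_mem: "\<alpha> \<in> bcc k \<beta> \<longleftrightarrow> \<alpha> - \<beta> \<in> Bd k"
  by (auto simp: BC_class_def elt_set_plus_def) (metis add_diff_cancel_left' diff_add_cancel add.commute)

text \<open>Once the operations are computed on representatives, the axioms become identities
  between forms. Zeros are written as classes of 0 so that the zero differential fits the same
  pattern.\<close>

lemma bc_ops:
  "gdeg BC k = bcc k ` Z k"
  "X \<oplus>\<^bsub>gcomp BC k\<^esub> Y = X + Y"
  "\<zero>\<^bsub>gcomp BC k\<^esub> = bcc k 0"
  "bcc k \<alpha> + bcc k \<beta> = bcc k (\<alpha> + \<beta>)"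
  "z \<odot>\<^bsub>gcomp BC k\<^esub> bcc k \<alpha> = bcc k (scale_form z \<alpha>)"
  "gone BC = bcc 0 (unit_form M)"
  "gdiff BC k X = bcc (k + 1) 0"
  by (simp_all add: bott_chern_def bcc_0)
    (simp_all add: BC_class_def form_coset_scale[OF Bd_sub] coset_add form_subspaceD(5)[OF Bd_sub])

lemma bc_mult:
  assumes "\<alpha> \<in> Z p" "\<beta> \<in> Z q"
  shows "gmult BC p q (bcc p \<alpha>) (bcc q \<beta>) = bcc (p + q) (wedge \<alpha> \<beta>)"
proof -
  have "{wedge \<alpha>' \<beta>' | \<alpha>' \<beta>'. \<alpha>' \<in> bcc p \<alpha> \<and> \<beta>' \<in> bcc q \<beta>} + Bd (p + q) = bcc (p + q) (wedge \<alpha> \<beta>)"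
  proof (rule union_cosets)
    have "\<alpha> \<in> bcc p \<alpha>" "\<beta> \<in> bcc q \<beta>" using form_subspaceD(1)[OF Bd_sub] by (simp_all add: bcc_mem)
    then show "{wedge \<alpha>' \<beta>' | \<alpha>' \<beta>'. \<alpha>' \<in> bcc p \<alpha> \<and> \<beta>' \<in> bcc q \<beta>} \<noteq> {}" by blast
    fix s assume "s \<in> {wedge \<alpha>' \<beta>' | \<alpha>' \<beta>'. \<alpha>' \<in> bcc p \<alpha> \<and> \<beta>' \<in> bcc q \<beta>}"
    then obtain \<alpha>' \<beta>' where s: "s = wedge \<alpha>' \<beta>'" "\<alpha>' - \<alpha> \<in> Bd p" "\<beta>' - \<beta> \<in> Bd q" by (auto simp: bcc_mem)
    have "\<beta>' \<in> Z q" using form_subspaceD(2)[OF Z_sub assms(2) Bd_Z[OF s(3)]] by simp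
    \<comment> \<open>This sum is the difference of the two products; its second term needs the new
      \<open>\<beta>'\<close> to be a cycle.\<close>
    then have "wedge \<alpha> (\<beta>' - \<beta>) + wedge (\<alpha>' - \<alpha>) \<beta>' \<in> Bd (p + q)"
      by (intro form_subspaceD(2)[OF Bd_sub] Bd_wedge_right[OF assms(1) s(3)] Bd_wedge_left[OF s(2)])
    then show "s +o Bd (p + q) = bcc (p + q) (wedge \<alpha> \<beta>)"
      using bcc_eqI[of s "wedge \<alpha> \<beta>" "p + q"] s(1)
      by (simp add: wedge_diff_left wedge_diff_right BC_class_def)
  qed
  then show ?thesis by (simp add: bott_chern_def)
qed

text \<open>The Leibniz rule for \<open>1 = 1 \<and> 1\<close> gives \<open>d1 = d1 + d1\<close>.
  Moreover \<open>J\<close> fixes 1, so \<open>d\<^sup>c1\<close> vanishes too.\<close>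

lemma unit_Z: "unit_form M \<in> Z 0"
proof -
  have *: "d (unit_form M) = 0"
  proof -
    have "wedge (unit_form M) (d (unit_form M)) = d (unit_form M)"
      by (rule wedge_unit(1)[OF M d_F[OF unit_forms[OF M]]])
    moreover have "wedge (d (unit_form M)) (unit_form M) = d (unit_form M)"
      by (rule wedge_unit(2)[OF M d_F[OF unit_forms[OF M]]])
    moreover have "parity_form (unit_form M) = unit_form M"
      by (simp add: parity_form_scale[OF M unit_forms[OF M]] scale_one)
    moreover have "wedge (unit_form M) (unit_form M) = unit_form M"
      by (rule wedge_unit(1)[OF M unit_forms[OF M]])
    ultimately show ?thesis using d_wedge[OF unit_forms[OF M] unit_forms[OF M]] by simp
  qed
  have "act (unit_form M) = unit_form M"
    by (auto simp: fun_eq_iff act_on_forms_def unit_form_def tangent_list_def)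
  then have "\<delta> (unit_form M) = 0" by (simp add: dc_def * act_zero)
  then show ?thesis using * unit_forms[OF M] by (simp add: Z_iff)
qed

lemmas Z_closed = form_subspaceD(1-3)[OF Z_sub] Z_wedge unit_Z

lemma wedge_unit_Z: "\<alpha> \<in> Z k \<Longrightarrow> wedge (unit_form M) \<alpha> = \<alpha>" "\<alpha> \<in> Z k \<Longrightarrow> wedge \<alpha> (unit_form M) = \<alpha>"
  by (simp_all add: Z_iff wedge_unit[OF M, of \<alpha> k])

lemma bott_chern_dga: "is_dga BC"
  unfolding is_dga_def
proof (intro conjI allI ballI)
  show "module complex_ring (gcomp BC k)" for k
    unfolding bott_chern_def dga.simps
    by (rule module_image[OF Z_sub])
      (simp_all add: bc_ops bcc_0 BC_class_def form_coset_scale[OF Bd_sub] coset_add form_subspaceD(5)[OF Bd_sub] form_coset_0)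
  show "bilinear_map (gcomp BC p) (gcomp BC q) (gcomp BC (p + q)) (gmult BC p q)" for p q
    by (auto simp: bilinear_map_def linear_map_def bc_ops bc_mult Z_closed wedge_add_left wedge_add_right
        wedge_scale_left wedge_scale_right)
  show "linear_map (gcomp BC p) (gcomp BC (p + 1)) (gdiff BC p)" for p
    by (auto simp: linear_map_def bc_ops Z_closed scale_form_0)
next
  fix p q r x y z assume "x \<in> gdeg BC p" "y \<in> gdeg BC q" "z \<in> gdeg BC r"
  then show "gmult BC (p + q) r (gmult BC p q x y) z = gmult BC p (q + r) x (gmult BC q r y z)"
    by (auto simp: bc_ops bc_mult Z_closed wedge_assoc add.assoc)
next
  fix p x assume "x \<in> gdeg BC p"
  have "p + 1 + 1 = p + 2" by simp
  then show "gdiff BC (p + 1) (gdiff BC p x) = \<zero>\<^bsub>gcomp BC (p + 2)\<^esub>" by (simp only: bc_ops)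
next
  fix p q x y assume "x \<in> gdeg BC p" "y \<in> gdeg BC q"
  then show "gdiff BC (p + q) (gmult BC p q x y)
          = gmult BC (p + 1) q (gdiff BC p x) y \<oplus>\<^bsub>gcomp BC (p + q + 1)\<^esub>
            ((-1) powi p) \<odot>\<^bsub>gcomp BC (p + q + 1)\<^esub> gmult BC p (q + 1) x (gdiff BC q y)"
    \<comment> \<open>Both sides are the class of 0. The instances of \<open>bc_mult\<close> put the
      zero form into degree \<open>q + 1\<close> or \<open>p + 1\<close>, where the differential
      places it.\<close>
    by (auto simp: scale_form_0 bc_ops bc_mult Z_closed wedge_zero_left wedge_zero_right bc_mult[of _ p 0 "q + 1", simplified]
        bc_mult[of 0 "p + 1" _ q, simplified] add.assoc add.commute[of 1])
qed (auto simp: bc_ops bc_mult Z_closed wedge_unit_Z bc_mult[of "unit_form M" 0 _ p for p, simplified]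
    bc_mult[of _ p "unit_form M" 0 for p, simplified])

end

section \<open>Aeppli cohomology\<close>

lemma set_plus_iff: "x \<in> A + B \<longleftrightarrow> (\<exists>a\<in>A. \<exists>b\<in>B. x = a + b)"
  by (auto simp: set_plus_def)

context almost_complex
begin

abbreviation "K \<equiv> C_zero M J"
abbreviation "cc \<equiv> C_class M J"
abbreviation "AB \<equiv> A_boundaries M J"
abbreviation "AM \<equiv> aeppli M J"

text \<open>Aeppli classes are cosets of cosets; this sends a form through both quotients at once.
  The set \<open>ZA\<close> below collects the forms that give cycles.\<close>

definition ae_class :: "int \<Rightarrow> ('a, 'v) form \<Rightarrow> ('a, 'v) form set set" where
  "ae_class k \<gamma> = A_class M J k (cc k \<gamma>)"

definition ZA :: "int \<Rightarrow> ('a, 'v) form set" where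
  "ZA k = {\<gamma> \<in> F k. d (\<delta> \<gamma>) \<in> K (k + 2)}"

lemma K_iff: "\<alpha> \<in> K k \<longleftrightarrow> (\<exists>\<beta>\<in>F (k - 2). \<alpha> = D \<beta>)"
  by (auto simp: C_zero_def)

lemma D_K: "\<beta> \<in> F l \<Longrightarrow> l = k - 2 \<Longrightarrow> D \<beta> \<in> K k"
  by (auto simp: K_iff)

lemma K_sub: "form_subspace (K k)"
  unfolding form_subspace_def
proof (intro conjI ballI allI)
  have "D 0 = 0" by (simp add: ddc_plus_dcd_def d_zero dc_zero)
  then show "0 \<in> K k" unfolding K_iff using F_intros(5) by metis
next
  fix a b assume "a \<in> K k" "b \<in> K k"
  then obtain \<alpha> \<beta> where *: "\<alpha> \<in> F (k - 2)" "a = D \<alpha>" "\<beta> \<in> F (k - 2)" "b = D \<beta>"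
    by (auto simp: K_iff)
  then show "a + b \<in> K k"
    unfolding K_iff by (intro bexI[of _ "\<alpha> + \<beta>"]) (simp_all add: F_intros D_add)
next
  fix z a assume "a \<in> K k"
  then obtain \<alpha> where *: "\<alpha> \<in> F (k - 2)" "a = D \<alpha>" by (auto simp: K_iff)
  then show "scale_form z a \<in> K k"
    unfolding K_iff by (intro bexI[of _ "scale_form z \<alpha>"]) (simp_all add: F_intros D_scale)
qed

lemmas K_closed = form_subspaceD[OF K_sub]

lemma K_F: "\<alpha> \<in> K k \<Longrightarrow> \<alpha> \<in> F k"
  unfolding K_iff using D_F by fastforce

lemma cc_0: "cc k 0 = K k"
  unfolding C_class_def by (rule form_coset_0)

lemma cc_add: "cc k \<alpha> + cc k \<beta> = cc k (\<alpha> + \<beta>)"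
  unfolding C_class_def by (rule coset_add[OF K_closed(5)])

lemma cc_eqI: "\<alpha> - \<beta> \<in> K k \<Longrightarrow> cc k \<alpha> = cc k \<beta>"
  unfolding C_class_def by (rule form_coset_eqI[OF K_sub])

lemma cc_eq_K: "cc k \<alpha> = K k \<longleftrightarrow> \<alpha> \<in> K k"
proof
  assume "cc k \<alpha> = K k"
  moreover have "\<alpha> + 0 \<in> cc k \<alpha>" unfolding C_class_def using K_closed(1) by (rule set_plus_intro2)
  ultimately show "\<alpha> \<in> K k" by simp
qed (use cc_eqI[of \<alpha> 0] cc_0 in simp)

lemma cc_map:
  assumes "\<And>w. w \<in> K k \<Longrightarrow> g (\<alpha> + w) = g \<alpha> + h w" "\<And>w. w \<in> K k \<Longrightarrow> h w \<in> W"
    and "form_subspace W"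
  shows "coset_map W g (cc k \<alpha>) = g \<alpha> +o W"
  unfolding C_class_def
  by (rule coset_map_coset[of _ 0]) (use assms K_closed(1) form_subspaceD(2)[OF assms(3)] in auto)

lemma d_K: "\<alpha> \<in> K k \<Longrightarrow> d \<alpha> \<in> K (k + 1)" and dc_K: "\<alpha> \<in> K k \<Longrightarrow> \<delta> \<alpha> \<in> K (k + 1)"
proof -
  assume "\<alpha> \<in> K k"
  then obtain \<beta> where \<beta>: "\<beta> \<in> F (k - 2)" "\<alpha> = D \<beta>" by (auto simp: K_iff)
  then show "d \<alpha> \<in> K (k + 1)" "\<delta> \<alpha> \<in> K (k + 1)"
    using D_K[OF d_F[OF \<beta>(1)], of "k + 1"] D_K[OF dc_F[OF \<beta>(1)], of "k + 1"]
    by (simp_all add: d_D dc_D)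
qed

lemma C_d_cc: "\<gamma> \<in> F k \<Longrightarrow> C_d M J k (cc k \<gamma>) = cc (k + 1) (d \<gamma>)"
  unfolding C_d_def C_class_def[of M J "k + 1"]
  by (rule cc_map[OF _ _ K_sub, of _ _ _ d]) (simp_all add: d_add[OF _ K_F] d_K)

lemma C_dc_cc: "\<gamma> \<in> F k \<Longrightarrow> C_dc M J k (cc k \<gamma>) = cc (k + 1) (\<delta> \<gamma>)"
  unfolding C_dc_def C_class_def[of M J "k + 1"]
  by (rule cc_map[OF _ _ K_sub, of _ _ _ \<delta>]) (simp_all add: dc_add[OF _ K_F] dc_K)

lemma cc_scale: "coset_map (K k) (scale_form z) (cc k \<gamma>) = cc k (scale_form z \<gamma>)"
  unfolding C_class_def by (rule form_coset_scale[OF K_sub])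

lemma A_cycle_iff:
  assumes \<gamma>: "\<gamma> \<in> F k"
  shows "cc k \<gamma> \<in> A_cycles M J k \<longleftrightarrow> \<gamma> \<in> ZA k"
proof -
  have "k + 1 + 1 = k + 2" by simp
  then have "C_d M J (k + 1) (C_dc M J k (cc k \<gamma>)) = cc (k + 2) (d (\<delta> \<gamma>))"
    by (metis C_dc_cc[OF \<gamma>] C_d_cc[OF dc_F[OF \<gamma>]])
  then show ?thesis using \<gamma> cc_eq_K[of "k + 2" "d (\<delta> \<gamma>)"] by (simp add: A_cycles_def C_forms_def ZA_def)
qed

lemma A_cycles_eq: "A_cycles M J k = cc k ` ZA k"
proof (intro subset_antisym subsetI)
  fix X assume X: "X \<in> A_cycles M J k"
  then obtain \<gamma> where \<gamma>: "\<gamma> \<in> F k" "X = cc k \<gamma>" unfolding A_cycles_def C_forms_def by blast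
  then show "X \<in> cc k ` ZA k" using A_cycle_iff[OF \<gamma>(1)] X by blast
next
  fix X assume "X \<in> cc k ` ZA k"
  then obtain \<gamma> where \<gamma>: "\<gamma> \<in> ZA k" "X = cc k \<gamma>" by blast
  then have "\<gamma> \<in> F k" by (simp add: ZA_def)
  then show "X \<in> A_cycles M J k" using A_cycle_iff \<gamma> by blast
qed

lemma AB_iff: "X \<in> AB k \<longleftrightarrow> (\<exists>\<mu>\<in>F (k - 1). \<exists>\<nu>\<in>F (k - 1). X = cc k (d \<mu> + \<delta> \<nu>))"
proof -
  have eq: "C_d M J (k - 1) ` C_forms M J (k - 1) = (\<lambda>\<mu>. cc k (d \<mu>)) ` F (k - 1)"
    "C_dc M J (k - 1) ` C_forms M J (k - 1) = (\<lambda>\<mu>. cc k (\<delta> \<mu>)) ` F (k - 1)"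
    using C_d_cc[of _ "k - 1"] C_dc_cc[of _ "k - 1"] by (auto simp: C_forms_def image_image)
  show ?thesis unfolding A_boundaries_def eq set_plus_iff[of X] by (auto simp: cc_add)
qed

lemma AB_add: "X \<in> AB k \<Longrightarrow> Y \<in> AB k \<Longrightarrow> X + Y \<in> AB k"
proof -
  assume "X \<in> AB k" "Y \<in> AB k"
  then obtain \<mu> \<nu> \<mu>' \<nu>' where *: "\<mu> \<in> F (k - 1)" "\<nu> \<in> F (k - 1)" "\<mu>' \<in> F (k - 1)" "\<nu>' \<in> F (k - 1)"
    "X = cc k (d \<mu> + \<delta> \<nu>)" "Y = cc k (d \<mu>' + \<delta> \<nu>')" by (auto simp: AB_iff)
  have "X + Y = cc k (d (\<mu> + \<mu>') + \<delta> (\<nu> + \<nu>'))"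
    using * by (simp add: cc_add d_add[of _ "k - 1" _ "k - 1"] dc_add[of _ "k - 1" _ "k - 1"] ac_simps)
  then show "X + Y \<in> AB k" unfolding AB_iff using * F_intros(1) by blast
qed

lemma AB_0: "cc k 0 \<in> AB k"
  unfolding AB_iff using F_intros(5)[of "k - 1"] by (intro bexI[of _ 0]) (simp_all add: d_zero dc_zero)

text \<open>The neutral element here is the coset of 0 rather than the zero of set addition, so
  \<open>X\<close> is written as \<open>cc k 0 + X\<close>.\<close>

lemma AB_AB: "AB k + AB k = AB k"
proof -
  have "X \<in> AB k + AB k" if "X \<in> AB k" for X
  proof -
    have "cc k 0 + X \<in> AB k + AB k" by (rule set_plus_intro[OF AB_0 that])
    moreover have "cc k 0 + X = X" using that by (auto simp: AB_iff cc_add)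
    ultimately show ?thesis by simp
  qed
  then show ?thesis using AB_add by (intro subset_antisym subsetI) (auto simp: set_plus_iff[of _ "AB k" "AB k"])
qed

lemma ae_class_add: "ae_class k \<alpha> + ae_class k \<beta> = ae_class k (\<alpha> + \<beta>)"
  unfolding ae_class_def A_class_def coset_add[OF AB_AB] cc_add ..

lemma ae_class_0: "ae_class k 0 = AB k"
proof -
  have "cc k 0 + X = X" if "X \<in> AB k" for X using that by (auto simp: AB_iff cc_add)
  then show ?thesis unfolding ae_class_def A_class_def elt_set_plus_def by auto
qed

text \<open>Translates equality in the double quotient into a relation between forms modulo
  \<open>K k\<close>; the classes of \<open>d \<mu> + \<delta> \<nu>\<close> and of its negative are
  the witnesses for \<open>coset_eqI\<close>.\<close>

lemma ae_class_eqI: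
  assumes "\<alpha> - \<beta> - (d \<mu> + \<delta> \<nu>) \<in> K k" "\<mu> \<in> F (k - 1)" "\<nu> \<in> F (k - 1)"
  shows "ae_class k \<alpha> = ae_class k \<beta>"
  unfolding ae_class_def A_class_def
proof (rule coset_eqI[OF _ _ _ _ AB_add])
  show "cc k \<alpha> = cc k \<beta> + cc k (d \<mu> + \<delta> \<nu>)"
    unfolding cc_add by (rule cc_eqI) (use assms(1) in \<open>simp add: algebra_simps\<close>)
  show "cc k (d \<mu> + \<delta> \<nu>) \<in> AB k" using assms(2,3) by (auto simp: AB_iff)
  have neg: "d (- \<mu>) + \<delta> (- \<nu>) = - (d \<mu> + \<delta> \<nu>)"
    using d_scale[OF assms(2), of "-1"] dc_scale[OF assms(3), of "-1"] by (simp add: scale_minus1)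
  show "cc k \<beta> = cc k \<alpha> + cc k (- (d \<mu> + \<delta> \<nu>))"
    unfolding cc_add by (rule cc_eqI) (use K_closed(4)[OF assms(1)] in \<open>simp add: algebra_simps\<close>)
  show "cc k (- (d \<mu> + \<delta> \<nu>)) \<in> AB k"
    unfolding AB_iff using neg assms(2,3) F_intros(3) by metis
qed

text \<open>One lemma for scaling and pullback: \<open>g\<close> acts on cosets, \<open>h\<close> on
  forms, and \<open>h\<close> has to send images of \<open>d\<close> and of \<open>\<delta>\<close>
  to such images in degree \<open>l\<close>.\<close>

lemma ae_class_map:
  fixes M' :: "('b, 'w::euclidean_space) manifold"
  assumes "almost_complex M' J'"
    and cc: "\<And>\<beta>. \<beta> \<in> F k \<Longrightarrow> g (cc k \<beta>) = C_class M' J' l (h \<beta>)"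
    and "\<And>\<alpha> \<beta>. h (\<alpha> + \<beta>) = h \<alpha> + h \<beta>"
    and h: "\<And>\<mu>. \<mu> \<in> F (k - 1) \<Longrightarrow> \<exists>\<mu>'\<in>forms M' (l - 1). h (d \<mu>) = ext_d M' \<mu>'"
      "\<And>\<mu>. \<mu> \<in> F (k - 1) \<Longrightarrow> \<exists>\<mu>'\<in>forms M' (l - 1). h (\<delta> \<mu>) = dc M' J' \<mu>'"
    and \<alpha>: "\<alpha> \<in> F k"
  shows "coset_map (A_boundaries M' J' l) g (ae_class k \<alpha>) = almost_complex.ae_class M' J' l (h \<alpha>)"
proof -
  interpret N: almost_complex M' J' by fact
  have "coset_map (A_boundaries M' J' l) g (cc k \<alpha> +o AB k) = g (cc k \<alpha>) +o A_boundaries M' J' l"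
  proof (rule coset_map_coset[OF _ AB_0 _ N.AB_add])
    show "cc k \<alpha> + cc k 0 = cc k \<alpha>" by (simp add: cc_add)
    fix w assume "w \<in> AB k"
    then obtain \<mu> \<nu> where *: "\<mu> \<in> F (k - 1)" "\<nu> \<in> F (k - 1)" "w = cc k (d \<mu> + \<delta> \<nu>)" by (auto simp: AB_iff)
    obtain \<mu>' \<nu>' where **: "\<mu>' \<in> forms M' (l - 1)" "h (d \<mu>) = ext_d M' \<mu>'"
      "\<nu>' \<in> forms M' (l - 1)" "h (\<delta> \<nu>) = dc M' J' \<nu>'" using h * by blast
    have "d \<mu> + \<delta> \<nu> \<in> F k" using d_F[OF *(1)] dc_F[OF *(2)] F_intros(1) by simp
    then have "g (cc k \<alpha> + w) = g (cc k \<alpha>) + N.cc l (ext_d M' \<mu>' + dc M' J' \<nu>')"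
      using * ** \<alpha> F_intros(1)[OF \<alpha>] by (simp add: cc_add cc N.cc_add assms(3))
    then show "\<exists>w'\<in>A_boundaries M' J' l. g (cc k \<alpha> + w) = g (cc k \<alpha>) + w'"
      using ** N.AB_iff by blast
  qed
  then show ?thesis by (simp add: ae_class_def A_class_def N.ae_class_def cc[OF \<alpha>])
qed

lemma ae_class_scale:
  assumes "\<gamma> \<in> F k"
  shows "coset_map (AB k) (coset_map (K k) (scale_form z)) (ae_class k \<gamma>) = ae_class k (scale_form z \<gamma>)"
proof (rule ae_class_map[where h = "scale_form z", OF almost_complex_axioms cc_scale scale_add _ _ assms])
  fix \<mu> assume "\<mu> \<in> F (k - 1)"
  then show "\<exists>\<mu>'\<in>F (k - 1). scale_form z (d \<mu>) = d \<mu>'" "\<exists>\<mu>'\<in>F (k - 1). scale_form z (\<delta> \<mu>) = \<delta> \<mu>'"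
    using d_scale dc_scale F_intros(2) by metis+
qed

lemma ZA_sub: "form_subspace (ZA k)"
  using K_closed[where k = "k + 2"]
  by (auto simp: form_subspace_def ZA_def F_intros d_zero dc_zero dc_add dc_scale d_add[OF dc_F dc_F] d_scale[OF dc_F])

lemma ae_ops:
  "mdeg AM k = ae_class k ` ZA k"
  "X \<oplus>\<^bsub>mcomp AM k\<^esub> Y = X + Y"
  "\<zero>\<^bsub>mcomp AM k\<^esub> = ae_class k 0"
  "ae_class k \<alpha> + ae_class k \<beta> = ae_class k (\<alpha> + \<beta>)"
  "\<gamma> \<in> ZA k \<Longrightarrow> z \<odot>\<^bsub>mcomp AM k\<^esub> ae_class k \<gamma> = ae_class k (scale_form z \<gamma>)"
  "mdiff AM k X = ae_class (k + 1) 0"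
  by (simp_all add: aeppli_def ae_class_0 ae_class_add)
    (simp_all add: ae_class_def A_cycles_eq image_image ae_class_scale[unfolded ae_class_def] ZA_def)

text \<open>Both \<open>dd\<^sup>c\<close> and \<open>D\<close> pass a cycle
  \<open>\<alpha>\<close>, so \<open>dd\<^sup>c\<gamma> = D\<epsilon>\<close> gives
  \<open>dd\<^sup>c(\<alpha> \<and> \<gamma>) = D(\<alpha> \<and> \<epsilon>)\<close>.\<close>

lemma Z_wedge_ZA: "\<alpha> \<in> Z p \<Longrightarrow> \<gamma> \<in> ZA q \<Longrightarrow> wedge \<alpha> \<gamma> \<in> ZA (p + q)"
proof -
  assume \<alpha>: "\<alpha> \<in> Z p" and \<gamma>: "\<gamma> \<in> ZA q"
  then obtain \<epsilon> where \<epsilon>: "\<epsilon> \<in> F q" "d (\<delta> \<gamma>) = D \<epsilon>" by (auto simp: ZA_def K_iff)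
  have "wedge \<alpha> \<gamma> \<in> F (p + q)" "wedge \<alpha> \<epsilon> \<in> F (p + q)"
    using \<alpha> \<gamma> \<epsilon> by (auto simp: Z_iff ZA_def wedge_forms[OF M])
  moreover have "d (\<delta> (wedge \<alpha> \<gamma>)) = D (wedge \<alpha> \<epsilon>)"
    using d_cycle_wedge(3)[OF \<alpha>, of \<gamma> q] d_cycle_wedge(4)[OF \<alpha> \<epsilon>(1)] \<gamma> \<epsilon>(2) by (simp add: ZA_def)
  ultimately show ?thesis by (simp add: ZA_def D_K)
qed

text \<open>The identity behind well-definedness in the algebra variable: for \<open>b = dd\<^sup>c\<beta>\<close> and
  \<open>d\<^sup>cd\<gamma> = D\<theta>\<close> with \<open>D = dd\<^sup>c + d\<^sup>cd\<close> and \<open>D\<beta> = 0\<close>,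
  \<open>b \<and> \<gamma> = d(d\<^sup>c\<beta> \<and> \<gamma>) \<plusminus> d\<^sup>c(\<beta> \<and> d\<gamma>) - D(\<beta> \<and> \<theta>)\<close>.\<close>

lemma Bd_wedge_ZA:
  assumes "b \<in> Bd p" "\<gamma> \<in> ZA q"
  shows "\<exists>\<mu>\<in>F (p + q - 1). \<exists>\<nu>\<in>F (p + q - 1). wedge b \<gamma> - (d \<mu> + \<delta> \<nu>) \<in> K (p + q)"
proof -
  obtain \<beta> where \<beta>: "\<beta> \<in> F (p - 2)" "D \<beta> = 0" "b = d (\<delta> \<beta>)" using assms(1) by (auto simp: Bd_iff)
  obtain \<epsilon> where \<epsilon>: "\<epsilon> \<in> F q" "d (\<delta> \<gamma>) = D \<epsilon>" and \<gamma>: "\<gamma> \<in> F q" using assms(2) by (auto simp: ZA_def K_iff)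
  \<comment> \<open>Since \<open>D\<gamma> = dd\<^sup>c\<gamma> + d\<^sup>cd\<gamma>\<close> and
    \<open>dd\<^sup>c\<gamma> = D\<epsilon>\<close>, this choice gives
    \<open>d\<^sup>cd\<gamma> = D\<theta>\<close>.\<close>
  define \<theta> where "\<theta> = \<gamma> - \<epsilon>"
  have \<theta>: "\<theta> \<in> F q" unfolding \<theta>_def by (rule F_intros(4)[OF \<gamma> \<epsilon>(1)])
  have "D \<gamma> = D (\<theta> + \<epsilon>)" by (simp add: \<theta>_def)
  then have "\<delta> (d \<gamma>) = D \<theta>"
    using D_add[OF \<theta> \<epsilon>(1)] \<epsilon>(2) by (simp add: ddc_plus_dcd_def[of M J \<gamma>] algebra_simps)
  note w = wedge_forms[OF M]
  have "d (wedge (\<delta> \<beta>) \<gamma>) = wedge b \<gamma> + wedge (parity_form (\<delta> \<beta>)) (d \<gamma>)"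
    using d_wedge[OF dc_F[OF \<beta>(1)] \<gamma>] \<beta>(3) by simp
  moreover have "\<delta> (wedge (parity_form \<beta>) (d \<gamma>)) = - wedge (parity_form (\<delta> \<beta>)) (d \<gamma>) + wedge \<beta> (D \<theta>)"
    using dc_wedge[OF F_intros(6)[OF \<beta>(1)] d_F[OF \<gamma>]] \<open>\<delta> (d \<gamma>) = D \<theta>\<close>
    by (simp add: dc_parity_form[OF \<beta>(1)] parity_form_parity_form wedge_uminus_left)
  moreover have "D (wedge \<beta> \<theta>) = wedge \<beta> (D \<theta>)"
    using D_wedge[OF \<beta>(1) \<theta>] \<beta>(2) by (simp add: wedge_zero_left)
  ultimately have "wedge b \<gamma> - (d (wedge (\<delta> \<beta>) \<gamma>) + \<delta> (wedge (parity_form \<beta>) (d \<gamma>))) = - D (wedge \<beta> \<theta>)"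
    by simp
  moreover have "- D (wedge \<beta> \<theta>) \<in> K (p + q)"
    by (rule K_closed(4)[OF D_K[OF w[OF \<beta>(1) \<theta>]]]) simp
  moreover have "wedge (\<delta> \<beta>) \<gamma> \<in> F (p + q - 1)" "wedge (parity_form \<beta>) (d \<gamma>) \<in> F (p + q - 1)"
    using w[OF dc_F[OF \<beta>(1)] \<gamma>] w[OF F_intros(6)[OF \<beta>(1)] d_F[OF \<gamma>]] by (simp_all add: algebra_simps)
  ultimately show ?thesis by metis
qed

text \<open>Multiplication by a cycle preserves the image of \<open>D\<close>, by
  \<open>d_cycle_wedge\<close>, and so descends to cosets.\<close>

lemma cc_wedge:
  assumes "\<alpha> \<in> Z p" "\<gamma> \<in> F q"
  shows "coset_map (K (p + q)) (wedge \<alpha>) (cc q \<gamma>) = cc (p + q) (wedge \<alpha> \<gamma>)"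
  unfolding C_class_def[of M J "p + q"]
proof (rule cc_map[where g = "wedge \<alpha>" and h = "wedge \<alpha>", OF wedge_add_right _ K_sub])
  fix w assume "w \<in> K q"
  then obtain \<beta> where \<beta>: "\<beta> \<in> F (q - 2)" "w = D \<beta>" by (auto simp: K_iff)
  have "\<alpha> \<in> F p" using assms(1) by (simp add: Z_iff)
  then show "wedge \<alpha> w \<in> K (p + q)"
    unfolding \<beta>(2) d_cycle_wedge(4)[OF assms(1) \<beta>(1)] by (intro D_K[OF wedge_forms[OF M _ \<beta>(1)]]) simp_all
qed

text \<open>A change of representatives alters the product by
  \<open>(\<alpha>' - \<alpha>) \<and> \<gamma>\<close>, handled by \<open>Bd_wedge_ZA\<close>, and
  by \<open>\<alpha>' \<and> (d\<mu> + d\<^sup>c\<nu>)\<close>, which is again a sum of images of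
  \<open>d\<close> and \<open>d\<^sup>c\<close> because \<open>\<alpha>'\<close> is a cycle.\<close>

lemma ae_act:
  assumes \<alpha>: "\<alpha> \<in> Z p" and \<gamma>: "\<gamma> \<in> ZA q"
  shows "mact AM p q (bcc p \<alpha>) (ae_class q \<gamma>) = ae_class (p + q) (wedge \<alpha> \<gamma>)"
proof -
  define S where "S = {coset_map (K (p + q)) (wedge \<alpha>') c | \<alpha>' c. \<alpha>' \<in> bcc p \<alpha> \<and> c \<in> ae_class q \<gamma>}"
  have \<gamma>F: "\<gamma> \<in> F q" using \<gamma> by (simp add: ZA_def)
  have "S + AB (p + q) = ae_class (p + q) (wedge \<alpha> \<gamma>)"
  proof (rule union_cosets)
    have "\<alpha> \<in> bcc p \<alpha>" using form_subspaceD(1)[OF Bd_sub] by (simp add: bcc_mem)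
    moreover have "cc q \<gamma> + cc q 0 \<in> ae_class q \<gamma>" unfolding ae_class_def A_class_def by (rule set_plus_intro2[OF AB_0])
    ultimately show "S \<noteq> {}" unfolding S_def by blast
    fix s assume "s \<in> S"
    then obtain \<alpha>' c where s: "s = coset_map (K (p + q)) (wedge \<alpha>') c" "\<alpha>' - \<alpha> \<in> Bd p" "c \<in> cc q \<gamma> +o AB q"
      by (auto simp: S_def bcc_mem ae_class_def A_class_def)
    then obtain \<mu> \<nu> where c: "\<mu> \<in> F (q - 1)" "\<nu> \<in> F (q - 1)" "c = cc q (\<gamma> + (d \<mu> + \<delta> \<nu>))"
      by (auto simp: elt_set_plus_def AB_iff cc_add)
    have \<alpha>': "\<alpha>' \<in> Z p" using form_subspaceD(2)[OF Z_sub \<alpha> Bd_Z[OF s(2)]] by simp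
    have F': "d \<mu> + \<delta> \<nu> \<in> F q" using d_F[OF c(1)] dc_F[OF c(2)] F_intros(1) by simp
    have s': "s = cc (p + q) (wedge \<alpha>' (\<gamma> + (d \<mu> + \<delta> \<nu>)))"
      unfolding s(1) c(3) by (rule cc_wedge[OF \<alpha>' F_intros(1)[OF \<gamma>F F']])
    obtain \<mu>1 \<nu>1 where 1: "\<mu>1 \<in> F (p + q - 1)" "\<nu>1 \<in> F (p + q - 1)"
      "wedge (\<alpha>' - \<alpha>) \<gamma> - (d \<mu>1 + \<delta> \<nu>1) \<in> K (p + q)" using Bd_wedge_ZA[OF s(2) \<gamma>] by blast
    \<comment> \<open>By \<open>d_cycle_wedge\<close>, \<open>\<alpha>' \<and> d\<mu>\<close> is
      \<open>d\<close> of the first and \<open>\<alpha>' \<and> d\<^sup>c\<nu>\<close> is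
      \<open>d\<^sup>c\<close> of the second.\<close>
    define \<mu>2 \<nu>2 where "\<mu>2 = wedge (parity_form \<alpha>') \<mu>" and "\<nu>2 = wedge (parity_form \<alpha>') \<nu>"
    have 2: "\<mu>2 \<in> F (p + q - 1)" "\<nu>2 \<in> F (p + q - 1)"
      using Z_parity_form[OF \<alpha>'] wedge_forms[OF M _ c(1), of "parity_form \<alpha>'" p] wedge_forms[OF M _ c(2), of "parity_form \<alpha>'" p]
      by (simp_all add: \<mu>2_def \<nu>2_def Z_iff algebra_simps)
    have "wedge \<alpha>' (\<gamma> + (d \<mu> + \<delta> \<nu>)) - wedge \<alpha> \<gamma> - (d (\<mu>1 + \<mu>2) + \<delta> (\<nu>1 + \<nu>2))
        = wedge (\<alpha>' - \<alpha>) \<gamma> - (d \<mu>1 + \<delta> \<nu>1)"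
      by (simp add: wedge_add_right wedge_diff_left d_cycle_wedge(1)[OF \<alpha>' c(1)] d_cycle_wedge(2)[OF \<alpha>' c(2)]
          d_add[OF 1(1) 2(1)] dc_add[OF 1(2) 2(2)] flip: \<mu>2_def \<nu>2_def)
    then have "ae_class (p + q) (wedge \<alpha>' (\<gamma> + (d \<mu> + \<delta> \<nu>))) = ae_class (p + q) (wedge \<alpha> \<gamma>)"
      by (intro ae_class_eqI[of _ _ "\<mu>1 + \<mu>2" "\<nu>1 + \<nu>2"]) (simp_all add: 1 2 F_intros)
    then show "s +o AB (p + q) = ae_class (p + q) (wedge \<alpha> \<gamma>)" by (simp add: s' ae_class_def A_class_def)
  qed
  then show ?thesis by (simp add: aeppli_def S_def)
qed

lemmas ZA_closed = form_subspaceD(1-3)[OF ZA_sub] Z_wedge_ZA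

lemma aeppli_dg_module: "is_dg_module BC AM"
  unfolding is_dg_module_def
proof (intro conjI allI ballI)
  show "is_dga BC" by (rule bott_chern_dga)
  show "module complex_ring (mcomp AM k)" for k
  proof -
    have "mcomp AM k = \<lparr>carrier = ae_class k ` ZA k, mult = undefined, one = undefined, zero = AB k, add = (+),
        smult = (\<lambda>z. coset_map (AB k) (coset_map (K k) (scale_form z)))\<rparr>"
      by (simp add: aeppli_def ae_class_def A_cycles_eq image_image)
    then show ?thesis
      by (simp only:) (rule module_image[OF ZA_sub], simp_all add: ae_class_add ae_class_scale ZA_def ae_class_0)
  qed
  show "bilinear_map (gcomp BC p) (mcomp AM q) (mcomp AM (p + q)) (mact AM p q)" for p q
    by (auto simp: bilinear_map_def linear_map_def bc_ops ae_ops ae_act ZA_closed Z_closed wedge_add_left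
        wedge_add_right wedge_scale_left wedge_scale_right)
  show "linear_map (mcomp AM p) (mcomp AM (p + 1)) (mdiff AM p)" for p
    by (auto simp: linear_map_def ae_ops ZA_closed scale_form_0)
next
  fix p q r x y z assume "x \<in> gdeg BC p" "y \<in> gdeg BC q" "z \<in> mdeg AM r"
  then show "mact AM (p + q) r (gmult BC p q x y) z = mact AM p (q + r) x (mact AM q r y z)"
    by (auto simp: bc_ops bc_mult ae_ops ae_act Z_closed ZA_closed wedge_assoc add.assoc)
next
  fix p x assume "x \<in> mdeg AM p"
  have "p + 1 + 1 = p + 2" by simp
  then show "mdiff AM (p + 1) (mdiff AM p x) = \<zero>\<^bsub>mcomp AM (p + 2)\<^esub>" by (simp only: ae_ops)
next
  fix p m assume "m \<in> mdeg AM p"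
  then obtain \<gamma> where \<gamma>: "\<gamma> \<in> ZA p" "m = ae_class p \<gamma>" by (auto simp: ae_ops)
  have "wedge (unit_form M) \<gamma> = \<gamma>" using \<gamma>(1) by (simp add: ZA_def wedge_unit(1)[OF M, of \<gamma> p])
  then show "mact AM 0 p (gone BC) m = m" using ae_act[OF unit_Z \<gamma>(1)] \<gamma>(2) by (simp add: bc_ops)
next
  fix p q x m assume "x \<in> gdeg BC p" "m \<in> mdeg AM q"
  then show "mdiff AM (p + q) (mact AM p q x m)
          = mact AM (p + 1) q (gdiff BC p x) m \<oplus>\<^bsub>mcomp AM (p + q + 1)\<^esub>
            ((-1) powi p) \<odot>\<^bsub>mcomp AM (p + q + 1)\<^esub> mact AM p (q + 1) x (mdiff AM q m)"
    by (auto simp: scale_form_0 bc_ops ae_ops ae_act Z_closed ZA_closed wedge_zero_left wedge_zero_right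
        ae_act[of _ p 0 "q + 1", simplified] ae_act[of 0 "p + 1" _ q, simplified] add.assoc add.commute[of 1])
qed

end

section \<open>Pullback\<close>

context pseudo_holomorphic_map
begin

lemma pb_Z: "\<alpha> \<in> cod.Z k \<Longrightarrow> pb \<alpha> \<in> dom.Z k"
proof -
  assume "\<alpha> \<in> cod.Z k"
  then have \<alpha>: "\<alpha> \<in> cod.F k" "cod.d \<alpha> = 0" "cod.\<delta> \<alpha> = 0" by (simp_all add: cod.Z_iff)
  have "pb 0 = 0" by (simp add: pullback_def fun_eq_iff)
  then show "pb \<alpha> \<in> dom.Z k" using pb_d[OF \<alpha>(1)] pb_dc[OF \<alpha>(1)] pb_F[OF \<alpha>(1)] \<alpha>(2,3) by (simp add: dom.Z_iff)
qed

lemma pb_Bd: "\<alpha> \<in> cod.Bd k \<Longrightarrow> pb \<alpha> \<in> dom.Bd k"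
proof -
  assume "\<alpha> \<in> cod.Bd k"
  then obtain \<beta> where \<beta>: "\<beta> \<in> cod.F (k - 2)" "cod.D \<beta> = 0" "\<alpha> = cod.d (cod.\<delta> \<beta>)" by (auto simp: cod.Bd_iff)
  have "pb 0 = 0" by (simp add: pullback_def fun_eq_iff)
  then have "dom.D (pb \<beta>) = 0" using pb_D[OF \<beta>(1)] \<beta>(2) by simp
  moreover have "pb \<alpha> = dom.d (dom.\<delta> (pb \<beta>))"
    unfolding \<beta>(3) by (simp add: pb_d[OF cod.dc_F[OF \<beta>(1)]] pb_dc[OF \<beta>(1)])
  ultimately show "pb \<alpha> \<in> dom.Bd k" unfolding dom.Bd_iff using pb_F[OF \<beta>(1)] by blast
qed

lemma pb_K: "\<alpha> \<in> cod.K k \<Longrightarrow> pb \<alpha> \<in> dom.K k"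
  unfolding cod.K_iff dom.K_iff using pb_D pb_F by blast

lemma pb_bcc: "BC_pullback M J N f k (cod.bcc k \<alpha>) = dom.bcc k (pb \<alpha>)"
  unfolding BC_pullback_def BC_class_def
  by (rule coset_map_coset[of _ 0])
    (use pb_Bd form_subspaceD(1)[OF cod.Bd_sub] form_subspaceD(2)[OF dom.Bd_sub] in \<open>auto simp: pullback_add\<close>)

lemma pb_cc: "coset_map (dom.K k) pb (cod.cc k \<alpha>) = dom.cc k (pb \<alpha>)"
  unfolding C_class_def
  by (rule coset_map_coset[of _ 0])
    (use pb_K cod.K_closed(1) dom.K_closed(2) in \<open>auto simp: pullback_add\<close>)

lemma pb_ZA: "\<gamma> \<in> cod.ZA k \<Longrightarrow> pb \<gamma> \<in> dom.ZA k"
proof -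
  assume "\<gamma> \<in> cod.ZA k"
  then have \<gamma>: "\<gamma> \<in> cod.F k" "cod.d (cod.\<delta> \<gamma>) \<in> cod.K (k + 2)" by (simp_all add: cod.ZA_def)
  have "dom.d (dom.\<delta> (pb \<gamma>)) = pb (cod.d (cod.\<delta> \<gamma>))"
    by (simp add: pb_d[OF cod.dc_F[OF \<gamma>(1)]] pb_dc[OF \<gamma>(1)])
  then show "pb \<gamma> \<in> dom.ZA k" using pb_K[OF \<gamma>(2)] pb_F[OF \<gamma>(1)] by (simp add: dom.ZA_def)
qed

lemma pb_ae_class:
  assumes "\<gamma> \<in> cod.F k"
  shows "A_pullback M J N f k (cod.ae_class k \<gamma>) = dom.ae_class k (pb \<gamma>)"
  unfolding A_pullback_def
proof (rule cod.ae_class_map[where h = pb, OF dom.almost_complex_axioms pb_cc pullback_add _ _ assms])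
  fix \<mu> assume \<mu>: "\<mu> \<in> cod.F (k - 1)"
  show "\<exists>\<mu>'\<in>dom.F (k - 1). pb (cod.d \<mu>) = dom.d \<mu>'" "\<exists>\<mu>'\<in>dom.F (k - 1). pb (cod.\<delta> \<mu>) = dom.\<delta> \<mu>'"
    using pb_d[OF \<mu>] pb_dc[OF \<mu>] pb_F[OF \<mu>] by blast+
qed

lemma pb_zero: "pb 0 = 0"
  by (simp add: pullback_def fun_eq_iff)

lemma ZA_F: "\<gamma> \<in> cod.ZA k \<Longrightarrow> \<gamma> \<in> cod.F k"
  by (simp add: cod.ZA_def)

lemma BC_pullback_hom: "dga_hom cod.BC dom.BC (BC_pullback M J N f)"
  unfolding dga_hom_def
proof (intro conjI allI ballI)
  show "linear_map (gcomp cod.BC p) (gcomp dom.BC p) (BC_pullback M J N f p)" for p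
    by (auto simp: linear_map_def cod.bc_ops dom.bc_ops pb_bcc pb_Z pullback_add pullback_scale)
  show "BC_pullback M J N f 0 (gone cod.BC) = gone dom.BC"
    by (simp add: cod.bc_ops dom.bc_ops pb_bcc pb_unit)
qed (auto simp: cod.bott_chern_dga dom.bott_chern_dga cod.bc_ops dom.bc_ops cod.bc_mult dom.bc_mult
    pb_bcc pb_Z pullback_wedge pb_zero)

lemma A_pullback_hom:
  "dg_module_hom cod.BC cod.AM dom.BC dom.AM (BC_pullback M J N f) (A_pullback M J N f)"
  unfolding dg_module_hom_def
proof (intro conjI allI ballI)
  show "linear_map (mcomp cod.AM p) (mcomp dom.AM p) (A_pullback M J N f p)" for p
    by (auto simp: linear_map_def cod.ae_ops dom.ae_ops pb_ae_class[OF ZA_F] pb_ZA pullback_add pullback_scale cod.ZA_closed)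
qed (auto simp: cod.aeppli_dg_module dom.aeppli_dg_module BC_pullback_hom cod.bc_ops dom.bc_ops
    cod.ae_ops dom.ae_ops cod.ae_act dom.ae_act pb_bcc pb_Z pb_ae_class[OF ZA_F] pb_ZA pullback_wedge pb_zero
    pb_ae_class[OF cod.F_intros(5)] cod.ZA_closed)

text \<open>Puts the description on representatives into the terms of the theorem, where Aeppli
  cycles are cosets \<open>cc k \<gamma>\<close>.\<close>

lemma pullback_classes:
  "\<alpha> \<in> cod.Z k \<Longrightarrow> pb \<alpha> \<in> dom.Z k \<and> BC_pullback M J N f k (cod.bcc k \<alpha>) = dom.bcc k (pb \<alpha>)"
  "\<gamma> \<in> cod.F k \<Longrightarrow> cod.cc k \<gamma> \<in> A_cycles N J' k \<Longrightarrow>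
    dom.cc k (pb \<gamma>) \<in> A_cycles M J k \<and>
    A_pullback M J N f k (A_class N J' k (cod.cc k \<gamma>)) = A_class M J k (dom.cc k (pb \<gamma>))"
  using pb_Z pb_bcc pb_ZA cod.A_cycle_iff[of \<gamma> k] dom.A_cycle_iff[OF pb_F, of \<gamma> k] pb_ae_class[of \<gamma> k]
  by (auto simp: cod.ae_class_def dom.ae_class_def)

end

section \<open>Inverses of pseudo-holomorphic diffeomorphisms\<close>

lemma differential_cong:
  assumes M: "smooth_manifold M" and p: "p \<in> points M" and eq: "\<And>p. p \<in> points M \<Longrightarrow> f p = g p"
  shows "differential M N f p \<xi> = differential M N g p \<xi>"
proof -
  define c where "c = (SOME c. c \<in> charts_at M p)"
  have c: "c \<in> charts_at M p" unfolding c_def by (rule some_chart[OF M p])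
  note a = charts_atD(1)[OF M c]
  have *: "fd (lrep c f c') (cmap c p) = fd (lrep c g c') (cmap c p)" for c'
    by (rule fd_cong[OF atlasD(2)[OF M a] charts_atD(3)[OF M c]]) (use cimgD(4)[OF M a] eq in simp)
  show ?thesis by (simp only: differential_def c_def[symmetric] Let_def eq[OF p] *)
qed

lemma differential_comp:
  assumes M: "smooth_manifold M" and N: "smooth_manifold N" and P: "smooth_manifold P"
    and f: "smooth_map M N f" and g: "smooth_map N P g" and gf: "smooth_map M P (g \<circ> f)"
    and p: "p \<in> points M" and \<xi>: "\<xi> \<in> tangent_space M p"
  shows "differential N P g (f p) (differential M N f p \<xi>) = differential M P (g \<circ> f) p \<xi>"
proof -
  obtain c where c: "c \<in> charts_at M p" using ex_chart[OF M p] by blast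
  obtain c' where c': "c' \<in> charts_at N (f p)" using ex_chart[OF N smooth_map_points[OF M N f p]] by blast
  obtain c'' where c'': "c'' \<in> charts_at P (g (f p))"
    using ex_chart[OF P smooth_map_points[OF N P g smooth_map_points[OF M N f p]]] by blast
  then have "c'' \<in> charts_at P ((g \<circ> f) p)" by simp
  moreover have gp: "(g \<circ> f) p = g (f p)" by simp
  ultimately show ?thesis
    using differential_tvec[OF M P gf c, of c'' "\<xi> c"] differential_tvec[OF M N f c c', of "\<xi> c"] differential_tvec[OF N P g c' c'', of "fd (lrep c f c') (cmap c p) (\<xi> c)"]
    by (simp only: tvec_of_chart[OF M c \<xi>] lrep_chain[OF M N P f g c c' c''] gp)
qed

text \<open>Mutually inverse maps compose to the identity on \<open>points M\<close> only, so the
  composite need not be the function \<open>id\<close>; this and \<open>differential_cong\<close>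
  bridge the gap.\<close>

lemma smooth_map_cong_id:
  assumes M: "smooth_manifold M" and eq: "\<And>p. p \<in> points M \<Longrightarrow> h p = p"
  shows "smooth_map M M h"
  unfolding smooth_map_def
proof (intro conjI ballI)
  show "continuous_map (space_of M) (space_of M) h"
    by (rule continuous_map_eq[OF continuous_map_id]) (simp add: eq)
  fix c c' assume c: "c \<in> atlas M" and c': "c' \<in> atlas M"
  have pts: "p \<in> points M" if "p \<in> cdom c" for p using atlasD(3)[OF M c] that by blast
  have "cdom c \<inter> h -` cdom c' = cdom c \<inter> id -` cdom c'" using eq pts by auto
  moreover have "smooth_on (ldom c id c') (lrep c h c')"
  proof (rule smooth_on_cong[OF ldom_open[OF M M smooth_map_id[OF M] c c']])
    show "smooth_on (ldom c id c') (lrep c id c')" by (rule lrep_smooth[OF M M smooth_map_id[OF M] c c'])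
    fix x assume "x \<in> ldom c id c'"
    then have "x \<in> cimg c" by auto
    then show "lrep c id c' x = lrep c h c' x" using cimgD(4)[OF M c] eq by simp
  qed
  ultimately show "smooth_on (ldom c h c') (lrep c h c')" by simp
qed

lemma differential_inverse:
  assumes M: "smooth_manifold M" and N: "smooth_manifold N" and f: "smooth_map M N f" and g: "smooth_map N M g"
    and gf: "\<And>p. p \<in> points M \<Longrightarrow> g (f p) = p" and p: "p \<in> points M" and \<xi>: "\<xi> \<in> tangent_space M p"
  shows "differential N M g (f p) (differential M N f p \<xi>) = \<xi>"
proof -
  have "smooth_map M M (g \<circ> f)" by (rule smooth_map_cong_id[OF M]) (simp add: gf)
  from differential_comp[OF M N M f g this p \<xi>]
  have "differential N M g (f p) (differential M N f p \<xi>) = differential M M (g \<circ> f) p \<xi>" .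
  also have "\<dots> = differential M M id p \<xi>" by (rule differential_cong[OF M p]) (simp add: gf)
  also have "\<dots> = \<xi>" by (rule differential_id[OF M p \<xi>])
  finally show ?thesis .
qed

lemma pullback_inverse:
  assumes M: "smooth_manifold M" and N: "smooth_manifold N" and f: "smooth_map M N f" and g: "smooth_map N M g"
    and gf: "\<And>p. p \<in> points M \<Longrightarrow> g (f p) = p" and \<omega>: "\<omega> \<in> forms M k"
  shows "pullback M N f (pullback N M g \<omega>) = \<omega>"
proof (intro ext)
  fix p vs show "pullback M N f (pullback N M g \<omega>) p vs = \<omega> p vs"
  proof (cases "tangent_list M p vs")
    case True
    then have p: "p \<in> points M" by (simp add: tangent_list_def)
    have "map (differential N M g (f p)) (map (differential M N f p) vs) = vs"
      unfolding map_map using True differential_inverse[OF M N f g gf p]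
      by (auto simp: tangent_list_def subset_iff intro!: map_idI)
    then show ?thesis
      using True differential_list[OF M N f True] by (simp add: pullback_def gf[OF p] del: map_map)
  qed (use forms_eq_0[OF M \<omega>] in \<open>simp add: pullback_def\<close>)
qed

context pseudo_holomorphic_map
begin

text \<open>A tangent vector \<open>\<eta>\<close> at \<open>q\<close> is the image under the
  differential of \<open>f\<close> of \<open>\<xi>\<close>, its own image under the differential of
  \<open>g\<close>. So \<open>J' q \<eta>\<close> is the image of \<open>J p \<xi>\<close>, and the
  differential of \<open>g\<close> takes it back.\<close>

lemma inverse_pseudo_holomorphic:
  assumes g: "smooth_map N M g" and gf: "\<And>p. p \<in> points M \<Longrightarrow> g (f p) = p"
    and fg: "\<And>q. q \<in> points N \<Longrightarrow> f (g q) = q"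
  shows "pseudo_holomorphic N J' M J g"
  unfolding pseudo_holomorphic_def
proof (intro conjI g ballI)
  fix q \<eta> assume q: "q \<in> points N" and \<eta>: "\<eta> \<in> tangent_space N q"
  define p \<xi> where "p = g q" and "\<xi> = differential N M g q \<eta>"
  have p: "p \<in> points M" "f p = q"
    unfolding p_def by (rule smooth_map_points[OF cod.M dom.M g q]) (rule fg[OF q])
  have \<xi>: "\<xi> \<in> tangent_space M p" "differential M N f p \<xi> = \<eta>"
    unfolding \<xi>_def p_def
    by (rule differential_tangent[OF cod.M dom.M g q \<eta>]) (rule differential_inverse[OF cod.M dom.M g f fg q \<eta>])
  have J\<xi>: "J p \<xi> \<in> tangent_space M p" using dom.J(1) p(1) \<xi>(1) by (simp add: endo_field_def)
  have "differential N M g (f p) (differential M N f p (J p \<xi>)) = J p \<xi>"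
    by (rule differential_inverse[OF dom.M cod.M f g gf p(1) J\<xi>])
  moreover have "differential M N f p (J p \<xi>) = J' q \<eta>"
    using holo p \<xi> by (simp add: pseudo_holomorphic_def)
  ultimately show "differential N M g q (J' q \<eta>) = J (g q) (differential N M g q \<eta>)"
    by (simp add: p(2) p_def[symmetric] \<xi>_def[symmetric])
qed

lemma pullback_bij:
  assumes "diffeomorphism M N f"
  shows "bij_betw (BC_pullback M J N f k) (gdeg cod.BC k) (gdeg dom.BC k)"
    "bij_betw (A_pullback M J N f k) (mdeg cod.AM k) (mdeg dom.AM k)"
proof -
  obtain g where g: "smooth_map N M g" "\<And>p. p \<in> points M \<Longrightarrow> g (f p) = p" "\<And>q. q \<in> points N \<Longrightarrow> f (g q) = q"
    using assms by (auto simp: diffeomorphism_def)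
  interpret inv: pseudo_holomorphic_map N J' M J g
    by unfold_locales (rule inverse_pseudo_holomorphic[OF g])
  have 1: "pb (inv.pb \<omega>) = \<omega>" if "\<omega> \<in> dom.F k" for \<omega>
    by (rule pullback_inverse[OF dom.M cod.M f g(1,2) that])
  have 2: "inv.pb (pb \<omega>) = \<omega>" if "\<omega> \<in> cod.F k" for \<omega>
    by (rule pullback_inverse[OF cod.M dom.M g(1) f g(3) that])
  show "bij_betw (BC_pullback M J N f k) (gdeg cod.BC k) (gdeg dom.BC k)"
    by (rule bij_betw_byWitness[where f' = "BC_pullback N J' M g k"])
      (auto simp: cod.bc_ops dom.bc_ops pb_bcc inv.pb_bcc 1 2 cod.Z_iff[THEN iffD1] dom.Z_iff[THEN iffD1] pb_Z inv.pb_Z)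
  show "bij_betw (A_pullback M J N f k) (mdeg cod.AM k) (mdeg dom.AM k)"
    by (rule bij_betw_byWitness[where f' = "A_pullback N J' M g k"])
      (auto simp: cod.ae_ops dom.ae_ops pb_ae_class[OF ZA_F] inv.pb_ae_class[OF inv.ZA_F] pb_ZA inv.pb_ZA 1 2 ZA_F inv.ZA_F)
qed

end

theorem theorem3p9:
  fixes M :: "('a, 'v::euclidean_space) manifold"
    and J :: "'a \<Rightarrow> ('a, 'v) tvec \<Rightarrow> ('a, 'v) tvec"
    and M' :: "('b, 'w::euclidean_space) manifold"
    and J' :: "'b \<Rightarrow> ('b, 'w) tvec \<Rightarrow> ('b, 'w) tvec"
    and f :: "'a \<Rightarrow> 'b"
  assumes "almost_complex_manifold M J"
    and "almost_complex_manifold M' J'"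
    and "pseudo_holomorphic M J M' J' f"
  shows
    "(\<forall>k. \<forall>\<alpha>\<in>BC_cycles M' J' k.
        pullback M M' f \<alpha> \<in> BC_cycles M J k \<and>
        BC_pullback M J M' f k (BC_class M' J' k \<alpha>) = BC_class M J k (pullback M M' f \<alpha>)) \<and>
     dga_hom (bott_chern M' J') (bott_chern M J) (BC_pullback M J M' f) \<and>
     (\<forall>k. \<forall>\<gamma>\<in>forms M' k. C_class M' J' k \<gamma> \<in> A_cycles M' J' k \<longrightarrow>
        C_class M J k (pullback M M' f \<gamma>) \<in> A_cycles M J k \<and>
        A_pullback M J M' f k (A_class M' J' k (C_class M' J' k \<gamma>))
          = A_class M J k (C_class M J k (pullback M M' f \<gamma>))) \<and>
     dg_module_hom (bott_chern M' J') (aeppli M' J') (bott_chern M J) (aeppli M J)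
       (BC_pullback M J M' f) (A_pullback M J M' f) \<and>
     (diffeomorphism M M' f \<longrightarrow>
        dga_iso (bott_chern M' J') (bott_chern M J) (BC_pullback M J M' f) \<and>
        dg_module_iso (bott_chern M' J') (aeppli M' J') (bott_chern M J) (aeppli M J)
          (BC_pullback M J M' f) (A_pullback M J M' f))"
proof -
  interpret pseudo_holomorphic_map M J M' J' f
    by unfold_locales (fact assms)+
  show ?thesis
    using pullback_classes BC_pullback_hom A_pullback_hom pullback_bij
    by (simp add: dga_iso_def dg_module_iso_def)
qed

end
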